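(* Let $J$ be a countable linearly ordered set and let $\mathcal{B}$ be one of the classes $\mathcal{B}_J$, $\mathcal{B}_u$, $\mathcal{B}_J^u$. Let $\mathcal{C}_{\mathcal{B}}$ and $\mathcal{C}_{\mathcal{B}}^{<}$ be the Fraïssé limits of $\mathcal{B}$ and $\mathrm{NA}(\mathcal{B})$ respectively. Then: (a) the universal minimal flow of the group $\mathrm{Aut}(\mathcal{C}_{\mathcal{B}})$ is the space $\mathrm{NO}_{\mathcal{B}}(\mathcal{C}_{\mathcal{B}})$; (b) the group $\mathrm{Aut}(\mathcal{C}_{\mathcal{B}}^{<})$ is extremely amenable.
   Context: Let $L_J=\{\vee,\wedge,0,1,\neg\}\cup\{P_j:j\in J\}$ be the language of Boolean algebras expanded by unary predicate symbols $P_j$ ($j\in J$), and $L_1=\{\vee,\wedge,0,1,\neg,P_0\}$ (the case $J=\{0\}$). An ideal on a Boolean algebra is a subset containing $0$, downward closed under the canonical order and closed under finite joins; ideals are assumed non-trivial, i.e. not containing $1$. $\mathcal{B}_J$: isomorphism types of finite Boolean algebras $A$ in the language $L_J$ in which each $P_j$ is an ideal, $P_i\subseteq P_j$ for $i<j$ in $J$, and at least one atom of $A$ lies in no $P_j$. $\mathcal{B}_u$: isomorphism types of finite Boolean algebras $A$ in the language $L_1$ in which $P_0$ is an ideal and exactly one atom of $A$ is not in $P_0$. $\mathcal{B}_J^u$: isomorphism types of finite Boolean algebras $A$ in the language $L_J$ in which each $P_j$ is an ideal, $P_i\subseteq P_j$ for $i<j$ in $J$, and exactly one atom of $A$ lies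 in no $P_j$. Proper and natural orderings: a linear ordering $<$ of the atoms of a finite Boolean algebra $A$ in $L_J$ is proper if for all atoms $a,b$ of $A$ and all $i\in J$ with $a\in P_i$, we have $a<b$ whenever either $b\in P_j\setminus P_i$ for some $j>i$, or $b\notin P_k$ for every $k\in J$. A linear ordering of $A$ is natural if it is the antilexicographical extension of a proper ordering $a_1<\dots<a_n$ of its atoms: for distinct $x,y\in A$, $x<y$ iff, for the largest $m$ such that exactly one of $a_m\le x$, $a_m\le y$ holds (with $\le$ the Boolean order), we have $a_m\le y$. $\mathrm{NA}(\mathcal{B})$ is the class of all structures $(A,<)$ with $A\in\mathcal{B}$ and $<$ a natural ordering of $A$. The Fraïssé limit of a class is the unique (up to isomorphism) countable, locally finite, homogeneous structure whose class of finite substructures, up to isomorphism, is the given class. Automorphism groups carry the topology of pointwise convergence (underlying structure discrete). $\mathrm{NO}_{\mathcal{B}}(\mathcal{C}_{\mathcal{B}})$ is the set of all linear orderings $<$ of $\mathcal{C}_{\mathcal{B}}$ (called normal) whose restriction to every finite substructure $A$ of $\mathcal{C}_{\mathcal{B}}$ is a natural ordering of $A$; it has the subspace topology from $2^{\mathcal{C}_{\mathcal{B}}\times\mathcal{C}_{\mathcal{B}}}$, and $G=\mathrm{Aut}(\mathcal{C}_{\mathcal{B}})$ acts by $a\,(g{<})\,b\iff g^{-1}a<g^{-1}b$. For a topological group $G$, a $G$-flow is a continuous action of $G$ on a compact Hausdorff space; the universal minimal flow is the (unique up to isomorphism of $G$-flows) minimal $G$-flow having every minimal $G$-flow as a factor.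 "Is" means isomorphic as $G$-flows. $G$ is extremely amenable if every $G$-flow has a fixed point. *)

theory Defs
  imports "HOL-Analysis.Analysis" "HOL-Algebra.Group_Action"
begin

section \<open>First-order structures\<close>

record ('f, 'r) lang =
  fsyms :: "'f set"
  farity :: "'f \<Rightarrow> nat"
  rsyms :: "'r set"
  rarity :: "'r \<Rightarrow> nat"

record ('a, 'f, 'r) struct =
  univ :: "'a set"
  fint :: "'f \<Rightarrow> 'a list \<Rightarrow> 'a"
  rint :: "'r \<Rightarrow> 'a list \<Rightarrow> bool"

definition tuples :: "nat \<Rightarrow> 'a set \<Rightarrow> 'a list set" where
  "tuples n A = {xs. length xs = n \<and> set xs \<subseteq> A}"

text \<open>Interpretations are total functions on lists; only their values at tuples from the
  universe, of the arity prescribed by the language, are ever looked at.\<close>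

definition is_struct :: "('f, 'r) lang \<Rightarrow> ('a, 'f, 'r) struct \<Rightarrow> bool" where
  "is_struct L M \<longleftrightarrow>
     (\<forall>f\<in>fsyms L. \<forall>xs\<in>tuples (farity L f) (univ M). fint M f xs \<in> univ M)"

definition induced :: "('a, 'f, 'r) struct \<Rightarrow> 'a set \<Rightarrow> ('a, 'f, 'r) struct" where
  "induced M S = M\<lparr>univ := S\<rparr>"

definition substructure :: "('f, 'r) lang \<Rightarrow> ('a, 'f, 'r) struct \<Rightarrow> 'a set \<Rightarrow> bool" where
  "substructure L M S \<longleftrightarrow> S \<subseteq> univ M \<and> is_struct L (induced M S)"

definition struct_iso ::
    "('f, 'r) lang \<Rightarrow> ('a, 'f, 'r) struct \<Rightarrow> ('b, 'f, 'r) struct \<Rightarrow> ('a \<Rightarrow> 'b) \<Rightarrow> bool" where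
  "struct_iso L M N h \<longleftrightarrow>
     bij_betw h (univ M) (univ N) \<and>
     (\<forall>f\<in>fsyms L. \<forall>xs\<in>tuples (farity L f) (univ M). h (fint M f xs) = fint N f (map h xs)) \<and>
     (\<forall>r\<in>rsyms L. \<forall>xs\<in>tuples (rarity L r) (univ M). rint M r xs \<longleftrightarrow> rint N r (map h xs))"

definition isomorphic ::
    "('f, 'r) lang \<Rightarrow> ('a, 'f, 'r) struct \<Rightarrow> ('b, 'f, 'r) struct \<Rightarrow> bool" where
  "isomorphic L M N \<longleftrightarrow> (\<exists>h. struct_iso L M N h)"

definition locally_finite :: "('f, 'r) lang \<Rightarrow> ('a, 'f, 'r) struct \<Rightarrow> bool" where
  "locally_finite L M \<longleftrightarrow>
     (\<forall>X. X \<subseteq> univ M \<and> finite X \<longrightarrow> finite (substructure L M hull X))"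

definition homogeneous :: "('f, 'r) lang \<Rightarrow> ('a, 'f, 'r) struct \<Rightarrow> bool" where
  "homogeneous L M \<longleftrightarrow>
     (\<forall>S T h. substructure L M S \<and> finite S \<and> substructure L M T \<and> finite T \<and>
        struct_iso L (induced M S) (induced M T) h \<longrightarrow>
        (\<exists>g. struct_iso L M M g \<and> (\<forall>x\<in>S. g x = h x)))"

text \<open>Every finite structure is isomorphic to one whose universe is a set of natural numbers, so
  a class of isomorphism types of finite structures is given by its members of that kind.\<close>

definition has_age ::
    "('f, 'r) lang \<Rightarrow> (nat, 'f, 'r) struct set \<Rightarrow> ('a, 'f, 'r) struct \<Rightarrow> bool" where
  "has_age L K M \<longleftrightarrow>
     (\<forall>S. substructure L M S \<and> finite S \<longrightarrow> (\<exists>A\<in>K. isomorphic L (induced M S) A)) \<and>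
     (\<forall>A\<in>K. \<exists>S. substructure L M S \<and> finite S \<and> isomorphic L (induced M S) A)"

definition fraisse_limit ::
    "('f, 'r) lang \<Rightarrow> (nat, 'f, 'r) struct set \<Rightarrow> ('a, 'f, 'r) struct \<Rightarrow> bool" where
  "fraisse_limit L K M \<longleftrightarrow>
     is_struct L M \<and> countable (univ M) \<and> locally_finite L M \<and> homogeneous L M \<and> has_age L K M"


section \<open>Automorphism groups and their flows\<close>

definition automorphisms :: "('f, 'r) lang \<Rightarrow> ('a, 'f, 'r) struct \<Rightarrow> ('a \<Rightarrow> 'a) set" where
  "automorphisms L M = {g \<in> Bij (univ M). struct_iso L M M g}"

definition Aut :: "('f, 'r) lang \<Rightarrow> ('a, 'f, 'r) struct \<Rightarrow> ('a \<Rightarrow> 'a) monoid" where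
  "Aut L M = BijGroup (univ M) \<lparr>carrier := automorphisms L M\<rparr>"

definition Aut_topology :: "('f, 'r) lang \<Rightarrow> ('a, 'f, 'r) struct \<Rightarrow> ('a \<Rightarrow> 'a) topology" where
  "Aut_topology L M =
     subtopology (product_topology (\<lambda>_. discrete_topology (univ M)) (univ M)) (automorphisms L M)"

text \<open>The spaces underlying flows are required to be nonempty, as usual; otherwise no group would
  be extremely amenable.\<close>

definition flow ::
    "('g, 'm) monoid_scheme \<Rightarrow> 'g topology \<Rightarrow> 'x topology \<Rightarrow> ('g \<Rightarrow> 'x \<Rightarrow> 'x) \<Rightarrow> bool" where
  "flow G T X \<phi> \<longleftrightarrow>
     compact_space X \<and> Hausdorff_space X \<and> topspace X \<noteq> {} \<and>
     group_action G (topspace X) \<phi> \<and>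
     continuous_map (prod_topology T X) X (\<lambda>(g, x). \<phi> g x)"

definition minimal_flow ::
    "('g, 'm) monoid_scheme \<Rightarrow> 'g topology \<Rightarrow> 'x topology \<Rightarrow> ('g \<Rightarrow> 'x \<Rightarrow> 'x) \<Rightarrow> bool" where
  "minimal_flow G T X \<phi> \<longleftrightarrow>
     flow G T X \<phi> \<and>
     (\<forall>F. closedin X F \<and> F \<noteq> {} \<and> (\<forall>g\<in>carrier G. \<forall>x\<in>F. \<phi> g x \<in> F) \<longrightarrow> F = topspace X)"

definition flow_factor ::
    "('g, 'm) monoid_scheme \<Rightarrow> 'x topology \<Rightarrow> ('g \<Rightarrow> 'x \<Rightarrow> 'x) \<Rightarrow>
     'y topology \<Rightarrow> ('g \<Rightarrow> 'y \<Rightarrow> 'y) \<Rightarrow> bool" where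
  "flow_factor G X \<phi> Y \<psi> \<longleftrightarrow>
     (\<exists>p. continuous_map X Y p \<and> p ` topspace X = topspace Y \<and>
        (\<forall>g\<in>carrier G. \<forall>x\<in>topspace X. p (\<phi> g x) = \<psi> g (p x)))"

text \<open>The type argument is the type of points of the test flows. A statement about all flows leaves
  it as a free type variable.\<close>

definition universal_minimal_flow ::
    "'y itself \<Rightarrow> ('g, 'm) monoid_scheme \<Rightarrow> 'g topology \<Rightarrow>
     'x topology \<Rightarrow> ('g \<Rightarrow> 'x \<Rightarrow> 'x) \<Rightarrow> bool" where
  "universal_minimal_flow (_ :: 'y itself) G T X \<phi> \<longleftrightarrow>
     minimal_flow G T X \<phi> \<and>
     (\<forall>(Y :: 'y topology) \<psi>. minimal_flow G T Y \<psi> \<longrightarrow> flow_factor G X \<phi> Y \<psi>)"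

definition extremely_amenable ::
    "'y itself \<Rightarrow> ('g, 'm) monoid_scheme \<Rightarrow> 'g topology \<Rightarrow> bool" where
  "extremely_amenable (_ :: 'y itself) G T \<longleftrightarrow>
     (\<forall>(Y :: 'y topology) \<psi>. flow G T Y \<psi> \<longrightarrow>
        (\<exists>y\<in>topspace Y. \<forall>g\<in>carrier G. \<psi> g y = y))"


section \<open>Boolean algebras with distinguished ideals\<close>

datatype bool_sym = Join | Meet | Zero | One | Neg

fun bool_arity :: "bool_sym \<Rightarrow> nat" where
  "bool_arity Join = 2"
| "bool_arity Meet = 2"
| "bool_arity Zero = 0"
| "bool_arity One = 0"
| "bool_arity Neg = 1"

text \<open>The predicate symbol \<open>P\<^sub>j\<close> is represented by its index \<open>j\<close>.\<close>

definition ideal_lang :: "'j set \<Rightarrow> (bool_sym, 'j) lang" where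
  "ideal_lang J = \<lparr>fsyms = UNIV, farity = bool_arity, rsyms = J, rarity = (\<lambda>_. 1)\<rparr>"

type_synonym ('a, 'j) ideal_struct = "('a, bool_sym, 'j) struct"

abbreviation bjoin :: "('a, 'j) ideal_struct \<Rightarrow> 'a \<Rightarrow> 'a \<Rightarrow> 'a" where
  "bjoin A x y \<equiv> fint A Join [x, y]"

abbreviation bmeet :: "('a, 'j) ideal_struct \<Rightarrow> 'a \<Rightarrow> 'a \<Rightarrow> 'a" where
  "bmeet A x y \<equiv> fint A Meet [x, y]"

abbreviation bneg :: "('a, 'j) ideal_struct \<Rightarrow> 'a \<Rightarrow> 'a" where
  "bneg A x \<equiv> fint A Neg [x]"

abbreviation bzero :: "('a, 'j) ideal_struct \<Rightarrow> 'a" where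
  "bzero A \<equiv> fint A Zero []"

abbreviation bone :: "('a, 'j) ideal_struct \<Rightarrow> 'a" where
  "bone A \<equiv> fint A One []"

text \<open>The axioms are those of the library locale \<^locale>\<open>abstract_boolean_algebra\<close>, relativised to
  the universe.\<close>

definition is_boolean_algebra :: "('a, 'j) ideal_struct \<Rightarrow> bool" where
  "is_boolean_algebra A \<longleftrightarrow>
     is_struct (ideal_lang {}) A \<and>
     (\<forall>x\<in>univ A. \<forall>y\<in>univ A. \<forall>z\<in>univ A.
        bmeet A (bmeet A x y) z = bmeet A x (bmeet A y z) \<and>
        bjoin A (bjoin A x y) z = bjoin A x (bjoin A y z) \<and>
        bmeet A x (bjoin A y z) = bjoin A (bmeet A x y) (bmeet A x z) \<and>
        bjoin A x (bmeet A y z) = bmeet A (bjoin A x y) (bjoin A x z)) \<and>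
     (\<forall>x\<in>univ A. \<forall>y\<in>univ A. bmeet A x y = bmeet A y x \<and> bjoin A x y = bjoin A y x) \<and>
     (\<forall>x\<in>univ A.
        bmeet A x (bone A) = x \<and> bjoin A x (bzero A) = x \<and>
        bmeet A x (bneg A x) = bzero A \<and> bjoin A x (bneg A x) = bone A)"

definition ble :: "('a, 'j) ideal_struct \<Rightarrow> 'a \<Rightarrow> 'a \<Rightarrow> bool" where
  "ble A x y \<longleftrightarrow> bmeet A x y = x"

definition atoms :: "('a, 'j) ideal_struct \<Rightarrow> 'a set" where
  "atoms A = {a \<in> univ A. a \<noteq> bzero A \<and> (\<forall>x\<in>univ A. ble A x a \<longrightarrow> x = bzero A \<or> x = a)}"

definition pset :: "('a, 'j) ideal_struct \<Rightarrow> 'j \<Rightarrow> 'a set" where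
  "pset A j = {x \<in> univ A. rint A j [x]}"

definition is_ideal :: "('a, 'j) ideal_struct \<Rightarrow> 'a set \<Rightarrow> bool" where
  "is_ideal A I \<longleftrightarrow>
     I \<subseteq> univ A \<and> bzero A \<in> I \<and> bone A \<notin> I \<and>
     (\<forall>x\<in>univ A. \<forall>y\<in>I. ble A x y \<longrightarrow> x \<in> I) \<and>
     (\<forall>x\<in>I. \<forall>y\<in>I. bjoin A x y \<in> I)"

definition free_atoms :: "'j set \<Rightarrow> ('a, 'j) ideal_struct \<Rightarrow> 'a set" where
  "free_atoms J A = {a \<in> atoms A. \<forall>j\<in>J. a \<notin> pset A j}"

definition class_B :: "'j::linorder set \<Rightarrow> ('a, 'j) ideal_struct set" where
  "class_B J = {A. is_struct (ideal_lang J) A \<and> finite (univ A) \<and> is_boolean_algebra A \<and>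
     (\<forall>j\<in>J. is_ideal A (pset A j)) \<and>
     (\<forall>i\<in>J. \<forall>j\<in>J. i < j \<longrightarrow> pset A i \<subseteq> pset A j) \<and>
     (\<exists>a. a \<in> free_atoms J A)}"

text \<open>The parameter \<open>z\<close> is the index of the single predicate symbol \<open>P\<^sub>0\<close> of \<open>L\<^sub>1\<close>.\<close>

definition class_B_u :: "'j \<Rightarrow> ('a, 'j) ideal_struct set" where
  "class_B_u z = {A. is_struct (ideal_lang {z}) A \<and> finite (univ A) \<and> is_boolean_algebra A \<and>
     is_ideal A (pset A z) \<and>
     (\<exists>!a. a \<in> atoms A \<and> a \<notin> pset A z)}"

definition class_B_J_u :: "'j::linorder set \<Rightarrow> ('a, 'j) ideal_struct set" where
  "class_B_J_u J = {A. is_struct (ideal_lang J) A \<and> finite (univ A) \<and> is_boolean_algebra A \<and>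
     (\<forall>j\<in>J. is_ideal A (pset A j)) \<and>
     (\<forall>i\<in>J. \<forall>j\<in>J. i < j \<longrightarrow> pset A i \<subseteq> pset A j) \<and>
     (\<exists>!a. a \<in> free_atoms J A)}"


section \<open>Natural orderings\<close>

text \<open>Orderings are strict and are represented as sets of pairs.\<close>

definition linear_ordering :: "'a set \<Rightarrow> ('a \<times> 'a) set \<Rightarrow> bool" where
  "linear_ordering A R \<longleftrightarrow> R \<subseteq> A \<times> A \<and> strict_linear_order_on A R"

definition proper_ordering ::
    "'j::linorder set \<Rightarrow> ('a, 'j) ideal_struct \<Rightarrow> ('a \<times> 'a) set \<Rightarrow> bool" where
  "proper_ordering J A S \<longleftrightarrow>
     linear_ordering (atoms A) S \<and>
     (\<forall>a\<in>atoms A. \<forall>b\<in>atoms A. \<forall>i\<in>J. a \<in> pset A i \<longrightarrow>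
        (\<exists>j\<in>J. i < j \<and> b \<in> pset A j - pset A i) \<or> (\<forall>k\<in>J. b \<notin> pset A k) \<longrightarrow> (a, b) \<in> S)"

definition antilex_extension ::
    "('a, 'j) ideal_struct \<Rightarrow> ('a \<times> 'a) set \<Rightarrow> ('a \<times> 'a) set \<Rightarrow> bool" where
  "antilex_extension A S R \<longleftrightarrow>
     (\<forall>x\<in>univ A. \<forall>y\<in>univ A. x \<noteq> y \<longrightarrow>
        ((x, y) \<in> R \<longleftrightarrow>
         (let D = {a \<in> atoms A. ble A a x \<noteq> ble A a y}
          in \<exists>m\<in>D. (\<forall>a\<in>D. a \<noteq> m \<longrightarrow> (a, m) \<in> S) \<and> ble A m y)))"

definition natural_ordering ::
    "'j::linorder set \<Rightarrow> ('a, 'j) ideal_struct \<Rightarrow> ('a \<times> 'a) set \<Rightarrow> bool" where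
  "natural_ordering J A R \<longleftrightarrow>
     linear_ordering (univ A) R \<and> (\<exists>S. proper_ordering J A S \<and> antilex_extension A S R)"

datatype 'j ord_sym = Pred 'j | Less

definition ord_lang :: "'j set \<Rightarrow> (bool_sym, 'j ord_sym) lang" where
  "ord_lang J = \<lparr>fsyms = UNIV, farity = bool_arity, rsyms = insert Less (Pred ` J),
     rarity = (\<lambda>r. case r of Pred _ \<Rightarrow> 1 | Less \<Rightarrow> 2)\<rparr>"

definition ord_expansion ::
    "('a, 'j) ideal_struct \<Rightarrow> ('a \<times> 'a) set \<Rightarrow> ('a, bool_sym, 'j ord_sym) struct" where
  "ord_expansion A R = \<lparr>univ = univ A, fint = fint A,
     rint = (\<lambda>r xs. case r of Pred j \<Rightarrow> rint A j xs | Less \<Rightarrow> (xs ! 0, xs ! 1) \<in> R)\<rparr>"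

definition class_NA ::
    "'j::linorder set \<Rightarrow> ('a, 'j) ideal_struct set \<Rightarrow> ('a, bool_sym, 'j ord_sym) struct set" where
  "class_NA J B = {ord_expansion A R | A R. A \<in> B \<and> natural_ordering J A R}"

definition normal_orderings ::
    "'j::linorder set \<Rightarrow> ('a, 'j) ideal_struct \<Rightarrow> ('a \<times> 'a) set set" where
  "normal_orderings J C = {R. linear_ordering (univ C) R \<and>
     (\<forall>S. substructure (ideal_lang J) C S \<and> finite S \<longrightarrow>
        natural_ordering J (induced C S) (R \<inter> S \<times> S))}"

text \<open>The subspace topology from \<open>2\<^bsup>C \<times> C\<^esup>\<close>, where a relation is identified with its characteristic
  function on \<open>C \<times> C\<close>.\<close>

definition normal_topology ::
    "'j::linorder set \<Rightarrow> ('a, 'j) ideal_struct \<Rightarrow> ('a \<times> 'a) set topology" where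
  "normal_topology J C =
     pullback_topology (normal_orderings J C) (\<lambda>R. \<lambda>p\<in>univ C \<times> univ C. p \<in> R)
       (product_topology (\<lambda>_. discrete_topology (UNIV :: bool set)) (univ C \<times> univ C))"

definition normal_action ::
    "'j::linorder set \<Rightarrow> ('a, 'j) ideal_struct \<Rightarrow> ('a \<Rightarrow> 'a) \<Rightarrow>
     ('a \<times> 'a) set \<Rightarrow> ('a \<times> 'a) set" where
  "normal_action J C g = (\<lambda>R\<in>normal_orderings J C.
     {(a, b). a \<in> univ C \<and> b \<in> univ C \<and> (inv_into (univ C) g a, inv_into (univ C) g b) \<in> R})"

end

theory Submission
  imports Defs
begin

text \<open>
The proof follows the method of Kechris, Pestov and Todorcevic, which derives statements about flows
of automorphism groups from a Ramsey theorem for finite structures.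

Finite structures and Ramsey theorem. A finite Boolean algebra with increasing ideals is determined
by its atoms and, for each atom, by the upward closed set of indices of the ideals that contain it.
A natural ordering lists the atoms from the largest one downwards with increasing sets of indices, and
compares elements by the first atom at which they differ (\<open>class_iso\<close>, \<open>iso_natural_ordering\<close>). Order
preserving embeddings are dual to words that introduce their letters in order, each at a position
of the right type (\<open>emb_pull\<close>, \<open>ordered_emb_factor\<close>). The Ramsey theorem for embeddings is therefore a
statement about such words. For a single type it is the Graham-Rothschild theorem on parameter words,
deduced here from the Hales-Jewett theorem; several types are treated block by block
(\<open>graham_rothschild\<close>, \<open>typed_graham_rothschild\<close>, \<open>dual_ramsey\<close>).

From colourings to flows. A continuous function \<open>f\<close> on a flow and a point \<open>y\<close> colour the group: the colour
of \<open>g\<close> is the approximate value of \<open>f\<close> at the translate of \<open>y\<close> by the inverse of \<open>g\<close>. Since the space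
is compact, this colour depends, up to a small error, only on the restriction of \<open>g\<close> to a finite
substructure. The Ramsey theorem and compactness provide a point \<open>y\<close> for which it depends only on
the order type induced on the image of this substructure (\<open>homogeneous_translate\<close>,
\<open>almost_constant_point\<close>). If the group preserves the ordering, there is only one such type, and \<open>y\<close> is
a fixed point (\<open>fixed_point\<close>); this gives extreme amenability.

For the unordered limit, \<open>R\<close> is any normal ordering. Then the translate of \<open>y\<close> by \<open>g\<close> is a uniformly
continuous function of the translate of \<open>R\<close> by \<open>g\<close>, and extends to a map from the closure of the orbit
of \<open>R\<close>. This closure consists of all normal orderings: two natural orderings of a finite structure
always differ by an automorphism (\<open>emb_label_unique\<close>), which homogeneity extends to the limit, so that
every orbit of normal orderings is dense (\<open>conjugate_on_finite\<close>, \<open>normal_minimal\<close>). In this way the space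
of normal orderings is minimal and maps onto every minimal flow (\<open>normal_universal\<close>).
\<close>

section \<open>The Hales-Jewett theorem\<close>

text \<open>The partition relation of Ramsey theory. In its uses below, the members of \<open>H\<close> are the sets of all
copies of a small configuration inside the various copies of a larger one.\<close>

definition arrows :: "nat \<Rightarrow> 'w set set \<Rightarrow> bool" where
  "arrows r H \<longleftrightarrow> (\<forall>c :: 'w \<Rightarrow> nat. (\<forall>w. c w < r) \<longrightarrow> (\<exists>S\<in>H. \<exists>k. \<forall>w\<in>S. c w = k))"

text \<open>Colours need not be numbers. In the product arguments a colour is a whole function, and the number
of colours enters only through the bound \<open>card K < r\<close>.\<close>

lemma arrowsD:
  assumes "arrows r H" "finite K" "card K < r" "\<And>S w. S \<in> H \<Longrightarrow> w \<in> S \<Longrightarrow> c w \<in> K"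
  shows "\<exists>S\<in>H. \<exists>k. \<forall>w\<in>S. c w = k"
proof -
  obtain i where i: "inj_on i K" "i ` K = {0..<card K}"
    using ex_bij_betw_finite_nat[OF assms(2)] by (auto simp: bij_betw_def)
  define d where "d w = (if c w \<in> K then i (c w) else 0)" for w
  have "d w < r" for w
  proof (cases "c w \<in> K")
    case True
    hence "i (c w) \<in> {0..<card K}" using i(2) by blast
    thus ?thesis using True assms(3) by (simp add: d_def)
  qed (use assms(3) in \<open>auto simp: d_def\<close>)
  then obtain S k where S: "S \<in> H" "\<forall>w\<in>S. d w = k" using assms(1) unfolding arrows_def by blast
  have "\<forall>w\<in>S. c w = inv_into K i k"
  proof
    fix w assume w: "w \<in> S"
    have "c w \<in> K" using assms(4) S w by blast
    moreover have "i (c w) = k" using S(2) w \<open>c w \<in> K\<close> by (auto simp: d_def)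
    ultimately show "c w = inv_into K i k" using i(1) by auto
  qed
  thus ?thesis using S(1) by blast
qed

lemma finite_words: "finite A \<Longrightarrow> finite {u. length u = n \<and> set u \<subseteq> A}"
  using finite_lists_length_eq[of A n] by (simp add: conj_commute)

text \<open>A combinatorial line is a word in which \<open>None\<close> stands for the variable, which has to occur.\<close>

definition line :: "'s set \<Rightarrow> nat \<Rightarrow> 's option list \<Rightarrow> bool" where
  "line A N L \<longleftrightarrow> length L = N \<and> set L \<subseteq> insert None (Some ` A) \<and> None \<in> set L"

definition fill :: "'s \<Rightarrow> 's option list \<Rightarrow> 's list" where
  "fill x L = map (\<lambda>y. case y of None \<Rightarrow> x | Some y \<Rightarrow> y) L"

lemma fill_append [simp]: "fill x (L @ M) = fill x L @ fill x M"
  by (simp add: fill_def)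

lemma fill_Some [simp]: "fill x (map Some w) = w"
  by (simp add: fill_def comp_def)

lemma length_fill [simp]: "length (fill x L) = length L"
  by (simp add: fill_def)

lemma set_fill: "line A N L \<Longrightarrow> x \<in> A \<Longrightarrow> set (fill x L) \<subseteq> A"
  by (auto simp: fill_def line_def split: option.splits)

lemma line_append:
  "line A N L \<Longrightarrow> length M = N' \<Longrightarrow> set M \<subseteq> insert None (Some ` A) \<Longrightarrow> line A (N + N') (L @ M)"
  "line A N L \<Longrightarrow> length M = N' \<Longrightarrow> set M \<subseteq> insert None (Some ` A) \<Longrightarrow> line A (N' + N) (M @ L)"
  by (auto simp: line_def)

lemma line_mono: "line A N L \<Longrightarrow> A \<subseteq> B \<Longrightarrow> line B N L"
  unfolding line_def by blast

text \<open>The lines of the colour focusing argument. Their common value \<open>f\<close> at the letter \<open>a\<close> is the focus, and their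
values at the other letters have \<open>s\<close> different colours.\<close>

definition focused_lines :: "'s set \<Rightarrow> 's \<Rightarrow> nat \<Rightarrow> ('s list \<Rightarrow> nat) \<Rightarrow> nat \<Rightarrow> bool" where
  "focused_lines A a N c s \<longleftrightarrow>
    (\<exists>f K. length f = N \<and> set f \<subseteq> insert a A \<and> finite K \<and> card K = s \<and>
       (\<forall>k\<in>K. \<exists>L. line (insert a A) N L \<and> fill a L = f \<and> (\<forall>x\<in>A. c (fill x L) = k)))"

definition mono_line :: "'s set \<Rightarrow> nat \<Rightarrow> ('s list \<Rightarrow> nat) \<Rightarrow> bool" where
  "mono_line A N c \<longleftrightarrow> (\<exists>L k. line A N L \<and> (\<forall>x\<in>A. c (fill x L) = k))"

text \<open>The colour focusing argument. Words of length \<open>N + M\<close> are split as \<open>u @ v\<close>. The Hales-Jewett theorem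
for the smaller alphabet, applied to colourings of \<open>v\<close> by functions of \<open>u\<close>, yields a line on the right
along which the colour depends on \<open>u\<close> only. Lines focused for the induced colouring of \<open>u\<close>, each
prolonged by that line, remain focused, and the constant word at the old focus prolonged by it is
one line more.\<close>

lemma focusing:
  assumes fin: "finite A" and ne: "A \<noteq> {}"
    and HJ: "\<And>r. \<exists>N. arrows r {(\<lambda>x. fill x L) ` A | L. line A N L}"
  shows "\<exists>N. \<forall>c :: 's list \<Rightarrow> nat. (\<forall>w. c w < r) \<longrightarrow>
    mono_line (insert a A) N c \<or>
    focused_lines A a N c s"
proof (induction s)
  case 0
  show ?case
    unfolding focused_lines_def
    by (rule exI[of _ 0], intro allI impI disjI2 exI[of _ "[]"] exI[of _ "{}"]) auto
next
  case (Suc s)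
  let ?A = "insert a A"
  from Suc obtain N where N: "\<And>c :: 's list \<Rightarrow> nat. (\<And>w. c w < r) \<Longrightarrow>
    mono_line ?A N c \<or>
    focused_lines A a N c s" by blast
  define F where "F = {u. length u = N \<and> set u \<subseteq> ?A}"
  have finF: "finite F" unfolding F_def using fin by (intro finite_words) auto
  define K0 where "K0 = (PiE F (\<lambda>_. {..<r}))"
  have finK0: "finite K0" unfolding K0_def using finF by (intro finite_PiE) auto
  obtain M where M: "arrows (Suc (card K0)) {(\<lambda>x. fill x L) ` A | L. line A M L}" using HJ by blast
  obtain x0 where x0: "x0 \<in> A" using ne by auto
  show ?case
  proof (rule exI[of _ "N + M"], intro allI impI)
    fix c :: "'s list \<Rightarrow> nat" assume c: "\<forall>w. c w < r"
    have "\<exists>S\<in>{(\<lambda>x. fill x L) ` A | L. line A M L}. \<exists>k. \<forall>v\<in>S. (\<lambda>u\<in>F. c (u @ v)) = k"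
      by (rule arrowsD[OF M finK0]) (use c in \<open>auto simp: K0_def\<close>)
    then obtain L k0 where L: "line A M L" and k0: "\<And>x. x \<in> A \<Longrightarrow> (\<lambda>u\<in>F. c (u @ fill x L)) = k0"
      by blast
    \<comment> \<open>The colour of \<open>u @ fill x L\<close> does not depend on the letter \<open>x\<close> of \<open>A\<close>; the representative \<open>x0\<close> is arbitrary.\<close>
    define d where "d u = c (u @ fill x0 L)" for u
    have dF: "c (u @ fill x L) = d u" if "u \<in> F" "x \<in> A" for u x
    proof -
      have "(\<lambda>u\<in>F. c (u @ fill x L)) u = (\<lambda>u\<in>F. c (u @ fill x0 L)) u"
        using k0[OF that(2)] k0[OF x0] by simp
      thus ?thesis using that by (simp add: d_def)
    qed
    have L': "line ?A M L" using L by (rule line_mono) auto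
    have Lset: "set L \<subseteq> insert None (Some ` ?A)" "length L = M" using L' by (auto simp: line_def)
    have dr: "\<And>w. d w < r" using c by (simp add: d_def)
    have mono_case: "mono_line ?A (N + M) c"
      if "line ?A N L1" "\<forall>x\<in>?A. d (fill x L1) = k" for L1 k
    unfolding mono_line_def
    proof (intro exI conjI)
      show "line ?A (N + M) (L1 @ map Some (fill x0 L))"
        using that(1) set_fill[OF L x0] Lset by (intro line_append) auto
      show "\<forall>x\<in>?A. c (fill x (L1 @ map Some (fill x0 L))) = k" using that(2) by (simp add: d_def)
    qed
    from N[of d, OF dr] show "mono_line ?A (N + M) c \<or>
      focused_lines A a (N + M) c (Suc s)"
    proof
      assume "mono_line ?A N d"
      thus ?thesis using mono_case unfolding mono_line_def by blast
    next
      assume "focused_lines A a N d s"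
      then obtain f K where f: "length f = N" "set f \<subseteq> ?A" and K: "finite K" "card K = s"
        and foc: "\<And>k. k \<in> K \<Longrightarrow> \<exists>L. line ?A N L \<and> fill a L = f \<and> (\<forall>x\<in>A. d (fill x L) = k)"
        unfolding focused_lines_def by blast
      show ?thesis
      \<comment> \<open>If the colour of the focus is already among the focused colours, then the line of that colour is
monochromatic on the larger alphabet; otherwise the focus supplies the new colour.\<close>
      proof (cases "d f \<in> K")
        case True
        then obtain L1 where "line ?A N L1" "fill a L1 = f" "\<forall>x\<in>A. d (fill x L1) = d f" using foc by blast
        hence "\<forall>x\<in>?A. d (fill x L1) = d f" by auto
        thus ?thesis using mono_case \<open>line ?A N L1\<close> by blast
      next
        case False
        have lines: "\<exists>L2. line ?A (N + M) L2 \<and> fill a L2 = f @ fill a L \<and> (\<forall>x\<in>A. c (fill x L2) = k)"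
          if k: "k \<in> insert (d f) K" for k
        proof (cases "k = d f")
          case True
          have "f \<in> F" using f by (simp add: F_def)
          have "line ?A (N + M) (map Some f @ L)" using L' f by (intro line_append) auto
          moreover have "\<forall>x\<in>A. c (fill x (map Some f @ L)) = k" using dF[OF \<open>f \<in> F\<close>] True by simp
          ultimately show ?thesis by (intro exI[of _ "map Some f @ L"]) auto
        next
          case False
          then obtain L1 where L1: "line ?A N L1" "fill a L1 = f" "\<forall>x\<in>A. d (fill x L1) = k"
            using foc k by blast
          have "fill x L1 \<in> F" if "x \<in> A" for x
            using set_fill[OF L1(1)] that L1(1) by (auto simp: F_def line_def)
          hence "\<forall>x\<in>A. c (fill x (L1 @ L)) = k" using dF L1(3) by simp
          moreover have "line ?A (N + M) (L1 @ L)" using L1(1) Lset by (intro line_append) auto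
          ultimately show ?thesis using L1(2) by (intro exI[of _ "L1 @ L"]) auto
        qed
        have "length (f @ fill a L) = N + M" "set (f @ fill a L) \<subseteq> ?A"
          using f Lset set_fill[OF L', of a] by auto
        moreover have "finite (insert (d f) K)" "card (insert (d f) K) = Suc s" using K False by auto
        ultimately have "focused_lines A a (N + M) c (Suc s)"
          unfolding focused_lines_def using lines
          by (intro exI[of _ "f @ fill a L"] exI[of _ "insert (d f) K"] conjI ballI) auto
        thus ?thesis ..
      qed
    qed
  qed
qed

text \<open>More focused lines than colours are impossible, so that focusing \<open>r + 1\<close> lines must produce a
monochromatic one.\<close>

theorem hales_jewett:
  assumes "finite A" "A \<noteq> {}"
  shows "\<exists>N. arrows r {(\<lambda>x. fill x L) ` A | L. line A N L}"
  using assms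
proof (induction A arbitrary: r rule: finite_ne_induct)
  case (singleton x)
  have "line {x} 1 [None]" by (simp add: line_def)
  thus ?case unfolding arrows_def by (intro exI[of _ 1]) blast
next
  case (insert a A)
  from focusing[OF insert(1,2) insert.IH, of r a "Suc r"] obtain N where N:
    "\<And>c :: 'a list \<Rightarrow> nat. (\<And>w. c w < r) \<Longrightarrow>
    mono_line (insert a A) N c \<or>
    focused_lines A a N c (Suc r)"
    by blast
  show ?case unfolding arrows_def
  proof (rule exI[of _ N], intro allI impI)
    fix c :: "'a list \<Rightarrow> nat" assume c: "\<forall>w. c w < r"
    have "\<not> focused_lines A a N c (Suc r)"
    proof
      assume "focused_lines A a N c (Suc r)"
      then obtain K where K: "card K = Suc r" "\<forall>k\<in>K. \<exists>L. \<forall>x\<in>A. c (fill x L) = k"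
        unfolding focused_lines_def by blast
      have "K \<subseteq> {..<r}" using K(2) insert(2) c by fastforce
      hence "card K \<le> r" using card_mono[of "{..<r}" K] by simp
      thus False using K(1) by simp
    qed
    hence "mono_line (insert a A) N c" using N[of c] c by simp
    then obtain L k where L: "line (insert a A) N L" "\<forall>x\<in>insert a A. c (fill x L) = k"
      unfolding mono_line_def by blast
    show "\<exists>S\<in>{(\<lambda>x. fill x L) ` insert a A |L. line (insert a A) N L}. \<exists>k. \<forall>w\<in>S. c w = k"
      by (rule bexI[of _ "(\<lambda>x. fill x L) ` insert a A"]) (use L in auto)
  qed
qed

section \<open>Restricted growth words\<close>

text \<open>Restricted growth words with types. A word \<open>w\<close> over the constants \<open>{..<a}\<close> introduces the parameters
\<open>a\<close>, \<open>a + 1\<close>, ... in this order. The list \<open>P\<close> gives a type to each position, \<open>Q\<close> to each parameter, and a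
parameter may be introduced only at a position of its own type; later occurrences are free.
With \<open>a = 0\<close> these words are the rigid surjections that are dual to order preserving embeddings of
finite Boolean algebras. With a single type they are the parameter words of Graham and Rothschild.\<close>

inductive rgw :: "nat \<Rightarrow> 'l list \<Rightarrow> 'l list \<Rightarrow> nat list \<Rightarrow> bool" where
  Nil: "rgw a [] [] []"
| old: "x < a \<Longrightarrow> rgw a Q P w \<Longrightarrow> rgw a Q (p # P) (x # w)"
| new: "rgw (Suc a) Q P w \<Longrightarrow> rgw a (p # Q) (p # P) (a # w)"

inductive_cases rgw_Nil: "rgw a Q [] w"
inductive_cases rgw_Cons: "rgw a Q (p # P) w"

text \<open>Composition of parameter words: the parameter \<open>a + i\<close> of \<open>g\<close> is replaced by the letter \<open>f ! i\<close>.\<close>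

definition wsubst :: "nat \<Rightarrow> nat list \<Rightarrow> nat list \<Rightarrow> nat list" where
  "wsubst a f g = map (\<lambda>x. if x < a then x else f ! (x - a)) g"

lemma length_wsubst [simp]: "length (wsubst a f g) = length g"
  by (simp add: wsubst_def)

lemma wsubst_append [simp]: "wsubst a f (g @ h) = wsubst a f g @ wsubst a f h"
  by (simp add: wsubst_def)

lemma wsubst_assoc:
  assumes "set h \<subseteq> {..<a + length g}"
  shows "wsubst a f (wsubst a g h) = wsubst a (wsubst a f g) h"
  using assms by (auto simp: wsubst_def)

lemma wsubst_restrict:
  assumes "set g \<subseteq> {..<a + length u}"
  shows "wsubst a (u @ v) g = wsubst a u g"
  using assms by (auto simp: wsubst_def nth_append)

lemma rgw_length: "rgw a Q P w \<Longrightarrow> length w = length P"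
  by (induction rule: rgw.induct) auto

lemma rgw_set: "rgw a Q P w \<Longrightarrow> set w \<subseteq> {..<a + length Q}"
  by (induction rule: rgw.induct) auto

lemma rgw_labels: "rgw a Q P w \<Longrightarrow> set Q \<subseteq> set P"
  by (induction rule: rgw.induct) auto

lemma rgw_append:
  "rgw a Q P w \<Longrightarrow> rgw (a + length Q) Q' P' w' \<Longrightarrow> rgw a (Q @ Q') (P @ P') (w @ w')"
  by (induction rule: rgw.induct) (auto intro: rgw.intros)

lemma rgw_constants: "length w = length P \<Longrightarrow> set w \<subseteq> {..<a} \<Longrightarrow> rgw a [] P w"
  by (induction w P rule: list_induct2) (auto intro: rgw.intros)

lemma rgw_identity: "rgw a P P [a..<a + length P]"
proof (induction P arbitrary: a)
  case (Cons p P)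
  have "[a..<a + length (p # P)] = a # [Suc a..<Suc a + length P]"
    by (simp add: upt_conv_Cons del: upt_Suc)
  thus ?case using rgw.new[OF Cons] by metis
qed (auto intro: rgw.intros)

lemma rgw_split:
  "rgw a Q (P1 @ P2) w \<Longrightarrow> \<exists>Q1 Q2 w1 w2. Q = Q1 @ Q2 \<and> w = w1 @ w2 \<and> rgw a Q1 P1 w1 \<and>
     rgw (a + length Q1) Q2 P2 w2"
proof (induction P1 arbitrary: a Q w)
  case Nil
  thus ?case by (intro exI[of _ "[]"] exI[of _ Q] exI[of _ w]) (auto intro: rgw.intros)
next
  case (Cons p P1)
  from Cons.prems have "rgw a Q (p # (P1 @ P2)) w" by simp
  then consider (1) x w' where "w = x # w'" "x < a" "rgw a Q (P1 @ P2) w'"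
    | (2) Q' w' where "Q = p # Q'" "w = a # w'" "rgw (Suc a) Q' (P1 @ P2) w'"
    by (rule rgw_Cons) auto
  then show ?case
  proof cases
    case (1 x w')
    from Cons.IH[OF 1(3)] obtain Q1 Q2 w1 w2 where *: "Q = Q1 @ Q2" "w' = w1 @ w2"
      "rgw a Q1 P1 w1" "rgw (a + length Q1) Q2 P2 w2" by blast
    show ?thesis
      by (rule exI[of _ Q1], rule exI[of _ Q2], rule exI[of _ "x # w1"], rule exI[of _ w2])
        (use * 1 in \<open>auto intro: rgw.intros\<close>)
  next
    case (2 Q' w')
    from Cons.IH[OF 2(3)] obtain Q1 Q2 w1 w2 where *: "Q' = Q1 @ Q2" "w' = w1 @ w2"
      "rgw (Suc a) Q1 P1 w1" "rgw (Suc a + length Q1) Q2 P2 w2" by blast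
    show ?thesis
      by (rule exI[of _ "p # Q1"], rule exI[of _ Q2], rule exI[of _ "a # w1"], rule exI[of _ w2])
        (use * 2 in \<open>auto intro: rgw.intros\<close>)
  qed
qed

text \<open>The number of constants may change as long as parameters stay parameters in the same order. This is
how words move between blocks that have different constants.\<close>

lemma rgw_relabel:
  assumes "rgw a Q P w" "\<And>x. x < a \<Longrightarrow> s x < b" "\<And>y. s (a + y) = b + y"
  shows "rgw b Q P (map s w)"
  using assms
proof (induction arbitrary: b rule: rgw.induct)
  case (new a Q P w p)
  have "rgw (Suc b) Q P (map s w)"
  proof (rule new.IH)
    fix x assume "x < Suc a"
    thus "s x < Suc b" using new.prems(1)[of x] new.prems(2)[of 0]
      by (cases "x = a") (auto simp: less_Suc_eq)
  next
    fix y show "s (Suc a + y) = Suc b + y" using new.prems(2)[of "Suc y"] by simp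
  qed
  thus ?case using new.prems(2)[of 0] by (auto intro: rgw.intros)
qed (auto intro: rgw.intros)

text \<open>The general form of closure under composition, in which the prefix \<open>p\<close> of the substituted word has
already been used up and its letters act as constants.\<close>

lemma rgw_wsubst_aux:
  "rgw b (P :: 'l list) T g \<Longrightarrow> b = a + length p \<Longrightarrow> rgw a Q1 (P1 :: 'l list) p \<Longrightarrow> rgw (a + length Q1) Q2 P q \<Longrightarrow>
     rgw (a + length Q1) Q2 T (wsubst a (p @ q) g)"
proof (induction arbitrary: p q Q1 P1 Q2 rule: rgw.induct)
  case (Nil b)
  from Nil(3) show ?case by (cases rule: rgw_Nil) (auto simp: wsubst_def intro: rgw.intros)
next
  case (old x b P T w l)
  have "(if x < a then x else (p @ q) ! (x - a)) < a + length Q1"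
  proof (cases "x < a")
    case False
    hence l: "x - a < length p" using old(1) old.prems(1) by auto
    hence "p ! (x - a) \<in> set p" by simp
    hence "p ! (x - a) < a + length Q1" using rgw_set[OF old.prems(2)] by auto
    thus ?thesis using False l by (simp add: nth_append)
  qed auto
  thus ?case using old.IH[OF old.prems] by (auto simp: wsubst_def intro: rgw.old)
next
  case (new b P T w l)
  from new.prems(3) consider (1) y q' where "q = y # q'" "y < a + length Q1" "rgw (a + length Q1) Q2 P q'"
    | (2) Q2' q' where "Q2 = l # Q2'" "q = (a + length Q1) # q'" "rgw (Suc (a + length Q1)) Q2' P q'"
    by (rule rgw_Cons) auto
  then show ?case
  proof cases
    case (1 y q')
    have p': "rgw a Q1 (P1 @ [l]) (p @ [y])"
      using rgw_append[OF new.prems(2) rgw_constants[of "[y]" "[l]"]] 1 by simp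
    have "rgw (a + length Q1) Q2 T (wsubst a ((p @ [y]) @ q') w)"
      by (rule new.IH[OF _ p']) (use new.prems 1 in auto)
    thus ?thesis using 1 new.prems(1) by (auto simp: wsubst_def nth_append intro: rgw.old)
  next
    case (2 Q2' q')
    have p': "rgw a (Q1 @ [l]) (P1 @ [l]) (p @ [a + length Q1])"
      using rgw_append[OF new.prems(2) rgw_identity[of _ "[l]"]] by simp
    have "rgw (a + length (Q1 @ [l])) Q2' T (wsubst a ((p @ [a + length Q1]) @ q') w)"
      by (rule new.IH[OF _ p']) (use new.prems 2 in auto)
    thus ?thesis using 2 new.prems(1) by (auto simp: wsubst_def nth_append intro: rgw.new)
  qed
qed

lemma rgw_wsubst: "rgw a Q P f \<Longrightarrow> rgw a P T g \<Longrightarrow> rgw a Q T (wsubst a f g)"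
  using rgw_wsubst_aux[of a P T g a "[]" "[]" "[]" Q f] rgw.Nil[of a] by simp

text \<open>The first occurrence of parameter \<open>j\<close> splits the word: before it only the first \<open>j\<close> parameters can
occur, after it parameter \<open>j\<close> counts as a constant.\<close>

lemma rgw_first:
  "rgw a Q P w \<Longrightarrow> j < length Q \<Longrightarrow> \<exists>w1 w2 P1 P2 . w = w1 @ (a + j) # w2 \<and> P = P1 @ Q ! j # P2 \<and>
     rgw a (take j Q) P1 w1 \<and> rgw (a + Suc j) (drop (Suc j) Q) P2 w2"
proof (induction arbitrary: j rule: rgw.induct)
  case (old x a Q P w p)
  from old.IH[OF old.prems] obtain w1 w2 P1 P2 where *: "w = w1 @ (a + j) # w2" "P = P1 @ Q ! j # P2"
     "rgw a (take j Q) P1 w1" "rgw (a + Suc j) (drop (Suc j) Q) P2 w2" by blast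
  show ?case
    by (rule exI[of _ "x # w1"], rule exI[of _ w2], rule exI[of _ "p # P1"], rule exI[of _ P2])
      (use * old in \<open>auto intro: rgw.intros\<close>)
next
  case (new a Q P w p)
  show ?case
  proof (cases j)
    case 0
    show ?thesis
      by (rule exI[of _ "[]"], rule exI[of _ w], rule exI[of _ "[]"], rule exI[of _ P])
        (use 0 new in \<open>auto intro: rgw.intros\<close>)
  next
    case (Suc i)
    from new.IH[of i] new.prems Suc obtain w1 w2 P1 P2 where *: "w = w1 @ (Suc a + i) # w2" "P = P1 @ Q ! i # P2"
     "rgw (Suc a) (take i Q) P1 w1" "rgw (Suc a + Suc i) (drop (Suc i) Q) P2 w2" by auto
    show ?thesis
      by (rule exI[of _ "a # w1"], rule exI[of _ w2], rule exI[of _ "p # P1"], rule exI[of _ P2])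
        (use * Suc in \<open>auto intro: rgw.intros\<close>)
  qed
qed auto

lemma takeWhile_first: "set u \<subseteq> {..<b} \<Longrightarrow> \<not> x < b \<Longrightarrow> takeWhile (\<lambda>x. x < (b::nat)) (u @ x # v) = u"
  by (subst takeWhile_append2) auto

lemma wsubst_set:
  assumes "set u \<subseteq> {..<b}" "a \<le> b" "set w \<subseteq> {..<a + length u}"
  shows "set (wsubst a u w) \<subseteq> {..<b}"
proof
  fix y assume "y \<in> set (wsubst a u w)"
  then obtain z where z: "z \<in> set w" "y = (if z < a then z else u ! (z - a))" by (auto simp: wsubst_def)
  show "y \<in> {..<b}"
  proof (cases "z < a")
    case False
    hence "u ! (z - a) \<in> set u" using assms(3) z(1) by (intro nth_mem) auto
    thus ?thesis using assms(1) z False by auto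
  qed (use z assms in auto)
qed

text \<open>Parameters appear in order, so that the part of \<open>wsubst a f g\<close> before the first letter \<open>\<ge> b\<close> depends
only on the corresponding prefix \<open>u\<close> of \<open>f\<close>.\<close>

lemma takeWhile_wsubst:
  assumes f: "f = u @ x # v" "set u \<subseteq> {..<b}" "b \<le> x" "a \<le> b"
    and g: "rgw a Q P g" "length u < length Q"
  shows "takeWhile (\<lambda>x. x < b) (wsubst a f g) = wsubst a u (takeWhile (\<lambda>x. x < a + length u) g)"
proof -
  from rgw_first[OF g] obtain w1 w2 P1 where w: "g = w1 @ (a + length u) # w2"
     "rgw a (take (length u) Q) P1 w1" by blast
  have w1: "set w1 \<subseteq> {..<a + length u}" using rgw_set[OF w(2)] g(2) by simp
  have "takeWhile (\<lambda>x. x < a + length u) g = w1" unfolding w(1) by (rule takeWhile_first[OF w1]) simp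
  moreover have "wsubst a f g = wsubst a u w1 @ x # wsubst a f w2"
    unfolding w(1) f(1) using wsubst_restrict[OF w1, of "x # v"] by (simp add: wsubst_def)
  moreover have "set (wsubst a u w1) \<subseteq> {..<b}" using w1 f by (intro wsubst_set) auto
  ultimately show ?thesis using takeWhile_first f(3) by simp
qed

abbreviation pw :: "'l \<Rightarrow> nat \<Rightarrow> nat \<Rightarrow> nat \<Rightarrow> nat list \<Rightarrow> bool" where
  "pw l a k n w \<equiv> rgw a (replicate k l) (replicate n l) w"

lemma pw_0: "pw l a 0 n u \<longleftrightarrow> length u = n \<and> set u \<subseteq> {..<a}"
  using rgw_constants[of u "replicate n l" a] rgw_length[of a "[]" "replicate n l" u]
    rgw_set[of a "[]" "replicate n l" u] by auto

text \<open>A line over the alphabet of all words of length \<open>n\<close> becomes an \<open>n\<close>-dimensional subspace: its variable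
is replaced by a block of \<open>n\<close> consecutive parameters, so that the parameters appear in order.\<close>

lemma expand_line:
  assumes "line {u. length u = n \<and> set u \<subseteq> {..<a}} M L"
  shows "pw l a n (M * n) (concat (fill [a..<a+n] L))" (is "?w a")
proof -
  let ?e = "\<lambda>L. concat (fill [a..<a+n] L)"
  obtain xs ys where L: "L = xs @ None # ys" "None \<notin> set xs"
    using assms split_list_first[of None L] by (auto simp: line_def)
  have elt: "length (case z of None \<Rightarrow> [a..<a+n] | Some y \<Rightarrow> y) = n"
    "set (case z of None \<Rightarrow> [a..<a+n] | Some y \<Rightarrow> y) \<subseteq> {..<a+n}" if "z \<in> set L" for z
  proof -
    have "z = None \<or> (\<exists>u. z = Some u \<and> length u = n \<and> set u \<subseteq> {..<a})"
      using that assms by (auto simp: line_def)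
    moreover have "{..<a} \<subseteq> {..<a+n}" by auto
    ultimately show "length (case z of None \<Rightarrow> [a..<a+n] | Some y \<Rightarrow> y) = n"
      "set (case z of None \<Rightarrow> [a..<a+n] | Some y \<Rightarrow> y) \<subseteq> {..<a+n}" by auto
  qed
  have len: "length (?e zs) = length zs * n" "set (?e zs) \<subseteq> {..<a+n}" if "set zs \<subseteq> set L" for zs
  proof -
    have "length (?e zs) = length zs * n \<and> set (?e zs) \<subseteq> {..<a+n}"
      using that
    proof (induction zs)
      case (Cons z zs)
      have "z \<in> set L" "set zs \<subseteq> set L" using Cons.prems by auto
      thus ?case using elt[of z] Cons.IH by (simp add: fill_def)
    qed (simp add: fill_def)
    thus "length (?e zs) = length zs * n" "set (?e zs) \<subseteq> {..<a+n}" by auto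
  qed
  have xs: "set (?e xs) \<subseteq> {..<a}" 
  proof -
    have "set xs \<subseteq> Some ` {u. length u = n \<and> set u \<subseteq> {..<a}}"
      using L assms unfolding line_def by auto
    thus ?thesis by (induction xs) (auto simp: fill_def)
  qed
  have 1: "rgw a [] (replicate (length xs * n) l) (?e xs)"
    by (rule rgw_constants) (use len(1)[of xs] xs L(1) in auto)
  have 2: "rgw (a + length []) (replicate n l) (replicate n l) [a..<a+n]"
    using rgw_identity[of a "replicate n l"] by simp
  have 3: "rgw (a + length ([] @ replicate n l)) [] (replicate (length ys * n) l) (?e ys)"
    by (rule rgw_constants) (use len[of ys] L(1) in auto)
  have M: "length xs * n + n + length ys * n = M * n" using assms L by (auto simp: line_def algebra_simps)
  have "rgw a (([] @ replicate n l) @ [])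
     ((replicate (length xs * n) l @ replicate n l) @ replicate (length ys * n) l) ((?e xs @ [a..<a+n]) @ ?e ys)"
    by (intro rgw_append[OF rgw_append[OF 1 2] 3])
  thus ?thesis unfolding L(1) by (simp add: fill_def flip: replicate_add M add.assoc)
qed

text \<open>The multidimensional Hales-Jewett theorem, which is the case \<open>k = 0\<close> of the Graham-Rothschild theorem.\<close>

lemma hales_jewett_subspace:
  assumes a: "0 < a"
  shows "\<exists>N. arrows r {{wsubst a u g | u. length u = n \<and> set u \<subseteq> {..<a}} | g. pw l a n N g}"
proof -
  let ?A = "{u. length u = n \<and> set u \<subseteq> {..<a}}"
  have "finite ?A" by (intro finite_words) auto
  moreover have "replicate n 0 \<in> ?A" using a by auto
  ultimately obtain M where M: "arrows r {(\<lambda>x. fill x L) ` ?A | L. line ?A M L}"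
    using hales_jewett[of ?A r] by blast
  show ?thesis unfolding arrows_def
  proof (rule exI[of _ "M * n"], intro allI impI)
    fix c :: "nat list \<Rightarrow> nat" assume "\<forall>w. c w < r"
    hence "\<forall>w. (c \<circ> concat) w < r" by simp
    then obtain L k where L: "line ?A M L" "\<And>u. u \<in> ?A \<Longrightarrow> c (concat (fill u L)) = k"
      using M[unfolded arrows_def, rule_format, of "c \<circ> concat"] by auto
    have eq: "wsubst a u (concat (fill [a..<a+n] L)) = concat (fill u L)" if u: "u \<in> ?A" for u
    proof -
      have "wsubst a u [a..<a+n] = u" using u by (auto simp: wsubst_def intro!: nth_equalityI)
      moreover have "wsubst a u v = v" if "v \<in> ?A" for v
        using that by (auto simp: wsubst_def intro!: map_idI)
      ultimately have "wsubst a u (concat (fill [a..<a+n] zs)) = concat (fill u zs)"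
        if "set zs \<subseteq> insert None (Some ` ?A)" for zs
        using that by (induction zs) (auto simp: fill_def wsubst_def[of _ _ "[]"])
      thus ?thesis using L(1) by (auto simp: line_def)
    qed
    show "\<exists>S\<in>{{wsubst a u g | u. length u = n \<and> set u \<subseteq> {..<a}} | g. pw l a n (M * n) g}. \<exists>k. \<forall>w\<in>S. c w = k"
    proof (intro bexI exI ballI)
      show "{wsubst a u (concat (fill [a..<a+n] L)) | u. length u = n \<and> set u \<subseteq> {..<a}} \<in>
        {{wsubst a u g | u. length u = n \<and> set u \<subseteq> {..<a}} | g. pw l a n (M * n) g}"
        using expand_line[OF L(1), of l] by blast
    next
      fix w assume "w \<in> {wsubst a u (concat (fill [a..<a+n] L)) | u. length u = n \<and> set u \<subseteq> {..<a}}"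
      thus "c w = k" using eq L(2) by auto
    qed
  qed
qed

section \<open>The Graham-Rothschild theorem\<close>

lemma rgw_parameter: "rgw a Q P w \<Longrightarrow> j < length Q \<Longrightarrow> a + j \<in> set w"
  using rgw_first[of a Q P w j] by auto

lemma pw_snoc: "pw l a n m h \<Longrightarrow> pw l a (Suc n) (Suc m) (h @ [a + n])"
  using rgw_append[of a "replicate n l" "replicate m l" h "[l]" "[l]" "[a + n]"] rgw_identity[of "a + n" "[l]"]
  by (simp add: replicate_append_same)

text \<open>Here words \<open>u\<close> without parameters are coloured, and they are substituted into the initial segments of \<open>h\<close>
that end before a new parameter. By induction on \<open>n\<close>: the multidimensional Hales-Jewett theorem makes
full words of some length \<open>M\<close> monochromatic on a subspace \<open>s\<close>, the induction hypothesis is applied inside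
\<open>s\<close>, and a fresh last parameter is appended.\<close>

lemma prefix_homogeneous_aux:
  assumes a: "0 < a"
  shows "\<exists>M. \<forall>c :: nat list \<Rightarrow> nat. (\<forall>w. c w < r) \<longrightarrow>
    (\<exists>h. pw l a n M h \<and> (\<forall>j<n. \<exists>k. \<forall>u. length u = j \<and> set u \<subseteq> {..<a} \<longrightarrow>
       c (wsubst a u (takeWhile (\<lambda>x. x < a + j) h)) = k))"
proof (induction n)
  case 0
  show ?case by (rule exI[of _ 0]) (auto intro: rgw.intros)
next
  case (Suc n)
  then obtain m where m: "\<And>c :: nat list \<Rightarrow> nat. (\<forall>w. c w < r) \<Longrightarrow>
    (\<exists>h. pw l a n m h \<and> (\<forall>j<n. \<exists>k. \<forall>u. length u = j \<and> set u \<subseteq> {..<a} \<longrightarrow>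
       c (wsubst a u (takeWhile (\<lambda>x. x < a + j) h)) = k))" by auto
  obtain M where M: "arrows r {{wsubst a u g | u. length u = m \<and> set u \<subseteq> {..<a}} | g. pw l a m M g}"
    using hales_jewett_subspace[OF a, where r = r and n = m and l = l] by blast
  show ?case
  proof (rule exI[of _ "Suc M"], intro allI impI)
    fix c :: "nat list \<Rightarrow> nat" assume c: "\<forall>w. c w < r"
    obtain s k0 where s: "pw l a m M s"
      and k0: "\<And>u. length u = m \<Longrightarrow> set u \<subseteq> {..<a} \<Longrightarrow> c (wsubst a u s) = k0"
      using M[unfolded arrows_def, rule_format, of c] c by auto
    \<comment> \<open>The colouring of shorter words that is induced inside the subspace \<open>s\<close>.\<close>
    define d where "d u = c (wsubst a u (takeWhile (\<lambda>x. x < a + length u) s))" for u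
    obtain h where h: "pw l a n m h" and hd: "\<And>j. j < n \<Longrightarrow> \<exists>k. \<forall>u. length u = j \<and> set u \<subseteq> {..<a} \<longrightarrow>
       d (wsubst a u (takeWhile (\<lambda>x. x < a + j) h)) = k"
      using m[of d] c by (auto simp: d_def)
    have lenh: "length h = m" using rgw_length[OF h] by simp
    have hs: "pw l a n M (wsubst a h s)" by (rule rgw_wsubst[OF h s])
    let ?g = "wsubst a h s @ [a + n]"
    have "\<exists>k. \<forall>u. length u = j \<and> set u \<subseteq> {..<a} \<longrightarrow> c (wsubst a u (takeWhile (\<lambda>x. x < a + j) ?g)) = k"
      if j: "j < Suc n" for j
    proof (cases "j = n")
      case True
      have tw: "takeWhile (\<lambda>x. x < a + j) ?g = wsubst a h s"
        using takeWhile_first[of "wsubst a h s" "a + n" "a + n" "[]"] rgw_set[OF hs] True by simp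
      have "c (wsubst a u (wsubst a h s)) = k0" if u: "length u = j" "set u \<subseteq> {..<a}" for u
      proof -
        have "wsubst a u (wsubst a h s) = wsubst a (wsubst a u h) s"
          using rgw_set[OF s] lenh by (intro wsubst_assoc) auto
        moreover have "set (wsubst a u h) \<subseteq> {..<a}"
          using rgw_set[OF h] u True by (intro wsubst_set) auto
        ultimately show ?thesis using k0[of "wsubst a u h"] lenh by simp
      qed
      thus ?thesis unfolding tw by blast
    next
      case False
      hence j: "j < n" using that by simp
      then obtain w1 w2 P1 where w: "h = w1 @ (a + j) # w2" "rgw a (take j (replicate n l)) P1 w1"
        using rgw_first[OF h, of j] by auto
      have w1: "set w1 \<subseteq> {..<a + j}" using rgw_set[OF w(2)] j by simp
      have tw1: "takeWhile (\<lambda>x. x < a + j) h = w1" unfolding w(1) by (rule takeWhile_first[OF w1]) simp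
      have "takeWhile (\<lambda>x. x < a + j) (wsubst a h s) = wsubst a w1 (takeWhile (\<lambda>x. x < a + length w1) s)"
        by (rule takeWhile_wsubst[OF w(1) w1 _ _ s]) (use lenh w(1) in auto)
      moreover have "a + j \<in> set (wsubst a h s)" using rgw_parameter[OF hs] j by simp
      ultimately have tw: "takeWhile (\<lambda>x. x < a + j) ?g = wsubst a w1 (takeWhile (\<lambda>x. x < a + length w1) s)"
        by (subst takeWhile_append1) auto
      obtain k where k: "\<And>u. length u = j \<Longrightarrow> set u \<subseteq> {..<a} \<Longrightarrow> d (wsubst a u w1) = k"
        using hd[OF j] unfolding tw1 by blast
      have "c (wsubst a u (wsubst a w1 (takeWhile (\<lambda>x. x < a + length w1) s))) = k"
        if u: "length u = j" "set u \<subseteq> {..<a}" for u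
      proof -
        have "wsubst a u (wsubst a w1 (takeWhile (\<lambda>x. x < a + length w1) s)) =
          wsubst a (wsubst a u w1) (takeWhile (\<lambda>x. x < a + length w1) s)"
          by (intro wsubst_assoc) (auto dest: set_takeWhileD)
        thus ?thesis using k[OF u] by (simp add: d_def)
      qed
      thus ?thesis unfolding tw by blast
    qed
    thus "\<exists>h. pw l a (Suc n) (Suc M) h \<and> (\<forall>j<Suc n. \<exists>k. \<forall>u. length u = j \<and> set u \<subseteq> {..<a} \<longrightarrow>
       c (wsubst a u (takeWhile (\<lambda>x. x < a + j) h)) = k)"
      using pw_snoc[OF hs] by blast
  qed
qed

text \<open>Any set \<open>X\<close> of positions is the set of first occurrences of the parameters of some word; the other
positions carry the constant \<open>0\<close>.\<close>

lemma selection_word: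
  assumes "0 < a"
  shows "X \<subseteq> {..<m} \<Longrightarrow> \<exists>h. pw l a (card X) m h \<and> (\<forall>j<card X. length (takeWhile (\<lambda>x. x < a + j) h) \<in> X)"
proof (induction m arbitrary: X)
  case 0
  thus ?case by (auto intro: rgw.intros)
next
  case (Suc m)
  let ?Y = "X - {m}"
  have "?Y \<subseteq> {..<m}" using Suc.prems by (auto simp: less_Suc_eq)
  from Suc.IH[OF this] obtain h where h: "pw l a (card ?Y) m h"
    and hY: "\<And>j. j < card ?Y \<Longrightarrow> length (takeWhile (\<lambda>x. x < a + j) h) \<in> ?Y" by blast
  have fin: "finite X" using Suc.prems finite_subset by blast
  have old: "length (takeWhile (\<lambda>x. x < a + j) (h @ z)) \<in> X" if "j < card ?Y" for j z
  proof -
    have "a + j \<in> set h" using rgw_parameter[OF h] that by simp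
    thus ?thesis using hY[OF that] by (subst takeWhile_append1) auto
  qed
  show ?case
  proof (cases "m \<in> X")
    case True
    have cX: "card X = Suc (card ?Y)" using True fin by (metis card_Suc_Diff1)
    have "length (takeWhile (\<lambda>x. x < a + j) (h @ [a + card ?Y])) \<in> X" if "j < card X" for j
    proof (cases "j = card ?Y")
      case j: True
      show ?thesis
        unfolding j using takeWhile_first[of h "a + card ?Y" "a + card ?Y" "[]"] rgw_set[OF h] rgw_length[OF h] True by simp
    qed (use old that cX in auto)
    thus ?thesis using pw_snoc[OF h] cX by metis
  next
    case False
    hence [simp]: "?Y = X" by auto
    have "pw l a (card X) (Suc m) (h @ [0])"
      using rgw_append[OF h, of "[]" "[l]" "[0]"] rgw_constants[of "[0]" "[l]" "a + card X"] assms
      by (simp add: replicate_append_same)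
    thus ?thesis using old[of _ "[0]"] by auto
  qed
qed

lemma pigeonhole_colour:
  fixes f :: "nat \<Rightarrow> nat"
  assumes "\<And>j. j < r * n \<Longrightarrow> f j < r" "0 < r"
  shows "\<exists>k. n \<le> card {j. j < r * n \<and> f j = k}"
proof (rule ccontr)
  assume "\<not> ?thesis"
  hence *: "card {j. j < r * n \<and> f j = k} \<le> n - 1" "0 < n" for k by (auto simp: not_le less_Suc_eq_le) (metis Suc_pred bot_nat_0.not_eq_extremum less_Suc_eq_le not_less0)
  have "{..<r * n} \<subseteq> (\<Union>k<r. {j. j < r * n \<and> f j = k})" using assms by auto
  hence "card {..<r * n} \<le> card (\<Union>k<r. {j. j < r * n \<and> f j = k})" by (intro card_mono) auto
  also have "\<dots> \<le> (\<Sum>k<r. card {j. j < r * n \<and> f j = k})" by (rule card_UN_le) auto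
  also have "\<dots> \<le> (\<Sum>k<r. n - 1)" by (intro sum_mono *)
  finally have "r * n \<le> r * (n - 1)" by simp
  thus False using *(2) assms(2) by simp
qed

text \<open>The colour no longer depends on the length of \<open>u\<close>: among \<open>r * n\<close> parameters, \<open>n\<close> have the same colour,
and the others are set to the constant \<open>0\<close>.\<close>

lemma prefix_homogeneous:
  assumes a: "0 < a"
  shows "\<exists>M. \<forall>c :: nat list \<Rightarrow> nat. (\<forall>w. c w < r) \<longrightarrow>
    (\<exists>h k. pw l a n M h \<and> (\<forall>u. length u < n \<and> set u \<subseteq> {..<a} \<longrightarrow>
       c (wsubst a u (takeWhile (\<lambda>x. x < a + length u) h)) = k))"
proof -
  obtain M where M: "\<And>c :: nat list \<Rightarrow> nat. (\<forall>w. c w < r) \<Longrightarrow>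
    (\<exists>h. pw l a (r * n) M h \<and> (\<forall>j<r * n. \<exists>k. \<forall>u. length u = j \<and> set u \<subseteq> {..<a} \<longrightarrow>
       c (wsubst a u (takeWhile (\<lambda>x. x < a + j) h)) = k))"
    using prefix_homogeneous_aux[OF a, where r = r and l = l and n = "r * n"] by auto
  show ?thesis
  proof (rule exI[of _ M], intro allI impI)
    fix c :: "nat list \<Rightarrow> nat" assume c: "\<forall>w. c w < r"
    have r: "0 < r" using c[rule_format, of "[]"] by auto
    obtain h where h: "pw l a (r * n) M h" and "\<forall>j<r * n. \<exists>k. \<forall>u. length u = j \<and> set u \<subseteq> {..<a} \<longrightarrow>
       c (wsubst a u (takeWhile (\<lambda>x. x < a + j) h)) = k" using M[OF c] by blast
    then obtain K where K: "\<And>j u. j < r * n \<Longrightarrow> length u = j \<Longrightarrow> set u \<subseteq> {..<a} \<Longrightarrow>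
       c (wsubst a u (takeWhile (\<lambda>x. x < a + j) h)) = K j" by metis
    have "K j < r" if "j < r * n" for j
    proof -
      have "c (wsubst a (replicate j 0) (takeWhile (\<lambda>x. x < a + j) h)) = K j"
        by (rule K) (use that a in auto)
      thus ?thesis using c by metis
    qed
    then obtain k where k: "n \<le> card {j. j < r * n \<and> K j = k}" using pigeonhole_colour[OF _ r] by blast
    obtain X where X: "X \<subseteq> {j. j < r * n \<and> K j = k}" "card X = n"
      using obtain_subset_with_card_n[OF k] by blast
    hence "X \<subseteq> {..<r * n}" by auto
    from selection_word[OF a this, where l = l] obtain g where g: "pw l a n (r * n) g"
      and gX: "\<And>j. j < n \<Longrightarrow> length (takeWhile (\<lambda>x. x < a + j) g) \<in> X" using X(2) by auto
    have "c (wsubst a u (takeWhile (\<lambda>x. x < a + length u) (wsubst a g h))) = k"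
      if u: "length u < n" "set u \<subseteq> {..<a}" for u
    proof -
      from u obtain w1 w2 P1 where w: "g = w1 @ (a + length u) # w2" "rgw a (take (length u) (replicate n l)) P1 w1"
        using rgw_first[OF g, of "length u"] by auto
      have w1: "set w1 \<subseteq> {..<a + length u}" using rgw_set[OF w(2)] u by simp
      have "takeWhile (\<lambda>x. x < a + length u) g = w1" unfolding w(1) by (rule takeWhile_first[OF w1]) simp
      hence lw1: "length w1 \<in> X" using gX[OF u(1)] by simp
      have "takeWhile (\<lambda>x. x < a + length u) (wsubst a g h) = wsubst a w1 (takeWhile (\<lambda>x. x < a + length w1) h)"
        by (rule takeWhile_wsubst[OF w(1) w1 _ _ h]) (use lw1 X(1) in auto)
      moreover have "wsubst a u (wsubst a w1 (takeWhile (\<lambda>x. x < a + length w1) h)) =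
         wsubst a (wsubst a u w1) (takeWhile (\<lambda>x. x < a + length w1) h)"
        by (intro wsubst_assoc) (auto dest: set_takeWhileD)
      moreover have "c (wsubst a (wsubst a u w1) (takeWhile (\<lambda>x. x < a + length w1) h)) = K (length w1)"
        using lw1 X(1) wsubst_set[OF u(2) order_refl w1] by (intro K) auto
      ultimately show ?thesis using lw1 X(1) by auto
    qed
    thus "\<exists>h k. pw l a n M h \<and> (\<forall>u. length u < n \<and> set u \<subseteq> {..<a} \<longrightarrow>
       c (wsubst a u (takeWhile (\<lambda>x. x < a + length u) h)) = k)"
      using rgw_wsubst[OF g h] by blast
  qed
qed

lemma pw_Suc_cases:
  assumes "pw l a (Suc k) n f"
  obtains u v where "f = u @ a # v" "set u \<subseteq> {..<a}" "length u < n" "pw l (Suc a) k (n - Suc (length u)) v"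
proof -
  from rgw_first[OF assms, of 0] obtain u v P1 P2 where *: "f = u @ a # v" "replicate n l = P1 @ l # P2"
    "rgw a [] P1 u" "rgw (Suc a) (replicate k l) P2 v" by auto
  have "length P1 = length u" using rgw_length[OF *(3)] by simp
  moreover have "length (replicate n l) = length P1 + Suc (length P2)" using *(2) by simp
  moreover have "P2 = replicate (length P2) l"
    using *(2) by (metis append_eq_conv_conj drop_replicate list.inject replicate_length_same
        in_set_replicate in_set_conv_decomp list.set_intros(2) set_append UnCI)
  ultimately have "length u < n" "P2 = replicate (n - Suc (length u)) l" by auto
  thus ?thesis using that[of u v] * rgw_set[OF *(3)] by simp
qed

lemma pw_Suc_iff:
  assumes "set u \<subseteq> {..<a}" "length u < n"
  shows "pw l a (Suc k) n (u @ a # v) \<longleftrightarrow> pw l (Suc a) k (n - Suc (length u)) v"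
  using assms
proof (induction u arbitrary: n)
  case Nil
  then obtain n' where n: "n = Suc n'" by (cases n) auto
  show ?case unfolding n by (auto elim: rgw_Cons intro: rgw.new)
next
  case (Cons x u)
  then obtain n' where n: "n = Suc n'" by (cases n) auto
  have x: "x < a" using Cons.prems by auto
  have "pw l a (Suc k) n ((x # u) @ a # v) \<longleftrightarrow> pw l a (Suc k) n' (u @ a # v)"
    unfolding n using x by (auto elim: rgw_Cons intro: rgw.old)
  thus ?case using Cons.IH[of n'] Cons.prems n by simp
qed

lemma wsubst_upt: "a + n \<le> b \<Longrightarrow> b \<le> a + length f \<Longrightarrow> wsubst a f [a+n..<b] = take (b - (a + n)) (drop n f)"
  by (rule nth_equalityI) (auto simp: wsubst_def)

text \<open>A word with \<open>k + 1\<close> parameters is \<open>u @ a # v\<close>, where \<open>u\<close> has no parameters and \<open>v\<close> has \<open>k\<close> parameters over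
one constant more. The hypothesis for \<open>k\<close> is applied to one length of \<open>u\<close> after the other, for all \<open>u\<close> of
that length at once, until the colour depends only on \<open>u\<close>.\<close>

lemma tail_homogeneous:
  assumes GR: "\<And>n r. \<exists>N. arrows r {{wsubst (Suc a) f g | f. pw l (Suc a) k n f} | g. pw l (Suc a) n N g}"
  shows "\<exists>N. \<forall>c :: nat list \<Rightarrow> nat. (\<forall>w. c w < r) \<longrightarrow>
    (\<exists>g. pw l a (i + M) N g \<and> (\<forall>u. length u < i \<and> set u \<subseteq> {..<a} \<longrightarrow>
       (\<exists>q. \<forall>v. pw l (Suc a) k (i + M - Suc (length u)) v \<longrightarrow> c (wsubst a (u @ a # v) g) = q)))"
proof (induction i arbitrary: M)
  case 0
  have "pw l a M M [a..<a+M]" using rgw_identity[of a "replicate M l"] by simp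
  thus ?case by auto
next
  case (Suc i)
  define F where "F = {u. length u = i \<and> set u \<subseteq> {..<a}}"
  define K0 where "K0 = (PiE F (\<lambda>_. {..<r}))"
  have finK0: "finite K0" unfolding K0_def F_def by (intro finite_PiE finite_words) auto
  obtain M' where M': "arrows (Suc (card K0)) {{wsubst (Suc a) f g | f. pw l (Suc a) k M f} | g. pw l (Suc a) M M' g}"
    using GR by blast
  obtain N where N: "\<And>c :: nat list \<Rightarrow> nat. (\<forall>w. c w < r) \<Longrightarrow>
    (\<exists>g. pw l a (i + Suc M') N g \<and> (\<forall>u. length u < i \<and> set u \<subseteq> {..<a} \<longrightarrow>
       (\<exists>q. \<forall>v. pw l (Suc a) k (i + Suc M' - Suc (length u)) v \<longrightarrow> c (wsubst a (u @ a # v) g) = q)))"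
    using Suc[of "Suc M'"] by auto
  show ?case
  proof (rule exI[of _ N], intro allI impI)
    fix c :: "nat list \<Rightarrow> nat" assume c: "\<forall>w. c w < r"
    obtain g0 where g0: "pw l a (i + Suc M') N g0" and g0c: "\<And>u. length u < i \<Longrightarrow> set u \<subseteq> {..<a} \<Longrightarrow>
       (\<exists>q. \<forall>v. pw l (Suc a) k (i + Suc M' - Suc (length u)) v \<longrightarrow> c (wsubst a (u @ a # v) g0) = q)"
      using N[OF c] by blast
    have "\<exists>S\<in>{{wsubst (Suc a) f g | f. pw l (Suc a) k M f} | g. pw l (Suc a) M M' g}. \<exists>q. \<forall>v\<in>S.
        (\<lambda>u\<in>F. c (wsubst a (u @ a # v) g0)) = q"
      by (rule arrowsD[OF M' finK0]) (use c in \<open>auto simp: K0_def\<close>)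
    then obtain g1 q1 where g1: "pw l (Suc a) M M' g1"
      and q1: "\<And>v. pw l (Suc a) k M v \<Longrightarrow> (\<lambda>u\<in>F. c (wsubst a (u @ a # wsubst (Suc a) v g1) g0)) = q1" by blast
    \<comment> \<open>The constant \<open>a\<close> of \<open>g1\<close> is the parameter at position \<open>i\<close> of \<open>G\<close>; the first \<open>i + 1\<close> parameters of \<open>G\<close> are
left alone.\<close>
    define s where "s x = (if x < a then x else x + i)" for x
    have s: "rgw (a + length (replicate (Suc i) l)) (replicate M l) (replicate M' l) (map s g1)"
      by (rule rgw_relabel[OF g1]) (auto simp: s_def)
    define G where "G = [a..<a + Suc i] @ map s g1"
    have G: "pw l a (Suc i + M) (i + Suc M') G"
      using rgw_append[OF _ s, of "replicate (Suc i) l" "[a..<a + Suc i]"] rgw_identity[of a "replicate (Suc i) l"]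
      by (simp add: G_def del: upt_Suc replicate_Suc flip: replicate_add)
    have lenG: "length G = i + Suc M'" using rgw_length[OF G] by simp
    have "\<exists>q. \<forall>v. pw l (Suc a) k (Suc i + M - Suc (length u)) v \<longrightarrow> c (wsubst a (u @ a # v) (wsubst a G g0)) = q"
      if u: "length u < Suc i" "set u \<subseteq> {..<a}" for u
    proof -
      have assoc: "wsubst a f (wsubst a G g0) = wsubst a (wsubst a f G) g0" for f
        using rgw_set[OF g0] lenG by (intro wsubst_assoc) auto
      show ?thesis
      proof (cases "length u = i")
        case True
        have "c (wsubst a (u @ a # v) (wsubst a G g0)) = q1 u" if v: "pw l (Suc a) k M v" for v
        proof -
          have "u \<in> F" using u True by (simp add: F_def)
          hence "c (wsubst a (u @ a # wsubst (Suc a) v g1) g0) = q1 u" using fun_cong[OF q1[OF v], of u] by simp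
          moreover have "wsubst a (u @ a # v) [a..<a + Suc i] = u @ [a]"
            using True wsubst_upt[of a 0 "a + Suc i" "u @ a # v"] by (simp del: upt_Suc)
          moreover have "wsubst a (u @ a # v) (map s g1) = wsubst (Suc a) v g1"
            using True by (auto simp: wsubst_def s_def nth_append nth_Cons')
          ultimately show ?thesis unfolding assoc by (simp add: G_def del: upt_Suc)
        qed
        thus ?thesis using True by auto
      next
        case False
        hence ui: "length u < i" using u by simp
        then obtain q where q: "\<And>v. pw l (Suc a) k (i + Suc M' - Suc (length u)) v \<Longrightarrow> c (wsubst a (u @ a # v) g0) = q"
          using g0c u by blast
        have "c (wsubst a (u @ a # v) (wsubst a G g0)) = q" if v: "pw l (Suc a) k (Suc i + M - Suc (length u)) v" for v
        proof -
          have f: "pw l a (Suc k) (Suc i + M) (u @ a # v)" using v u by (subst pw_Suc_iff) auto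
          have lv: "length v = Suc i + M - Suc (length u)" using rgw_length[OF v] by simp
          have "wsubst a (u @ a # v) [a..<a + Suc i] = u @ a # take (i - length u) v"
            using ui lv wsubst_upt[of a 0 "a + Suc i" "u @ a # v"] by (simp add: take_Cons' Suc_diff_Suc del: upt_Suc)
          then obtain v2 where v2: "wsubst a (u @ a # v) G = u @ a # v2" by (simp add: G_def del: upt_Suc)
          have "pw l a (Suc k) (i + Suc M') (u @ a # v2)" using rgw_wsubst[OF f G] v2 by simp
          hence "pw l (Suc a) k (i + Suc M' - Suc (length u)) v2" using u by (subst (asm) pw_Suc_iff) auto
          thus ?thesis using q unfolding assoc v2 by simp
        qed
        thus ?thesis by blast
      qed
    qed
    thus "\<exists>g. pw l a (Suc i + M) N g \<and> (\<forall>u. length u < Suc i \<and> set u \<subseteq> {..<a} \<longrightarrow>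
       (\<exists>q. \<forall>v. pw l (Suc a) k (Suc i + M - Suc (length u)) v \<longrightarrow> c (wsubst a (u @ a # v) g) = q))"
      using rgw_wsubst[OF G g0] by blast
  qed
qed

text \<open>Induction on the number \<open>k\<close> of parameters: first the colour is made independent of the tail after the
first parameter, then of the initial segment before it.\<close>

theorem graham_rothschild:
  assumes "0 < a"
  shows "\<exists>N. arrows r {{wsubst a f g | f. pw l a k n f} | g. pw l a n N g}"
  using assms
proof (induction k arbitrary: a n r)
  case 0
  thus ?case using hales_jewett_subspace[of a, where r = r and n = n and l = l] by (simp add: pw_0[simplified])
next
  case (Suc k)
  obtain M where M: "\<And>c :: nat list \<Rightarrow> nat. (\<forall>w. c w < r) \<Longrightarrow>
    (\<exists>h q. pw l a n M h \<and> (\<forall>u. length u < n \<and> set u \<subseteq> {..<a} \<longrightarrow>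
       c (wsubst a u (takeWhile (\<lambda>x. x < a + length u) h)) = q))"
    using prefix_homogeneous[OF Suc.prems, where r = r and l = l and n = n] by auto
  obtain N where N: "\<And>c :: nat list \<Rightarrow> nat. (\<forall>w. c w < r) \<Longrightarrow>
    (\<exists>g. pw l a M N g \<and> (\<forall>u. length u < M \<and> set u \<subseteq> {..<a} \<longrightarrow>
       (\<exists>q. \<forall>v. pw l (Suc a) k (M - Suc (length u)) v \<longrightarrow> c (wsubst a (u @ a # v) g) = q)))"
    using tail_homogeneous[where a = a and l = l and k = k and r = r and i = M and M = 0] Suc.IH[of "Suc a"] by auto
  show ?case unfolding arrows_def
  proof (rule exI[of _ N], intro allI impI)
    fix c :: "nat list \<Rightarrow> nat" assume c: "\<forall>w. c w < r"
    obtain g where g: "pw l a M N g" and gc: "\<And>u. length u < M \<Longrightarrow> set u \<subseteq> {..<a} \<Longrightarrow>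
       (\<exists>q. \<forall>v. pw l (Suc a) k (M - Suc (length u)) v \<longrightarrow> c (wsubst a (u @ a # v) g) = q)"
      using N[OF c] by blast
    \<comment> \<open>A word \<open>u\<close> without any admissible tail \<open>v\<close> gets a meaningless colour, which is never used but must be \<open>< r\<close>.\<close>
    define d where "d u = c (wsubst a (u @ a # (SOME v. pw l (Suc a) k (M - Suc (length u)) v)) g)" for u
    have d: "c (wsubst a (u @ a # v) g) = d u"
      if "length u < M" "set u \<subseteq> {..<a}" "pw l (Suc a) k (M - Suc (length u)) v" for u v
      using gc[OF that(1,2)] that(3) someI[of "pw l (Suc a) k (M - Suc (length u))" v] unfolding d_def by metis
    obtain h q where h: "pw l a n M h" and q: "\<And>u. length u < n \<Longrightarrow> set u \<subseteq> {..<a} \<Longrightarrow>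
       d (wsubst a u (takeWhile (\<lambda>x. x < a + length u) h)) = q"
      using M[of d] c by (auto simp: d_def)
    have "c (wsubst a f (wsubst a h g)) = q" if f: "pw l a (Suc k) n f" for f
    proof -
      from f obtain u v where uv: "f = u @ a # v" "set u \<subseteq> {..<a}" "length u < n" by (rule pw_Suc_cases)
      from rgw_wsubst[OF f h] obtain u2 v2 where uv2: "wsubst a f h = u2 @ a # v2" "set u2 \<subseteq> {..<a}" "length u2 < M"
        "pw l (Suc a) k (M - Suc (length u2)) v2" by (rule pw_Suc_cases)
      have "u2 = takeWhile (\<lambda>x. x < a) (wsubst a f h)" unfolding uv2(1) by (simp add: takeWhile_first[OF uv2(2)])
      also have "\<dots> = wsubst a u (takeWhile (\<lambda>x. x < a + length u) h)"
        by (rule takeWhile_wsubst[OF uv(1,2) _ _ h]) (use uv in auto)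
      finally have "d u2 = q" using q[OF uv(3,2)] by simp
      moreover have "wsubst a f (wsubst a h g) = wsubst a (wsubst a f h) g"
        using rgw_set[OF g] rgw_length[OF h] by (intro wsubst_assoc) auto
      ultimately show ?thesis using d[OF uv2(3,2,4)] uv2(1) by simp
    qed
    thus "\<exists>S\<in>{{wsubst a f g | f. pw l a (Suc k) n f} | g. pw l a n N g}. \<exists>q. \<forall>w\<in>S. c w = q"
      using rgw_wsubst[OF h g] by (intro bexI[of _ "{wsubst a f (wsubst a h g) | f. pw l a (Suc k) n f}"]) auto
  qed
qed

section \<open>The dual Ramsey theorem with types\<close>

lemma first_block:
  fixes l :: "'l::order"
  assumes "sorted_wrt (\<le>) Q" "\<And>x. x \<in> set Q \<Longrightarrow> l \<le> x"
  obtains k Q' where "Q = replicate k l @ Q'" "l \<notin> set Q'" "sorted_wrt (\<le>) Q'"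
proof -
  have "\<exists>k Q'. Q = replicate k l @ Q' \<and> l \<notin> set Q' \<and> sorted_wrt (\<le>) Q'"
    using assms
  proof (induction Q)
    case (Cons x Q)
    show ?case
    proof (cases "x = l")
      case True
      from Cons obtain k Q' where "Q = replicate k l @ Q'" "l \<notin> set Q'" "sorted_wrt (\<le>) Q'" by auto
      thus ?thesis using True by (intro exI[of _ "Suc k"] exI[of _ Q']) auto
    next
      case False
      have "l \<notin> set (x # Q)" using Cons.prems False by (auto intro: antisym)
      thus ?thesis using Cons.prems by (intro exI[of _ 0] exI[of _ "x # Q"]) auto
    qed
  qed (auto)
  thus thesis using that by blast
qed

lemma block_unique:
  "replicate k l @ Q = Q1 @ Q2 \<Longrightarrow> l \<notin> set Q \<Longrightarrow> l \<notin> set Q2 \<Longrightarrow> set Q1 \<subseteq> {l} \<Longrightarrow>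
    Q1 = replicate k l \<and> Q2 = Q"
proof (induction k arbitrary: Q1)
  case 0
  thus ?case by (cases Q1) auto
next
  case (Suc k)
  thus ?case by (cases Q1) auto
qed

lemma rgw_block_split:
  assumes "rgw a (replicate k l @ Q) (replicate n l @ P) f" "l \<notin> set Q" "l \<notin> set P"
  obtains f1 f2 where "f = f1 @ f2" "pw l a k n f1" "rgw (a + k) Q P f2"
proof -
  obtain Q1 Q2 f1 f2 where *: "replicate k l @ Q = Q1 @ Q2" "f = f1 @ f2" "rgw a Q1 (replicate n l) f1"
    "rgw (a + length Q1) Q2 P f2" using rgw_split[OF assms(1)] by blast
  have "l \<notin> set Q2" using rgw_labels[OF *(4)] assms by auto
  moreover have "set Q1 \<subseteq> {l}" using rgw_labels[OF *(3)] by (auto split: if_splits)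
  ultimately have "Q1 = replicate k l" "Q2 = Q" using block_unique[OF *(1) assms(2)] by auto
  thus thesis using that * by auto
qed

lemma finite_rgw: "finite {f. rgw a Q P f}"
proof (rule finite_subset)
  show "{f. rgw a Q P f} \<subseteq> {u. length u = length P \<and> set u \<subseteq> {..<a + length Q}}"
    using rgw_length rgw_set by blast
qed (intro finite_words, auto)

text \<open>Sorted types come in blocks. The positions of the first block are handled by the Graham-Rothschild
theorem. For the remaining blocks the induction hypothesis is used with the \<open>N\<close> positions of the first
block as additional constants, and the colour of a word there is the function that assigns a colour to
every possible first block. What remains is a colouring of the first block alone.\<close>

theorem typed_graham_rothschild:
  fixes P Q :: "'l::order list"
  assumes "0 < a" "sorted_wrt (\<le>) P" "sorted_wrt (\<le>) Q"
  shows "\<exists>T. sorted_wrt (\<le>) T \<and> set T \<subseteq> set P \<and>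
    arrows r {{wsubst a f g | f. rgw a Q P f} | g. rgw a P T g}"
  using assms
proof (induction "length P" arbitrary: P Q a r rule: less_induct)
  case less
  show ?case
  proof (cases "P \<noteq> [] \<and> (\<exists>f. rgw a Q P f)")
    case False
    have "rgw a P P [a..<a + length P]" by (rule rgw_identity)
    moreover have "\<exists>k. \<forall>w \<in> {wsubst a f [a..<a + length P] | f. rgw a Q P f}. c w = k" for c :: "nat list \<Rightarrow> nat"
    proof (cases "P = []")
      case True
      have "\<forall>w \<in> {wsubst a f [a..<a + length P] | f. rgw a Q P f}. c w = c []" using True by (auto simp: wsubst_def)
      thus ?thesis ..
    next
      case False
      hence "{wsubst a f [a..<a + length P] | f. rgw a Q P f} = {}" using \<open>\<not> (P \<noteq> [] \<and> _)\<close> by blast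
      thus ?thesis by simp
    qed
    ultimately have "arrows r {{wsubst a f g | f. rgw a Q P f} | g. rgw a P P g}"
      unfolding arrows_def
      by (intro allI impI bexI[of _ "{wsubst a f [a..<a + length P] | f. rgw a Q P f}"]) auto
    thus ?thesis using less.prems(2) by (intro exI[of _ P] conjI) auto
  next
    case True
    then obtain l P0 where P0: "P = l # P0" by (cases P) auto
    have lP: "l \<le> x" if "x \<in> set P" for x using that less.prems(2) P0 by auto
    have "set Q \<subseteq> set P" using True rgw_labels by blast
    hence lQ: "l \<le> x" if "x \<in> set Q" for x using that lP by blast
    obtain n P' where P: "P = replicate n l @ P'" "l \<notin> set P'" "sorted_wrt (\<le>) P'"
      by (rule first_block[OF less.prems(2) lP])
    obtain k Q' where Q: "Q = replicate k l @ Q'" "l \<notin> set Q'" "sorted_wrt (\<le>) Q'"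
      by (rule first_block[OF less.prems(3) lQ])
    have "n \<noteq> 0" using P P0 by (cases n) auto
    hence lt: "length P' < length P" using P(1) by simp
    obtain N where N: "arrows r {{wsubst a f g | f. pw l a k n f} | g. pw l a n N g}"
      using graham_rothschild[OF less.prems(1), where r = r and k = k and n = n and l = l] by blast
    define F where "F = {f. pw l a k N f}"
    define K0 where "K0 = (PiE F (\<lambda>_. {..<r}))"
    have finK0: "finite K0" unfolding K0_def F_def by (intro finite_PiE finite_rgw) auto
    have aN: "0 < a + N" using less.prems(1) by simp
    obtain T' where T': "sorted_wrt (\<le>) T'" "set T' \<subseteq> set P'"
      "arrows (Suc (card K0)) {{wsubst (a + N) f g | f. rgw (a + N) Q' P' f} | g. rgw (a + N) P' T' g}"
      using less.hyps[OF lt aN P(3) Q(3)] by blast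
    define T where "T = replicate N l @ T'"
    have "sorted_wrt (\<le>) (replicate N l)" by (induction N) auto
    hence sT: "sorted_wrt (\<le>) T" using T'(1,2) lP P(1) by (auto simp: T_def sorted_wrt_append)
    have subT: "set T \<subseteq> set P" using T'(2) P(1) \<open>n \<noteq> 0\<close> by (auto simp: T_def)
    have main: "\<exists>S\<in>{{wsubst a f g | f. rgw a Q P f} | g. rgw a P T g}. \<exists>q. \<forall>w\<in>S. c w = q"
      if c: "\<forall>w. c w < r" for c :: "nat list \<Rightarrow> nat"
    proof -
      \<comment> \<open>The first block \<open>f\<close> followed by \<open>w\<close>, whose constants \<open>a + i\<close> with \<open>i < N\<close> are read as the letters \<open>f ! i\<close>.\<close>
      define comb where "comb f w = f @ wsubst a (f @ [a + k..<a + k + length Q']) w" for f w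
      have "\<exists>S\<in>{{wsubst (a + N) f g | f. rgw (a + N) Q' P' f} | g. rgw (a + N) P' T' g}. \<exists>q. \<forall>w\<in>S.
         (\<lambda>f\<in>F. c (comb f w)) = q"
        by (rule arrowsD[OF T'(3) finK0]) (use c in \<open>auto simp: K0_def\<close>)
      then obtain g2 q where g2: "rgw (a + N) P' T' g2"
        and q: "\<And>w. rgw (a + N) Q' P' w \<Longrightarrow> (\<lambda>f\<in>F. c (comb f (wsubst (a + N) w g2))) = q" by blast
      define d where "d f = c (comb f (wsubst (a + N) (SOME w. rgw (a + N) Q' P' w) g2))" for f
      have d: "c (comb f (wsubst (a + N) w g2)) = d f" if f: "f \<in> F" and w: "rgw (a + N) Q' P' w" for f w
      proof -
        have "rgw (a + N) Q' P' (SOME w. rgw (a + N) Q' P' w)" using w by (rule someI)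
        from fun_cong[OF q[OF this], of f] fun_cong[OF q[OF w], of f] show ?thesis using f by (simp add: d_def)
      qed
      obtain g1 q1 where g1: "pw l a n N g1" and q1: "\<And>f. pw l a k n f \<Longrightarrow> d (wsubst a f g1) = q1"
      proof -
        have "\<forall>w. d w < r" using c by (simp add: d_def)
        then obtain S q1 where "S \<in> {{wsubst a f g | f. pw l a k n f} | g. pw l a n N g}" "\<forall>w\<in>S. d w = q1"
          using N[unfolded arrows_def, rule_format, of d] by blast
        thus thesis using that by blast
      qed
      define I where "I = [a + n..<a + n + length P']"
      define g where "g = g1 @ wsubst a (g1 @ I) g2"
      have len1: "length g1 = N" using rgw_length[OF g1] by simp
      have set2: "set g2 \<subseteq> {..<a + N + length P'}" using rgw_set[OF g2] by simp
      have I: "rgw (a + n) P' P' I" unfolding I_def by (rule rgw_identity)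
      have "rgw (a + length (replicate n l)) P' T' (wsubst a (g1 @ I) g2)"
        by (rule rgw_wsubst_aux[OF g2 _ g1]) (use len1 I in auto)
      hence g: "rgw a P T g" unfolding g_def T_def P(1) by (rule rgw_append[OF g1])
      have "c (wsubst a f g) = q1" if f: "rgw a Q P f" for f
      proof -
        from f obtain f1 f2 where f12: "f = f1 @ f2" "pw l a k n f1" "rgw (a + k) Q' P' f2"
          unfolding Q(1) P(1) by (rule rgw_block_split[OF _ Q(2) P(2)])
        define f' where "f' = wsubst a f1 g1"
        have f': "pw l a k N f'" unfolding f'_def by (rule rgw_wsubst[OF f12(2) g1])
        have lenf: "length f1 = n" "length f2 = length P'" "length f' = N"
          using rgw_length[OF f12(2)] rgw_length[OF f12(3)] rgw_length[OF f'] by auto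
        have setf2: "set f2 \<subseteq> {..<a + k + length Q'}" using rgw_set[OF f12(3)] by simp
        have "\<exists>p. p < N \<and> f' ! p = a + j" if "j < k" for j
          using rgw_parameter[OF f', of j] that lenf by (auto simp: in_set_conv_nth)
        \<comment> \<open>Every letter of the first block occurs in \<open>f'\<close>, and thus can be represented by a position in it. This
lifts \<open>f2\<close> to a word over the enlarged set of constants.\<close>
        then obtain pos where pos: "\<And>j. j < k \<Longrightarrow> pos j < N \<and> f' ! pos j = a + j" by metis
        define lift where "lift x = (if x < a then x else if x < a + k then a + pos (x - a) else x - k + N)" for x
        have w: "rgw (a + N) Q' P' (map lift f2)"
        proof (rule rgw_relabel[OF f12(3)])
          fix x assume "x < a + k" thus "lift x < a + N" using pos[of "x - a"] by (auto simp: lift_def)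
        qed (auto simp: lift_def)
        have unlift: "wsubst a (f' @ [a + k..<a + k + length Q']) (map lift f2) = f2"
        proof (rule nth_equalityI)
          fix i assume "i < length (wsubst a (f' @ [a + k..<a + k + length Q']) (map lift f2))"
          hence i: "i < length f2" by simp
          hence "f2 ! i < a + k + length Q'" using setf2 nth_mem by blast
          thus "wsubst a (f' @ [a + k..<a + k + length Q']) (map lift f2) ! i = f2 ! i"
            using i pos[of "f2 ! i - a"] lenf by (auto simp: wsubst_def lift_def nth_append)
        qed simp
        have fgI: "wsubst a f (g1 @ I) = f' @ f2"
          using lenf wsubst_upt[of a n "a + n + length P'" f] rgw_set[OF g1]
          by (simp add: f12(1) f'_def I_def wsubst_restrict)
        have "wsubst a f g = f' @ wsubst a f (wsubst a (g1 @ I) g2)"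
          using rgw_set[OF g1] lenf by (simp add: g_def f12(1) f'_def wsubst_restrict)
        also have "wsubst a f (wsubst a (g1 @ I) g2) = wsubst a (wsubst a f (g1 @ I)) g2"
          using set2 len1 by (intro wsubst_assoc) (auto simp: I_def)
        also have "\<dots> = wsubst a (f' @ f2) g2" unfolding fgI ..
        also have "wsubst a (f' @ f2) g2 = wsubst a (f' @ [a + k..<a + k + length Q']) (wsubst (a + N) (map lift f2) g2)"
        proof (rule nth_equalityI)
          fix i assume "i < length (wsubst a (f' @ f2) g2)"
          hence i: "i < length g2" by simp
          hence gi: "g2 ! i < a + N + length P'" using set2 nth_mem by blast
          show "wsubst a (f' @ f2) g2 ! i =
            wsubst a (f' @ [a + k..<a + k + length Q']) (wsubst (a + N) (map lift f2) g2) ! i"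
          proof (cases "g2 ! i < a + N")
            case True
            thus ?thesis using i lenf by (auto simp: wsubst_def nth_append)
          next
            case False
            define m where "m = g2 ! i - (a + N)"
            have m: "g2 ! i = a + N + m" "m < length f2" using gi lenf False by (auto simp: m_def)
            have "wsubst a (f' @ f2) g2 ! i = f2 ! m" using i m lenf by (simp add: wsubst_def nth_append)
            moreover have "wsubst a z (wsubst (a + N) (map lift f2) g2) ! i = wsubst a z (map lift f2) ! m" for z
              using i m by (simp add: wsubst_def)
            ultimately show ?thesis by (simp add: unlift)
          qed
        qed simp
        finally have "c (wsubst a f g) = c (comb f' (wsubst (a + N) (map lift f2) g2))" by (simp add: comb_def)
        also have "\<dots> = d f'" using f' w by (intro d) (simp add: F_def)
        finally show ?thesis using q1[OF f12(2)] by (simp add: f'_def)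
      qed
      thus ?thesis using g by (intro bexI[of _ "{wsubst a f g | f. rgw a Q P f}"]) auto
    qed
    have "arrows r {{wsubst a f g | f. rgw a Q P f} | g. rgw a P T g}"
      unfolding arrows_def by (intro allI impI) (rule main)
    thus ?thesis using sT subT by (intro exI[of _ T] conjI)
  qed
qed

text \<open>Several configurations \<open>Qs\<close>, each with a colouring of its own, are treated one after the other; passing
to a subspace keeps what was achieved before.\<close>

theorem simultaneous_graham_rothschild:
  fixes P :: "'l::order list"
  assumes "0 < a" "sorted_wrt (\<le>) P" "\<And>Q. Q \<in> set Qs \<Longrightarrow> sorted_wrt (\<le>) Q"
  shows "\<exists>T. sorted_wrt (\<le>) T \<and> set T \<subseteq> set P \<and>
    (\<forall>c :: nat \<Rightarrow> nat list \<Rightarrow> nat. (\<forall>i w. c i w < r) \<longrightarrow>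
      (\<exists>g. rgw a P T g \<and> (\<forall>i<length Qs. \<exists>q. \<forall>f. rgw a (Qs ! i) P f \<longrightarrow> c i (wsubst a f g) = q)))"
  using assms(2,3)
proof (induction Qs arbitrary: P)
  case Nil
  thus ?case using rgw_identity[of a P] by (intro exI[of _ P]) auto
next
  case (Cons Q Qs)
  obtain T1 where T1: "sorted_wrt (\<le>) T1" "set T1 \<subseteq> set P"
    "arrows r {{wsubst a f g | f. rgw a Q P f} | g. rgw a P T1 g}"
    using typed_graham_rothschild[OF assms(1) Cons.prems(1), of Q r] Cons.prems(2) by auto
  obtain T where T: "sorted_wrt (\<le>) T" "set T \<subseteq> set T1"
    and Tc: "\<And>c :: nat \<Rightarrow> nat list \<Rightarrow> nat. (\<forall>i w. c i w < r) \<Longrightarrow>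
      (\<exists>g. rgw a T1 T g \<and> (\<forall>i<length Qs. \<exists>q. \<forall>f. rgw a (Qs ! i) T1 f \<longrightarrow> c i (wsubst a f g) = q))"
    using Cons.IH[OF T1(1)] Cons.prems(2) by auto
  have "\<exists>g. rgw a P T g \<and> (\<forall>i<length (Q # Qs). \<exists>q. \<forall>f. rgw a ((Q # Qs) ! i) P f \<longrightarrow> c i (wsubst a f g) = q)"
    if c: "\<forall>i w. c i w < r" for c :: "nat \<Rightarrow> nat list \<Rightarrow> nat"
  proof -
    obtain g' where g': "rgw a T1 T g'" and g'c: "\<And>i. i < length Qs \<Longrightarrow>
       \<exists>q. \<forall>f. rgw a (Qs ! i) T1 f \<longrightarrow> c (Suc i) (wsubst a f g') = q"
      using Tc[of "\<lambda>i. c (Suc i)"] c by auto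
    define d where "d f = c 0 (wsubst a f g')" for f
    obtain g q where g: "rgw a P T1 g" and q: "\<And>f. rgw a Q P f \<Longrightarrow> d (wsubst a f g) = q"
    proof -
      have "\<forall>w. d w < r" using c by (simp add: d_def)
      then obtain S q where "S \<in> {{wsubst a f g | f. rgw a Q P f} | g. rgw a P T1 g}" "\<forall>w\<in>S. d w = q"
        using T1(3)[unfolded arrows_def, rule_format, of d] by blast
      thus thesis using that by blast
    qed
    have assoc: "wsubst a f (wsubst a g g') = wsubst a (wsubst a f g) g'" for f
      using rgw_set[OF g'] rgw_length[OF g] by (intro wsubst_assoc) auto
    have "\<exists>q. \<forall>f. rgw a ((Q # Qs) ! i) P f \<longrightarrow> c i (wsubst a f (wsubst a g g')) = q"
      if iQ: "i < length (Q # Qs)" for i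
    proof (cases i)
      case 0
      thus ?thesis using q by (auto simp: assoc d_def)
    next
      case (Suc j)
      then obtain q where "\<And>f. rgw a (Qs ! j) T1 f \<Longrightarrow> c i (wsubst a f g') = q" using g'c[of j] iQ by auto
      thus ?thesis using rgw_wsubst[OF _ g] Suc by (auto simp: assoc)
    qed
    thus ?thesis using rgw_wsubst[OF g g'] by blast
  qed
  thus ?case using T T1(2) by (intro exI[of _ T]) auto
qed

lemma rgw_0_iff: "rgw 0 (q # Q) (p # P) w \<longleftrightarrow> p = q \<and> (\<exists>v. w = 0 # v \<and> rgw 1 Q P v)"
  by (auto elim: rgw_Cons intro: rgw.new)

lemma wsubst_0_Cons: "wsubst 0 (0 # f) (0 # g) = 0 # wsubst 1 f g"
  by (auto simp: wsubst_def nth_Cons')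

text \<open>The Ramsey property in the dual form needed for Boolean algebras. There is no constant to begin with,
but the first position necessarily carries the first parameter, and this provides the constant that
the preceding theorems require.\<close>

corollary dual_ramsey:
  fixes P :: "'l::order list"
  assumes "sorted_wrt (\<le>) P" "\<And>Q. Q \<in> set Qs \<Longrightarrow> sorted_wrt (\<le>) Q"
  obtains T where "sorted_wrt (\<le>) T" "set T \<subseteq> set P"
    "\<And>c :: nat \<Rightarrow> nat list \<Rightarrow> nat. (\<And>i w. c i w < r) \<Longrightarrow>
      (\<exists>g. rgw 0 (b # P) (b # T) g \<and>
        (\<forall>i<length Qs. \<exists>q. \<forall>f. rgw 0 (b # Qs ! i) (b # P) f \<longrightarrow> c i (wsubst 0 f g) = q))"
proof -
  obtain T where T: "sorted_wrt (\<le>) T" "set T \<subseteq> set P"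
    and Tc: "\<And>c :: nat \<Rightarrow> nat list \<Rightarrow> nat. (\<forall>i w. c i w < r) \<Longrightarrow>
      (\<exists>g. rgw 1 P T g \<and> (\<forall>i<length Qs. \<exists>q. \<forall>f. rgw 1 (Qs ! i) P f \<longrightarrow> c i (wsubst 1 f g) = q))"
    using simultaneous_graham_rothschild[of 1 P Qs r] assms by auto
  have "\<exists>g. rgw 0 (b # P) (b # T) g \<and>
        (\<forall>i<length Qs. \<exists>q. \<forall>f. rgw 0 (b # Qs ! i) (b # P) f \<longrightarrow> c i (wsubst 0 f g) = q)"
    if c: "\<And>i w. c i w < r" for c :: "nat \<Rightarrow> nat list \<Rightarrow> nat"
  proof -
    obtain g where g: "rgw 1 P T g" "\<And>i. i<length Qs \<Longrightarrow> \<exists>q. \<forall>f. rgw 1 (Qs ! i) P f \<longrightarrow> c i (0 # wsubst 1 f g) = q"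
      using Tc[of "\<lambda>i w. c i (0 # w)"] c by auto
    show ?thesis
    proof (intro exI[of _ "0 # g"] conjI allI impI)
      show "rgw 0 (b # P) (b # T) (0 # g)" using g(1) by (simp add: rgw_0_iff)
      fix i assume "i < length Qs"
      with g(2) obtain q where "\<And>f. rgw 1 (Qs ! i) P f \<Longrightarrow> c i (0 # wsubst 1 f g) = q" by blast
      thus "\<exists>q. \<forall>f. rgw 0 (b # Qs ! i) (b # P) f \<longrightarrow> c i (wsubst 0 f (0 # g)) = q"
        by (intro exI[of _ q]) (auto simp: rgw_0_iff wsubst_0_Cons)
    qed
  qed
  thus thesis using that T by blast
qed

section \<open>Standard finite structures\<close>

lemma tuples_simps:
  "tuples 0 A = {[]}" "tuples (Suc 0) A = (\<lambda>x. [x]) ` A" "tuples 2 A = (\<lambda>(x, y). [x, y]) ` (A \<times> A)"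
  by (auto simp: tuples_def length_Suc_conv numeral_2_eq_2)

lemma ball_bool_sym: "(\<forall>f::bool_sym. P f) \<longleftrightarrow> P Join \<and> P Meet \<and> P Zero \<and> P One \<and> P Neg"
  by (metis bool_sym.exhaust)

lemma is_struct_ideal_lang:
  "is_struct (ideal_lang I) M \<longleftrightarrow>
    (\<forall>x\<in>univ M. \<forall>y\<in>univ M. bjoin M x y \<in> univ M \<and> bmeet M x y \<in> univ M) \<and>
    (\<forall>x\<in>univ M. bneg M x \<in> univ M) \<and> bzero M \<in> univ M \<and> bone M \<in> univ M"
  by (auto simp: is_struct_def ideal_lang_def ball_bool_sym tuples_simps)

text \<open>The standard finite structure: the power set of the positions of \<open>L\<close>, where \<open>L ! i\<close> is the set of all \<open>j\<close>
such that the atom \<open>{i}\<close> lies in the ideal \<open>P\<^sub>j\<close>.\<close>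

definition pow_alg :: "'j set list \<Rightarrow> (nat set, 'j) ideal_struct" where
  "pow_alg L = \<lparr>univ = Pow {..<length L},
     fint = (\<lambda>f xs. case f of Join \<Rightarrow> xs ! 0 \<union> xs ! 1 | Meet \<Rightarrow> xs ! 0 \<inter> xs ! 1 | Zero \<Rightarrow> {}
        | One \<Rightarrow> {..<length L} | Neg \<Rightarrow> {..<length L} - xs ! 0),
     rint = (\<lambda>j xs. \<forall>i\<in>xs ! 0. j \<in> L ! i)\<rparr>"

text \<open>Embeddings of \<open>pow_alg L\<close>, spelled out for \<open>ideal_lang I\<close>.\<close>

definition emb :: "'j set \<Rightarrow> ('a, 'j) ideal_struct \<Rightarrow> 'j set list \<Rightarrow> (nat set \<Rightarrow> 'a) \<Rightarrow> bool" where
  "emb I C L e \<longleftrightarrow> inj_on e (Pow {..<length L}) \<and> e ` Pow {..<length L} \<subseteq> univ C \<and>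
     (\<forall>X\<in>Pow {..<length L}. \<forall>Y\<in>Pow {..<length L}.
        e (X \<union> Y) = bjoin C (e X) (e Y) \<and> e (X \<inter> Y) = bmeet C (e X) (e Y)) \<and>
     (\<forall>X\<in>Pow {..<length L}. e ({..<length L} - X) = bneg C (e X)) \<and>
     e {} = bzero C \<and> e {..<length L} = bone C \<and>
     (\<forall>j\<in>I. \<forall>X\<in>Pow {..<length L}. (\<forall>i\<in>X. j \<in> L ! i) \<longleftrightarrow> rint C j [e X])"

lemma struct_iso_pow_alg:
  "struct_iso (ideal_lang I) (pow_alg L) M e \<longleftrightarrow> emb I M L e \<and> e ` Pow {..<length L} = univ M"
  unfolding struct_iso_def emb_def bij_betw_def
  by (simp add: ideal_lang_def ball_bool_sym tuples_simps pow_alg_def ball_conj_distrib) auto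

lemma emb_struct:
  assumes "emb I C L e" "X \<subseteq> {..<length L}"
  shows "e X \<in> univ C" "bneg C (e X) = e ({..<length L} - X)" "bzero C = e {}" "bone C = e {..<length L}"
    "j \<in> I \<Longrightarrow> rint C j [e X] \<longleftrightarrow> (\<forall>i\<in>X. j \<in> L ! i)"
    "Y \<subseteq> {..<length L} \<Longrightarrow> bjoin C (e X) (e Y) = e (X \<union> Y)"
    "Y \<subseteq> {..<length L} \<Longrightarrow> bmeet C (e X) (e Y) = e (X \<inter> Y)"
    "Y \<subseteq> {..<length L} \<Longrightarrow> e X = e Y \<longleftrightarrow> X = Y"
  using assms unfolding emb_def by (simp_all add: image_subset_iff inj_on_eq_iff[of e "Pow {..<length L}"])

text \<open>The label sequences of the structures in the class under consideration. The ideals increase with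
their index, which makes labels upward closed in \<open>I\<close>, and such sets form a chain. Listing the atoms by
increasing label makes the list canonical. The leading \<open>{}\<close> belongs to an atom that lies in no ideal;
\<open>u\<close> says that there is only one.\<close>

definition label_seq :: "bool \<Rightarrow> 'j::linorder set \<Rightarrow> 'j set list \<Rightarrow> bool" where
  "label_seq u I L \<longleftrightarrow> (\<exists>T. L = {} # T \<and> sorted_wrt (\<le>) T \<and>
     (\<forall>U\<in>set T. U \<subseteq> I \<and> (\<forall>i\<in>U. \<forall>j\<in>I. i < j \<longrightarrow> j \<in> U)) \<and> (u \<longrightarrow> {} \<notin> set T))"

lemma label_seq_sorted: "label_seq u I L \<Longrightarrow> sorted_wrt (\<le>) L"
  unfolding label_seq_def by (elim exE conjE) simp

lemma label_seq_mono: "label_seq u I L \<Longrightarrow> i \<le> j \<Longrightarrow> j < length L \<Longrightarrow> L ! i \<subseteq> L ! j"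
  using sorted_wrt_nth_less[OF label_seq_sorted, of u I L i j] by (cases "i = j") auto

lemma label_seq_sub: "label_seq u I L \<Longrightarrow> i < length L \<Longrightarrow> L ! i \<subseteq> I"
  unfolding label_seq_def by (elim exE conjE, cases i) simp_all

lemma label_seq_up:
  assumes "label_seq u I L" "i < length L" "k \<in> L ! i" "j \<in> I" "k < j"
  shows "j \<in> L ! i"
proof -
  obtain T where T: "L = {} # T" "\<forall>U\<in>set T. U \<subseteq> I \<and> (\<forall>i\<in>U. \<forall>j\<in>I. i < j \<longrightarrow> j \<in> U)"
    using assms(1) unfolding label_seq_def by (elim exE conjE) simp
  then obtain m where "i = Suc m" "L ! i = T ! m" using assms(3) by (cases i) auto
  moreover have "T ! m \<in> set T" using assms(2) T(1) \<open>i = Suc m\<close> by simp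
  ultimately show ?thesis using T(2) assms(3-5) by metis
qed

lemma label_seq_0: "label_seq u I L \<Longrightarrow> 0 < length L \<and> L ! 0 = {}"
  unfolding label_seq_def by (elim exE conjE) simp

lemma label_seq_unique: "label_seq True I L \<Longrightarrow> i < length L \<Longrightarrow> L ! i = {} \<Longrightarrow> i = 0"
  unfolding label_seq_def by (elim exE conjE, cases i) (simp_all, metis nth_mem)

text \<open>The three classes are two: the class with one predicate is an instance of the class with a unique
free atom.\<close>

definition ideal_class :: "bool \<Rightarrow> 'j::linorder set \<Rightarrow> ('a, 'j) ideal_struct set" where
  "ideal_class u I = (if u then class_B_J_u I else class_B I)"

lemma class_B_u_eq: "class_B_u z = ideal_class True {z}"
  by (auto simp: class_B_u_def ideal_class_def class_B_J_u_def free_atoms_def)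

lemma ideal_class_iff: "M \<in> ideal_class u I \<longleftrightarrow> is_struct (ideal_lang I) M \<and> finite (univ M) \<and> is_boolean_algebra M \<and>
     (\<forall>j\<in>I. is_ideal M (pset M j)) \<and>
     (\<forall>i\<in>I. \<forall>j\<in>I. i < j \<longrightarrow> pset M i \<subseteq> pset M j) \<and>
     (\<exists>a. a \<in> free_atoms I M) \<and> (u \<longrightarrow> (\<forall>a\<in>free_atoms I M. \<forall>b\<in>free_atoms I M. a = b))"
  by (auto simp: ideal_class_def class_B_J_u_def class_B_def)

section \<open>Finite Boolean algebras\<close>

locale finite_ba =
  fixes M :: "('a, 'j) ideal_struct"
  assumes ba: "is_boolean_algebra M" and fin: "finite (univ M)"
begin

lemma closed:
  "x \<in> univ M \<Longrightarrow> y \<in> univ M \<Longrightarrow> bjoin M x y \<in> univ M"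
  "x \<in> univ M \<Longrightarrow> y \<in> univ M \<Longrightarrow> bmeet M x y \<in> univ M"
  "x \<in> univ M \<Longrightarrow> bneg M x \<in> univ M" "bzero M \<in> univ M" "bone M \<in> univ M"
  using ba by (auto simp: is_boolean_algebra_def is_struct_ideal_lang)

lemma comm: "x \<in> univ M \<Longrightarrow> y \<in> univ M \<Longrightarrow> bmeet M x y = bmeet M y x"
    "x \<in> univ M \<Longrightarrow> y \<in> univ M \<Longrightarrow> bjoin M x y = bjoin M y x"
  using ba by (auto simp: is_boolean_algebra_def)

lemma assoc: "x \<in> univ M \<Longrightarrow> y \<in> univ M \<Longrightarrow> z \<in> univ M \<Longrightarrow> bmeet M (bmeet M x y) z = bmeet M x (bmeet M y z)"
  using ba by (auto simp: is_boolean_algebra_def)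

lemma distrib:
  "x \<in> univ M \<Longrightarrow> y \<in> univ M \<Longrightarrow> z \<in> univ M \<Longrightarrow> bmeet M x (bjoin M y z) = bjoin M (bmeet M x y) (bmeet M x z)"
  "x \<in> univ M \<Longrightarrow> y \<in> univ M \<Longrightarrow> z \<in> univ M \<Longrightarrow> bjoin M x (bmeet M y z) = bmeet M (bjoin M x y) (bjoin M x z)"
  using ba by (auto simp: is_boolean_algebra_def)

lemma units:
  "x \<in> univ M \<Longrightarrow> bmeet M x (bone M) = x" "x \<in> univ M \<Longrightarrow> bjoin M x (bzero M) = x"
  "x \<in> univ M \<Longrightarrow> bmeet M x (bneg M x) = bzero M" "x \<in> univ M \<Longrightarrow> bjoin M x (bneg M x) = bone M"
  using ba by (auto simp: is_boolean_algebra_def)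

lemma idem: assumes x: "x \<in> univ M" shows "bmeet M x x = x" "bjoin M x x = x"
proof -
  have n: "bneg M x \<in> univ M" using x closed by blast
  show "bmeet M x x = x"
    using distrib(1)[OF x x n] by (simp add: units x closed)
  show "bjoin M x x = x"
    using distrib(2)[OF x x n] by (simp add: units x closed)
qed

lemma zero_meet: assumes x: "x \<in> univ M" shows "bmeet M x (bzero M) = bzero M"
proof -
  show ?thesis
    using assoc[OF x x closed(3)[OF x]] by (simp add: units idem x)
qed

text \<open>The Stone map of a finite Boolean algebra.\<close>

definition below :: "'a \<Rightarrow> 'a set" where "below x = {a \<in> atoms M. ble M a x}"

lemma atom_univ: "a \<in> atoms M \<Longrightarrow> a \<in> univ M" and atom_nonzero: "a \<in> atoms M \<Longrightarrow> a \<noteq> bzero M"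
  by (auto simp: atoms_def)

lemma atom_meet: assumes "a \<in> atoms M" "x \<in> univ M" shows "bmeet M a x = bzero M \<or> bmeet M a x = a"
proof -
  have a: "a \<in> univ M" using assms atom_univ by auto
  have "bmeet M (bmeet M a x) a = bmeet M a x"
    using assoc[OF a a assms(2)] comm(1)[OF closed(2)[OF a assms(2)] a] idem(1)[OF a] by simp
  thus ?thesis using assms closed(2)[OF a assms(2)] unfolding atoms_def ble_def by blast
qed

lemma atom_below_iff: "a \<in> atoms M \<Longrightarrow> x \<in> univ M \<Longrightarrow> a \<in> below x \<longleftrightarrow> bmeet M a x \<noteq> bzero M"
  using atom_meet[of a x] atom_nonzero[of a] by (auto simp: below_def ble_def)

lemma below_atoms: "below x \<subseteq> atoms M" by (auto simp: below_def)

lemma below_zero: "below (bzero M) = {}"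
proof -
  have "a \<notin> below (bzero M)" if "a \<in> atoms M" for a
    using atom_below_iff[OF that closed(4)] zero_meet[OF atom_univ[OF that]] by blast
  thus ?thesis using below_atoms by blast
qed

lemma below_one: "below (bone M) = atoms M"
  using units atom_univ by (auto simp: below_def ble_def)

lemma below_meet: assumes "x \<in> univ M" "y \<in> univ M" shows "below (bmeet M x y) = below x \<inter> below y"
proof -
  have "bmeet M a (bmeet M x y) = a \<longleftrightarrow> bmeet M a x = a \<and> bmeet M a y = a" if a: "a \<in> atoms M" for a
  proof
    have aU: "a \<in> univ M" using a atom_univ by auto
    assume h: "bmeet M a (bmeet M x y) = a"
    note xy = closed(2)[OF assms]
    have "bmeet M (bmeet M x y) x = bmeet M x y"
      using assoc[OF assms(1,1,2)] comm(1)[OF xy assms(1)] idem(1)[OF assms(1)] by simp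
    hence "bmeet M a x = a" using assoc[OF aU xy assms(1)] h by simp
    moreover have "bmeet M (bmeet M x y) y = bmeet M x y"
      using assoc[OF assms assms(2)] idem(1)[OF assms(2)] by simp
    hence "bmeet M a y = a" using assoc[OF aU xy assms(2)] h by simp
    ultimately show "bmeet M a x = a \<and> bmeet M a y = a" ..
  next
    assume "bmeet M a x = a \<and> bmeet M a y = a"
    thus "bmeet M a (bmeet M x y) = a" using assoc[of a x y] a atom_univ assms by simp
  qed
  thus ?thesis by (auto simp: below_def ble_def)
qed

lemma below_join: assumes "x \<in> univ M" "y \<in> univ M" shows "below (bjoin M x y) = below x \<union> below y"
proof -
  have zero: "bmeet M a (bjoin M x y) = bzero M \<longleftrightarrow> bmeet M a x = bzero M \<and> bmeet M a y = bzero M"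
    if a: "a \<in> atoms M" for a
  proof -
    have aU: "a \<in> univ M" using a atom_univ by auto
    have *: "bmeet M a (bjoin M x y) = bjoin M (bmeet M a x) (bmeet M a y)" using distrib aU assms by auto
    have "bjoin M (bzero M) a = a" using comm(2)[of "bzero M" a] units(2)[OF aU] aU closed(4) by simp
    thus ?thesis unfolding * using atom_meet[OF a assms(1)] atom_meet[OF a assms(2)] atom_nonzero[OF a]
        units(2)[OF aU] units(2)[OF closed(4)] idem(2)[OF aU] by auto
  qed
  have "a \<in> below (bjoin M x y) \<longleftrightarrow> a \<in> below x \<union> below y" if a: "a \<in> atoms M" for a
    using zero[OF a] atom_below_iff[OF a assms(1)] atom_below_iff[OF a assms(2)]
      atom_below_iff[OF a closed(1)[OF assms]] by blast
  thus ?thesis using below_atoms by blast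
qed

lemma below_neg: assumes "x \<in> univ M" shows "below (bneg M x) = atoms M - below x"
proof -
  have "below x \<inter> below (bneg M x) = {}" "below x \<union> below (bneg M x) = atoms M"
    using below_meet[OF assms closed(3)[OF assms]] below_join[OF assms closed(3)[OF assms]]
      units assms below_zero below_one by auto
  thus ?thesis using below_atoms by blast
qed

lemma ble_trans:
  assumes "x \<in> univ M" "y \<in> univ M" "z \<in> univ M" "ble M x y" "ble M y z" shows "ble M x z"
  using assms assoc[of x y z] by (simp add: ble_def)

lemma atom_exists: assumes "x \<in> univ M" "x \<noteq> bzero M" shows "below x \<noteq> {}"
  using assms
proof (induction "card {y \<in> univ M. ble M y x}" arbitrary: x rule: less_induct)
  case less
  show ?case
  proof (cases "x \<in> atoms M")
    case True
    thus ?thesis using idem less.prems by (auto simp: below_def ble_def)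
  next
    case False
    then obtain y where y: "y \<in> univ M" "ble M y x" "y \<noteq> bzero M" "y \<noteq> x"
      using less.prems by (auto simp: atoms_def)
    have "x \<notin> {z \<in> univ M. ble M z y}"
      using y less.prems comm[of x y] by (auto simp: ble_def)
    moreover have "x \<in> {z \<in> univ M. ble M z x}" using idem less.prems by (auto simp: ble_def)
    moreover have "{z \<in> univ M. ble M z y} \<subseteq> {z \<in> univ M. ble M z x}"
      using ble_trans y less.prems by blast
    ultimately have "{z \<in> univ M. ble M z y} \<subset> {z \<in> univ M. ble M z x}" by blast
    hence "card {z \<in> univ M. ble M z y} < card {z \<in> univ M. ble M z x}"
      using fin by (intro psubset_card_mono) auto
    from less.hyps[OF this y(1,3)] obtain a where "a \<in> atoms M" "ble M a y" by (auto simp: below_def)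
    thus ?thesis using ble_trans[of a y x] y less.prems atom_univ by (auto simp: below_def)
  qed
qed

lemma below_subset_imp: assumes "x \<in> univ M" "y \<in> univ M" "below x \<subseteq> below y" shows "bmeet M x y = x"
proof -
  have ny: "bneg M y \<in> univ M" using assms closed by auto
  have "below (bmeet M x (bneg M y)) = {}"
    using below_meet[OF assms(1) ny] below_neg[OF assms(2)] assms(3) by auto
  hence "bmeet M x (bneg M y) = bzero M" using atom_exists closed assms ny by metis
  thus ?thesis using distrib(1)[OF assms(1,2) ny] units(1)[OF assms(1)] units(4)[OF assms(2)]
      units(2)[OF closed(2)[OF assms(1,2)]] by simp
qed

lemma below_inj: "inj_on below (univ M)"
  by (rule inj_onI) (metis below_subset_imp comm(1) order_refl)

lemma below_eqD: "below x = below y \<Longrightarrow> x \<in> univ M \<Longrightarrow> y \<in> univ M \<Longrightarrow> x = y"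
  using below_inj by (rule inj_onD)

lemma below_atom: assumes "a \<in> atoms M" shows "below a = {a}"
proof -
  have "b = a" if "b \<in> atoms M" "ble M b a" for b
    using that assms by (auto simp: atoms_def)
  thus ?thesis using assms idem atom_univ by (auto simp: below_def ble_def)
qed

lemma finite_atoms: "finite (atoms M)" using fin by (auto simp: atoms_def)

lemma below_surj: "A \<subseteq> atoms M \<Longrightarrow> \<exists>x\<in>univ M. below x = A"
proof (induction A rule: infinite_finite_induct)
  case (infinite A)
  thus ?case using finite_atoms finite_subset by blast
next
  case empty
  thus ?case using below_zero closed by auto
next
  case (insert a A)
  then obtain x where "x \<in> univ M" "below x = A" by auto
  thus ?case using below_join[of a x] below_atom[of a] atom_univ[of a] insert closed(1)[of a x] by auto
qed

text \<open>An ideal of a finite Boolean algebra is determined by the atoms in it, because an element is the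
finite join of the atoms below it.\<close>

lemma ideal_iff:
  assumes I: "is_ideal M K" and x: "x \<in> univ M"
  shows "x \<in> K \<longleftrightarrow> below x \<subseteq> K"
proof
  assume "x \<in> K"
  thus "below x \<subseteq> K" using I atom_univ unfolding is_ideal_def below_def by blast
next
  have closed_join: "finite A \<Longrightarrow> A \<subseteq> atoms M \<Longrightarrow> A \<subseteq> K \<Longrightarrow> y \<in> univ M \<Longrightarrow> below y = A \<Longrightarrow> y \<in> K" for A y
  proof (induction A arbitrary: y rule: finite_induct)
    case empty
    hence "y = bzero M" using below_zero closed by (intro below_eqD) auto
    thus ?case using I by (auto simp: is_ideal_def)
  next
    case (insert a A)
    obtain z where z: "z \<in> univ M" "below z = A" using below_surj[of A] insert by auto
    have zK: "z \<in> K" using insert.IH[of z] insert.prems z by auto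
    have aU: "a \<in> univ M" using atom_univ insert by auto
    have "below (bjoin M a z) = below y" using below_join[OF aU z(1)] below_atom[of a] insert z by auto
    hence "y = bjoin M a z" using closed(1)[OF aU z(1)] insert.prems by (intro below_eqD) auto
    thus ?case using I zK insert by (auto simp: is_ideal_def)
  qed
  assume "below x \<subseteq> K"
  with closed_join[OF finite_subset[OF below_atoms finite_atoms] below_atoms _ x refl] show "x \<in> K" .
qed

text \<open>The inverse of the Stone map, read along an enumeration of the atoms.\<close>

lemma representation:
  assumes as: "distinct as" "set as = atoms M"
    and ideals: "\<And>j. j \<in> I \<Longrightarrow> is_ideal M (pset M j)"
    and L: "length L = length as" "\<And>i j. i < length as \<Longrightarrow> j \<in> I \<Longrightarrow> j \<in> L ! i \<longleftrightarrow> as ! i \<in> pset M j"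
  obtains e where "struct_iso (ideal_lang I) (pow_alg L) M e" "\<And>i. i < length as \<Longrightarrow> e {i} = as ! i"
proof -
  let ?n = "length as"
  define e where "e X = inv_into (univ M) below ((!) as ` X)" for X
  have im: "below ` univ M = Pow (atoms M)" using below_surj below_atoms by blast
  have eX: "e X \<in> univ M" "below (e X) = (!) as ` X" if "X \<subseteq> {..<?n}" for X
  proof -
    have "(!) as ` X \<in> below ` univ M" using that as(2) unfolding im by (auto simp: subset_iff)
    thus "e X \<in> univ M" "below (e X) = (!) as ` X" unfolding e_def
      by (rule inv_into_into, intro f_inv_into_f)
  qed
  have inj: "inj_on ((!) as) {..<?n}" using as(1) by (auto simp: inj_on_def nth_eq_iff_index_eq)
  have eqI: "x = e X" if "x \<in> univ M" "X \<subseteq> {..<?n}" "below x = (!) as ` X" for x X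
    using that eX[OF that(2)] by (intro below_eqD) auto
  have at: "atoms M = (!) as ` {..<?n}" using as(2) by (auto simp: set_conv_nth)
  have "emb I M L e" unfolding emb_def L(1)
  proof (intro conjI ballI)
    show "inj_on e (Pow {..<?n})"
    proof (rule inj_onI)
      fix X Y assume *: "X \<in> Pow {..<?n}" "Y \<in> Pow {..<?n}" "e X = e Y"
      hence "(!) as ` X = (!) as ` Y" using eX[of X] eX[of Y] by simp
      thus "X = Y" using inj_on_image_eq_iff[OF inj, of X Y] * by auto
    qed
    show "e ` Pow {..<?n} \<subseteq> univ M" using eX by auto
    fix X assume X: "X \<in> Pow {..<?n}"
    hence X': "X \<subseteq> {..<?n}" by auto
    show "e ({..<?n} - X) = bneg M (e X)"
      using eX[OF X'] closed below_neg inj X' at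
      by (intro eqI[symmetric]) (auto simp: inj_on_image_set_diff[OF inj])
    { fix Y assume Y: "Y \<in> Pow {..<?n}"
      hence Y': "Y \<subseteq> {..<?n}" by auto
      show "e (X \<union> Y) = bjoin M (e X) (e Y)"
        using eX[OF X'] eX[OF Y'] closed below_join X' Y' by (intro eqI[symmetric]) (auto simp: image_Un)
      show "e (X \<inter> Y) = bmeet M (e X) (e Y)"
        using eX[OF X'] eX[OF Y'] closed below_meet X' Y' by (intro eqI[symmetric]) (auto simp: inj_on_image_Int[OF inj]) }
    fix j assume j: "j \<in> I"
    have "rint M j [e X] \<longleftrightarrow> e X \<in> pset M j" using eX[OF X'] by (auto simp: pset_def)
    also have "\<dots> \<longleftrightarrow> (\<forall>i\<in>X. j \<in> L ! i)"
    proof -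
      have "(\<forall>i\<in>X. j \<in> L ! i) \<longleftrightarrow> (\<forall>i\<in>X. as ! i \<in> pset M j)"
        using L(2)[OF _ j] X' by (intro ball_cong) auto
      thus ?thesis using ideal_iff[OF ideals[OF j] eX(1)[OF X']] eX(2)[OF X'] by (simp add: image_subset_iff)
    qed
    finally show "(\<forall>i\<in>X. j \<in> L ! i) \<longleftrightarrow> rint M j [e X]" ..
  next
    show "e {} = bzero M" using closed below_zero by (intro eqI[symmetric]) auto
    show "e {..<?n} = bone M" using closed below_one at by (intro eqI[symmetric]) auto
  qed
  moreover have "e ` Pow {..<?n} = univ M"
  proof
    show "univ M \<subseteq> e ` Pow {..<?n}"
    proof
      fix x assume x: "x \<in> univ M"
      have "below x \<subseteq> (!) as ` {..<?n}" using below_atoms at by auto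
      then obtain X where "X \<subseteq> {..<?n}" "below x = (!) as ` X" by (auto simp: subset_image_iff)
      thus "x \<in> e ` Pow {..<?n}" using eqI[OF x] by blast
    qed
  qed (use eX in auto)
  ultimately have "struct_iso (ideal_lang I) (pow_alg L) M e" by (simp add: struct_iso_pow_alg L(1))
  moreover have "e {i} = as ! i" if "i < ?n" for i
  proof -
    have at_i: "as ! i \<in> atoms M" using nth_mem[OF that] unfolding as(2) .
    show ?thesis by (intro eqI[symmetric]) (simp_all add: below_atom[OF at_i] atom_univ[OF at_i] that)
  qed
  ultimately show thesis using that by blast
qed

end

section \<open>Natural orderings as lexicographic orderings\<close>

lemma finite_linear_order_list:
  assumes "trans R" "irrefl R" "finite A" "total_on A R"
  shows "\<exists>xs. distinct xs \<and> set xs = A \<and> sorted_wrt (\<lambda>x y. (y, x) \<in> R) xs"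
  using assms(3,4)
proof (induction A rule: finite_induct)
  case (insert a A)
  then obtain xs where xs: "distinct xs" "set xs = A" "sorted_wrt (\<lambda>x y. (y, x) \<in> R) xs"
    by (auto simp: total_on_def)
  let ?ys = "filter (\<lambda>x. (a, x) \<in> R) xs @ a # filter (\<lambda>x. (x, a) \<in> R) xs"
  have asym: "(x, y) \<in> R \<Longrightarrow> (y, x) \<notin> R" for x y
    using assms(1,2) by (meson irrefl_def transD)
  have "distinct ?ys" using xs insert(2) asym by auto
  moreover have "set ?ys = insert a A" using xs insert(2) insert.prems by (auto simp: total_on_def)
  moreover have "sorted_wrt (\<lambda>x y. (y, x) \<in> R) ?ys"
    using xs(3) assms(1) by (auto simp: sorted_wrt_append sorted_wrt_filter dest: transD)
  ultimately show ?case by blast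
qed auto

text \<open>The natural ordering of \<open>pow_alg L\<close> when position \<open>0\<close> is the largest atom: the largest atom at which
two elements differ is the least position in their symmetric difference.\<close>

definition lexless :: "nat set \<Rightarrow> nat set \<Rightarrow> bool" where
  "lexless X Y \<longleftrightarrow> (\<exists>m. m \<in> Y \<and> m \<notin> X \<and> (\<forall>i<m. i \<in> X \<longleftrightarrow> i \<in> Y))"

lemma lexless_irrefl: "\<not> lexless X X"
  by (auto simp: lexless_def)

lemma lexless_trans: assumes "lexless X Y" "lexless Y Z" shows "lexless X Z"
proof -
  obtain m where m: "m \<in> Y" "m \<notin> X" "\<And>i. i < m \<Longrightarrow> i \<in> X \<longleftrightarrow> i \<in> Y" using assms(1) by (auto simp: lexless_def)
  obtain n where n: "n \<in> Z" "n \<notin> Y" "\<And>i. i < n \<Longrightarrow> i \<in> Y \<longleftrightarrow> i \<in> Z" using assms(2) by (auto simp: lexless_def)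
  have "m \<noteq> n" using m n by auto
  hence "min m n \<in> Z \<and> min m n \<notin> X" using m n by (cases "m < n") (auto simp: min_def)
  moreover have "\<forall>i<min m n. i \<in> X \<longleftrightarrow> i \<in> Z" using m n by auto
  ultimately show ?thesis unfolding lexless_def by blast
qed

lemma lexless_total: assumes "X \<noteq> Y" shows "lexless X Y \<or> lexless Y X"
proof -
  let ?P = "\<lambda>i. (i \<in> X) \<noteq> (i \<in> Y)"
  have ex: "\<exists>i. ?P i" using assms by blast
  have "?P (LEAST i. ?P i)" by (rule LeastI_ex[OF ex])
  moreover have "\<And>i. i < (LEAST i. ?P i) \<Longrightarrow> \<not> ?P i" by (rule not_less_Least)
  ultimately show ?thesis unfolding lexless_def by blast
qed

lemma lexless_asym: "lexless X Y \<Longrightarrow> \<not> lexless Y X"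
  using lexless_trans lexless_irrefl by blast

lemma lexless_iff_least:
  assumes "X \<noteq> Y"
  shows "lexless X Y \<longleftrightarrow> (\<exists>m. m \<in> Y \<and> ((m \<in> X) \<noteq> (m \<in> Y)) \<and> (\<forall>i. (i \<in> X) \<noteq> (i \<in> Y) \<and> i \<noteq> m \<longrightarrow> m < i))"
  unfolding lexless_def by (metis linorder_neqE_nat order_less_irrefl order_less_asym)

lemma emb_ble:
  assumes "emb I M L e" "X \<subseteq> {..<length L}" "Y \<subseteq> {..<length L}"
  shows "ble M (e X) (e Y) \<longleftrightarrow> X \<subseteq> Y"
proof -
  have "X \<inter> Y \<subseteq> {..<length L}" using assms by auto
  thus ?thesis using emb_struct(7)[OF assms(1,2,3)] emb_struct(8)[OF assms(1) _ assms(2), of "X \<inter> Y"]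
    by (auto simp: ble_def)
qed

lemma iso_atoms:
  assumes e: "emb I M L e" and M: "univ M = e ` Pow {..<length L}"
  shows "atoms M = (\<lambda>i. e {i}) ` {..<length L}"
proof -
  have singleton: "e X \<in> atoms M \<longleftrightarrow> (\<exists>i. X = {i})" if X: "X \<subseteq> {..<length L}" for X
  proof -
    have "e X \<in> atoms M \<longleftrightarrow> X \<noteq> {} \<and> (\<forall>Y. Y \<subseteq> {..<length L} \<longrightarrow> Y \<subseteq> X \<longrightarrow> Y = {} \<or> Y = X)"
      using X emb_ble[OF e _ X] emb_struct(8)[OF e _ X] emb_struct(8)[OF e X, of "{}"]
        emb_struct(8)[OF e, of _ "{}"]
      by (simp add: atoms_def M emb_struct(3)[OF e empty_subsetI] Pow_def)
    also have "\<dots> \<longleftrightarrow> (\<exists>i. X = {i})"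
    proof
      assume *: "X \<noteq> {} \<and> (\<forall>Y. Y \<subseteq> {..<length L} \<longrightarrow> Y \<subseteq> X \<longrightarrow> Y = {} \<or> Y = X)"
      then obtain i where "i \<in> X" by auto
      hence "{i} = X" using *[THEN conjunct2, rule_format, of "{i}"] X by auto
      thus "\<exists>i. X = {i}" by auto
    qed auto
    finally show ?thesis .
  qed
  show ?thesis
  proof (intro equalityI subsetI)
    fix x assume x: "x \<in> atoms M"
    then obtain X where X: "X \<subseteq> {..<length L}" "x = e X" using M by (auto simp: atoms_def)
    then obtain i where "X = {i}" using singleton[OF X(1)] x by blast
    thus "x \<in> (\<lambda>i. e {i}) ` {..<length L}" using X by auto
  next
    fix x assume "x \<in> (\<lambda>i. e {i}) ` {..<length L}"
    thus "x \<in> atoms M" using singleton by auto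
  qed
qed

lemma iso_pset:
  assumes e: "emb I M L e" and M: "univ M = e ` Pow {..<length L}" and "j \<in> I"
  shows "X \<subseteq> {..<length L} \<Longrightarrow> e X \<in> pset M j \<longleftrightarrow> (\<forall>i\<in>X. j \<in> L ! i)"
  using emb_struct(1,5)[OF e] assms(3) by (simp add: pset_def)

lemma iso_free_atom:
  assumes e: "emb I M L e" and M: "univ M = e ` Pow {..<length L}" and g: "label_seq u I L" and i: "i < length L"
  shows "e {i} \<in> free_atoms I M \<longleftrightarrow> L ! i = {}"
proof -
  have "e {i} \<in> atoms M" using iso_atoms[OF e M] i by auto
  hence "e {i} \<in> free_atoms I M \<longleftrightarrow> (\<forall>j\<in>I. j \<notin> L ! i)"
    using iso_pset[OF e M, of _ "{i}"] i by (simp add: free_atoms_def)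
  thus ?thesis using label_seq_sub[OF g i] by blast
qed

text \<open>Membership in the class is invariant under isomorphism, and the standard structures are members.\<close>

lemma iso_in_class:
  assumes iso: "struct_iso (ideal_lang I) (pow_alg L) M e" and g: "label_seq u I L"
  shows "M \<in> ideal_class u I"
proof -
  have e: "emb I M L e" and M: "univ M = e ` Pow {..<length L}"
    using iso by (auto simp: struct_iso_pow_alg)
  note es = emb_struct[OF e]
  have all: "(\<forall>x\<in>univ M. P x) \<longleftrightarrow> (\<forall>X. X \<subseteq> {..<length L} \<longrightarrow> P (e X))" for P
    unfolding M by auto
  have str: "is_struct (ideal_lang K) M" for K
    unfolding is_struct_ideal_lang all
    by (auto simp: es(2) es(6) es(7) es(3)[OF empty_subsetI] es(4)[OF empty_subsetI] intro!: es(1))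
  have "is_boolean_algebra M"
    unfolding is_boolean_algebra_def all
    by (intro conjI allI impI str;
        simp add: es(2) es(6) es(7) es(3)[OF empty_subsetI] es(4)[OF empty_subsetI] le_infI1;
        rule arg_cong[where f = e]; blast)
  moreover have "is_ideal M (pset M j)" if j: "j \<in> I" for j
    unfolding is_ideal_def
  proof (intro conjI ballI impI)
    show "pset M j \<subseteq> univ M" by (auto simp: pset_def)
    show "bzero M \<in> pset M j" using iso_pset[OF e M j, of "{}"] es(3)[of "{}"] by simp
    show "bone M \<notin> pset M j" using iso_pset[OF e M j, of "{..<length L}"] es(4)[of "{}"] label_seq_0[OF g] by auto
    fix x y assume x: "x \<in> univ M" and y: "y \<in> pset M j" and le: "ble M x y"
    obtain X Y where XY: "X \<subseteq> {..<length L}" "Y \<subseteq> {..<length L}" "x = e X" "y = e Y"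
      using x y M by (auto simp: pset_def)
    thus "x \<in> pset M j" using iso_pset[OF e M j] emb_ble[OF e, of X Y] le y by auto
  next
    fix x y assume x: "x \<in> pset M j" and y: "y \<in> pset M j"
    obtain X Y where XY: "X \<subseteq> {..<length L}" "Y \<subseteq> {..<length L}" "x = e X" "y = e Y"
      using x y M by (auto simp: pset_def)
    thus "bjoin M x y \<in> pset M j" using iso_pset[OF e M j] es(6)[of X Y] x y by auto
  qed
  moreover have "pset M i \<subseteq> pset M j" if ij: "i \<in> I" "j \<in> I" "i < j" for i j
  proof
    fix x assume x: "x \<in> pset M i"
    then obtain X where X: "X \<subseteq> {..<length L}" "x = e X" using M by (auto simp: pset_def)
    have "\<forall>k\<in>X. i \<in> L ! k" using iso_pset[OF e M ij(1) X(1)] x X(2) by simp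
    hence "\<forall>k\<in>X. j \<in> L ! k" using label_seq_up[OF g _ _ ij(2,3)] X(1) by blast
    thus "x \<in> pset M j" using iso_pset[OF e M ij(2) X(1)] X(2) by simp
  qed
  moreover have "\<exists>a. a \<in> free_atoms I M"
    by (rule exI[of _ "e {0}"]) (use iso_free_atom[OF e M g, of 0] label_seq_0[OF g] in simp)
  moreover have uniq: "a = e {0}" if u: u and a: "a \<in> free_atoms I M" for a
  proof -
    obtain i where i: "i < length L" "a = e {i}" using a iso_atoms[OF e M] by (auto simp: free_atoms_def)
    hence "L ! i = {}" using iso_free_atom[OF e M g i(1)] a by simp
    thus ?thesis using label_seq_unique[of I L i] g u i by simp
  qed
  moreover have "u \<longrightarrow> (\<forall>a\<in>free_atoms I M. \<forall>b\<in>free_atoms I M. a = b)" using uniq by metis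
  moreover have "finite (univ M)" using M by simp
  ultimately show ?thesis unfolding ideal_class_iff using str[of I] by simp
qed

text \<open>Every member of the class is standard. Enumerating the atoms downwards along a proper ordering makes
the label sequence increasing, which is exactly what properness says, and puts a free atom first.\<close>

lemma class_iso:
  assumes M: "M \<in> ideal_class u I" and S: "proper_ordering I M S"
  obtains L e where "label_seq u I L" "struct_iso (ideal_lang I) (pow_alg L) M e"
    "\<And>i j. i < length L \<Longrightarrow> j < length L \<Longrightarrow> (e {i}, e {j}) \<in> S \<longleftrightarrow> j < i"
proof -
  have M': "is_boolean_algebra M" "finite (univ M)" and ideals: "\<And>j. j \<in> I \<Longrightarrow> is_ideal M (pset M j)"
    and mono: "\<And>i j. i \<in> I \<Longrightarrow> j \<in> I \<Longrightarrow> i < j \<Longrightarrow> pset M i \<subseteq> pset M j"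
    and ex: "\<exists>a. a \<in> free_atoms I M"
    and uniq: "\<And>a b. u \<Longrightarrow> a \<in> free_atoms I M \<Longrightarrow> b \<in> free_atoms I M \<Longrightarrow> a = b"
    using M unfolding ideal_class_iff by blast+
  interpret finite_ba M using M' by unfold_locales
  have lin: "trans S" "irrefl S" "total_on (atoms M) S"
    and proper: "\<And>a b i. a \<in> atoms M \<Longrightarrow> b \<in> atoms M \<Longrightarrow> i \<in> I \<Longrightarrow> a \<in> pset M i \<Longrightarrow>
       (\<exists>j\<in>I. i < j \<and> b \<in> pset M j - pset M i) \<or> (\<forall>k\<in>I. b \<notin> pset M k) \<Longrightarrow> (a, b) \<in> S"
    using S unfolding proper_ordering_def linear_ordering_def strict_linear_order_on_def by blast+
  obtain as where as: "distinct as" "set as = atoms M" and srt: "sorted_wrt (\<lambda>x y. (y, x) \<in> S) as"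
    using finite_linear_order_list[OF lin(1,2) finite_atoms lin(3)] by blast
  have ord: "(as ! i, as ! j) \<in> S \<longleftrightarrow> j < i" if "i < length as" "j < length as" for i j
  proof -
    have irr: "(x, x) \<notin> S" for x using lin(2) by (simp add: irrefl_def)
    consider "j < i" | "i = j" | "i < j" by linarith
    thus ?thesis
    proof cases
      case 1
      thus ?thesis using sorted_wrt_nth_less[OF srt 1 that(1)] by simp
    next
      case 2
      thus ?thesis using irr by simp
    next
      case 3
      have "(as ! j, as ! i) \<in> S" using sorted_wrt_nth_less[OF srt 3 that(2)] .
      hence "(as ! i, as ! j) \<notin> S" using transD[OF lin(1), of "as ! i" "as ! j" "as ! i"] irr by blast
      thus ?thesis using 3 by simp
    qed
  qed
  have at: "as ! i \<in> atoms M" if "i < length as" for i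
    using nth_mem[OF that] unfolding as(2) .
  define L where "L = map (\<lambda>a. {j \<in> I. a \<in> pset M j}) as"
  have L: "length L = length as" "\<And>i j. i < length as \<Longrightarrow> j \<in> I \<Longrightarrow> j \<in> L ! i \<longleftrightarrow> as ! i \<in> pset M j"
    by (auto simp: L_def)
  obtain e where e: "struct_iso (ideal_lang I) (pow_alg L) M e" "\<And>i. i < length as \<Longrightarrow> e {i} = as ! i"
    using representation[OF as ideals L] by blast
  have free: "as ! i \<in> free_atoms I M \<longleftrightarrow> L ! i = {}" if "i < length as" for i
    using at[OF that] that by (auto simp: free_atoms_def L_def)
  \<comment> \<open>Otherwise \<open>as ! j\<close> avoids an ideal that contains \<open>as ! i\<close>, and properness would put it above \<open>as ! i\<close>.\<close>
  have monoL: "L ! i \<subseteq> L ! j" if ij: "i < j" "j < length as" for i j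
  proof
    fix k assume k: "k \<in> L ! i"
    hence kI: "k \<in> I" "as ! i \<in> pset M k" using ij by (auto simp: L_def)
    show "k \<in> L ! j"
    proof (rule ccontr)
      assume "k \<notin> L ! j"
      hence nk: "as ! j \<notin> pset M k" using kI ij by (auto simp: L_def)
      have "(\<exists>j'\<in>I. k < j' \<and> as ! j \<in> pset M j' - pset M k) \<or> (\<forall>k\<in>I. as ! j \<notin> pset M k)"
      proof (rule disjCI)
        assume "\<not> (\<forall>k\<in>I. as ! j \<notin> pset M k)"
        then obtain j' where j': "j' \<in> I" "as ! j \<in> pset M j'" by blast
        have "\<not> j' < k" using mono[OF j'(1) kI(1)] j' nk by blast
        moreover have "j' \<noteq> k" using j' nk by blast
        ultimately have "k < j'" by (metis linorder_neqE)
        thus "\<exists>j'\<in>I. k < j' \<and> as ! j \<in> pset M j' - pset M k" using j' nk by auto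
      qed
      from proper[OF at at kI this] have "(as ! i, as ! j) \<in> S" using ij by auto
      thus False using ord[of i j] ij by auto
    qed
  qed
  obtain a where a: "a \<in> free_atoms I M" using ex by blast
  hence "a \<in> set as" unfolding as(2) by (simp add: free_atoms_def)
  then obtain k where k: "k < length as" "as ! k = a" unfolding in_set_conv_nth by blast
  have L0: "L ! 0 = {}" using monoL[of 0 k] free[OF k(1)] a k by (cases "k = 0") auto
  obtain T where T: "L = {} # T" using L0 L(1) k(1) by (cases L) auto
  have "sorted_wrt (\<le>) L" unfolding sorted_wrt_iff_nth_less using monoL L(1) by auto
  moreover have "U \<subseteq> I \<and> (\<forall>i\<in>U. \<forall>j\<in>I. i < j \<longrightarrow> j \<in> U)" if "U \<in> set L" for U
    using that mono by (auto simp: L_def)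
  moreover have "{} \<notin> set T" if u: u
  proof
    assume "{} \<in> set T"
    then obtain i where i: "i < length T" "T ! i = {}" by (auto simp: in_set_conv_nth)
    hence "L ! Suc i = {}" "Suc i < length as" using T L(1) by auto
    hence "as ! Suc i = as ! 0" using free[of "Suc i"] free[OF order_less_trans[OF zero_less_Suc]] L0 u uniq by blast
    thus False using nth_eq_iff_index_eq[OF as(1) \<open>Suc i < length as\<close>, of 0] \<open>Suc i < length as\<close> by linarith
  qed
  ultimately have "label_seq u I L" unfolding label_seq_def T by auto
  moreover have "(e {i}, e {j}) \<in> S \<longleftrightarrow> j < i" if "i < length L" "j < length L" for i j
    using ord[of i j] e(2) that L(1) by simp
  ultimately show thesis using that e(1) by blast
qed

text \<open>Natural orderings are the images of \<open>lexless\<close> under isomorphisms from standard structures. This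
replaces orderings of atoms and their antilexicographical extensions everywhere below.\<close>

lemma iso_natural_ordering:
  fixes M :: "('a, 'j::linorder) ideal_struct"
  assumes iso0: "struct_iso (ideal_lang I) (pow_alg L0) M e0" and g0: "label_seq u I L0"
  shows "natural_ordering I M R \<longleftrightarrow> R \<subseteq> univ M \<times> univ M \<and>
    (\<exists>L e. label_seq u I L \<and> struct_iso (ideal_lang I) (pow_alg L) M e \<and>
       (\<forall>X\<in>Pow {..<length L}. \<forall>Y\<in>Pow {..<length L}. (e X, e Y) \<in> R \<longleftrightarrow> lexless X Y))"
    (is "_ \<longleftrightarrow> _ \<and> ?ex")
proof -
  have antilex: "antilex_extension M S R \<longleftrightarrow>
      (\<forall>X\<in>Pow {..<length L}. \<forall>Y\<in>Pow {..<length L}. X \<noteq> Y \<longrightarrow> ((e X, e Y) \<in> R \<longleftrightarrow> lexless X Y))"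
    if iso: "struct_iso (ideal_lang I) (pow_alg L) M e"
      and S: "\<And>i j. i < length L \<Longrightarrow> j < length L \<Longrightarrow> (e {i}, e {j}) \<in> S \<longleftrightarrow> j < i" for L S and e :: "nat set \<Rightarrow> 'a"
  proof -
    have e: "emb I M L e" and M: "univ M = e ` Pow {..<length L}"
      using iso by (auto simp: struct_iso_pow_alg)
    have main: "(let D = {a \<in> atoms M. ble M a (e X) \<noteq> ble M a (e Y)}
          in \<exists>m\<in>D. (\<forall>a\<in>D. a \<noteq> m \<longrightarrow> (a, m) \<in> S) \<and> ble M m (e Y)) \<longleftrightarrow> lexless X Y"
      if XY: "X \<subseteq> {..<length L}" "Y \<subseteq> {..<length L}" "X \<noteq> Y" for X Y
    proof -
      define D where "D = {i. (i \<in> X) \<noteq> (i \<in> Y)}"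
      have D: "i < length L" if "i \<in> D" for i using that XY by (auto simp: D_def)
      have sing: "ble M (e {i}) (e Z) \<longleftrightarrow> i \<in> Z" if "i < length L" "Z \<subseteq> {..<length L}" for i Z
        using emb_ble[OF e, of "{i}" Z] that by simp
      have "{a \<in> atoms M. ble M a (e X) \<noteq> ble M a (e Y)} = (\<lambda>i. e {i}) ` D"
        unfolding iso_atoms[OF e M] D_def using sing XY by auto
      moreover have "e {i} = e {j} \<longleftrightarrow> i = j" if "i < length L" "j < length L" for i j
        using emb_struct(8)[OF e, of "{i}" "{j}"] that by simp
      ultimately have "(let D = {a \<in> atoms M. ble M a (e X) \<noteq> ble M a (e Y)}
          in \<exists>m\<in>D. (\<forall>a\<in>D. a \<noteq> m \<longrightarrow> (a, m) \<in> S) \<and> ble M m (e Y)) \<longleftrightarrow>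
          (\<exists>m\<in>D. (\<forall>a\<in>D. a \<noteq> m \<longrightarrow> m < a) \<and> m \<in> Y)"
        using D S sing XY(2) by simp
      also have "\<dots> \<longleftrightarrow> lexless X Y"
        unfolding lexless_iff_least[OF XY(3)] D_def by auto
      finally show ?thesis .
    qed
    have inj: "e X = e Y \<longleftrightarrow> X = Y" if "X \<subseteq> {..<length L}" "Y \<subseteq> {..<length L}" for X Y
      using emb_struct(8)[OF e] that by blast
    show ?thesis
      unfolding antilex_extension_def M using main inj by (simp add: Pow_def)
  qed
  show ?thesis
  proof
    assume nat: "natural_ordering I M R"
    then obtain S where S: "proper_ordering I M S" "antilex_extension M S R"
      and lin: "linear_ordering (univ M) R" by (auto simp: natural_ordering_def)
    from iso_in_class[OF iso0 g0] S(1) obtain L e where L: "label_seq u I L" "struct_iso (ideal_lang I) (pow_alg L) M e"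
      "\<And>i j. i < length L \<Longrightarrow> j < length L \<Longrightarrow> (e {i}, e {j}) \<in> S \<longleftrightarrow> j < i"
      by (rule class_iso) blast
    have irr: "(x, x) \<notin> R" for x
      using lin by (auto simp: linear_ordering_def strict_linear_order_on_def irrefl_def)
    have "(e X, e Y) \<in> R \<longleftrightarrow> lexless X Y" if "X \<in> Pow {..<length L}" "Y \<in> Pow {..<length L}" for X Y
    proof (cases "X = Y")
      case False
      thus ?thesis using iffD1[OF antilex[OF L(2,3)] S(2)] that by blast
    qed (use irr lexless_irrefl in auto)
    hence ?ex using L(1,2) by blast
    thus "R \<subseteq> univ M \<times> univ M \<and> ?ex" using lin by (simp add: linear_ordering_def)
  next
    assume *: "R \<subseteq> univ M \<times> univ M \<and> ?ex"
    then obtain L e where L: "label_seq u I L" and iso: "struct_iso (ideal_lang I) (pow_alg L) M e"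
      and R: "\<And>X Y. X \<subseteq> {..<length L} \<Longrightarrow> Y \<subseteq> {..<length L} \<Longrightarrow> (e X, e Y) \<in> R \<longleftrightarrow> lexless X Y"
      and Rsub: "R \<subseteq> univ M \<times> univ M" by (metis PowI)
    have e: "emb I M L e" and M: "univ M = e ` Pow {..<length L}"
      using iso by (auto simp: struct_iso_pow_alg)
    have inj: "e {i} = e {j} \<longleftrightarrow> i = j" if "i < length L" "j < length L" for i j
      using emb_struct(8)[OF e, of "{i}" "{j}"] that by simp
    define S where "S = {(e {i}, e {j}) | i j. j < i \<and> i < length L}"
    have S: "(e {i}, e {j}) \<in> S \<longleftrightarrow> j < i" if "i < length L" "j < length L" for i j
      using that inj by (auto simp: S_def)
    have Sat: "S \<subseteq> atoms M \<times> atoms M" unfolding iso_atoms[OF e M] by (auto simp: S_def)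
    have "trans S"
    proof (rule transI)
      fix x y z assume xy: "(x, y) \<in> S" "(y, z) \<in> S"
      then obtain i j k where "x = e {i}" "y = e {j}" "z = e {k}" "i < length L" "j < length L" "k < length L"
        using Sat unfolding iso_atoms[OF e M] by blast
      thus "(x, z) \<in> S" using xy S by auto
    qed
    moreover have "irrefl S"
    proof (rule irreflI)
      fix x show "(x, x) \<notin> S" using S Sat unfolding iso_atoms[OF e M] by blast
    qed
    moreover have "total_on (atoms M) S"
      unfolding total_on_def iso_atoms[OF e M] using S by (auto) (metis linorder_neqE_nat)
    ultimately have linS: "linear_ordering (atoms M) S"
      using Sat by (auto simp: linear_ordering_def strict_linear_order_on_def)
    have "proper_ordering I M S" unfolding proper_ordering_def
    proof (intro conjI ballI impI linS)
      fix a b k assume ab: "a \<in> atoms M" "b \<in> atoms M" and k: "k \<in> I" "a \<in> pset M k"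
        and h: "(\<exists>j\<in>I. k < j \<and> b \<in> pset M j - pset M k) \<or> (\<forall>k\<in>I. b \<notin> pset M k)"
      obtain i j where ij: "a = e {i}" "b = e {j}" "i < length L" "j < length L"
        using ab unfolding iso_atoms[OF e M] by blast
      have "b \<notin> pset M k" using h k by blast
      hence "k \<notin> L ! j" "k \<in> L ! i" using iso_pset[OF e M k(1)] k(2) ij by auto
      hence "\<not> i \<le> j" using label_seq_mono[OF L, of i j] ij by blast
      thus "(a, b) \<in> S" using S ij by simp
    qed
    moreover have "antilex_extension M S R"
      by (rule iffD2[OF antilex[OF iso S]]) (use R in auto)
    moreover have "linear_ordering (univ M) R"
      unfolding linear_ordering_def strict_linear_order_on_def
    proof (intro conjI Rsub)
      show "trans R"
      proof (rule transI)
        fix x y z assume xy: "(x, y) \<in> R" "(y, z) \<in> R"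
        then obtain X Y Z where "x = e X" "y = e Y" "z = e Z" "X \<subseteq> {..<length L}" "Y \<subseteq> {..<length L}" "Z \<subseteq> {..<length L}"
          using Rsub unfolding M by blast
        thus "(x, z) \<in> R" using xy R[of X Y] R[of Y Z] R[of X Z] lexless_trans[of X Y Z] by simp
      qed
      show "irrefl R"
      proof (rule irreflI)
        fix x show "(x, x) \<notin> R"
        proof
          assume xx: "(x, x) \<in> R"
          then obtain X where "x = e X" "X \<subseteq> {..<length L}" using Rsub unfolding M by blast
          thus False using R[of X X] xx lexless_irrefl by simp
        qed
      qed
      show "total_on (univ M) R"
      proof (rule total_onI)
        fix x y assume xy: "x \<in> univ M" "y \<in> univ M" "x \<noteq> y"
        then obtain X Y where "x = e X" "y = e Y" "X \<subseteq> {..<length L}" "Y \<subseteq> {..<length L}" unfolding M by blast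
        thus "(x, y) \<in> R \<or> (y, x) \<in> R" using R[of X Y] R[of Y X] lexless_total[of X Y] xy(3) by auto
      qed
    qed
    ultimately show "natural_ordering I M R" unfolding natural_ordering_def by blast
  qed
qed

section \<open>Duality between embeddings and words\<close>

lemma nth_letter: "set w \<subseteq> {..<n} \<Longrightarrow> y < length w \<Longrightarrow> w ! y < (n::nat)"
  by (metis lessThan_iff nth_mem subsetD)

text \<open>Duality: a word, read as a map from positions to letters, induces by preimages a map between power
sets in the opposite direction.\<close>

definition pull :: "nat list \<Rightarrow> nat set \<Rightarrow> nat set" where
  "pull w X = {y. y < length w \<and> w ! y \<in> X}"

lemma pull_subset: "pull w X \<subseteq> {..<length w}"
  by (auto simp: pull_def)

lemma pull_wsubst:
  assumes "set g \<subseteq> {..<length f}"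
  shows "pull g (pull f X) = pull (wsubst 0 f g) X"
  using assms by (auto simp: pull_def wsubst_def) (metis lessThan_iff nth_mem subsetD)

lemma rgw_0_first:
  assumes "rgw 0 Q P w" "j < length Q"
  shows "\<exists>y<length P. w ! y = j \<and> P ! y = Q ! j \<and> (\<forall>y'<y. w ! y' < j)"
proof -
  obtain w1 w2 P1 P2 where *: "w = w1 @ j # w2" "P = P1 @ Q ! j # P2" "rgw 0 (take j Q) P1 w1"
    using rgw_first[OF assms] by auto
  have "length w1 = length P1" using rgw_length[OF *(3)] .
  moreover have "w1 ! y' < j" if "y' < length w1" for y'
    using nth_letter[OF rgw_set[OF *(3)]] that assms(2) by simp
  ultimately show ?thesis using *(1,2) by (intro exI[of _ "length w1"]) (auto simp: nth_append)
qed

text \<open>Together with \<open>rgw_0_first\<close> this describes restricted growth words by the first occurrences of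
their parameters.\<close>

lemma rgwI:
  "length w = length P \<Longrightarrow> set w \<subseteq> {..<a + length Q} \<Longrightarrow>
   (\<And>j. j < length Q \<Longrightarrow> \<exists>y<length P. w ! y = a + j \<and> P ! y = Q ! j \<and> (\<forall>y'<y. w ! y' < a + j)) \<Longrightarrow>
   rgw a Q P w"
proof (induction w P arbitrary: a Q rule: list_induct2)
  case Nil
  have "length Q = 0" using Nil(2)[of 0] by (cases Q) auto
  thus ?case by (auto intro: rgw.intros)
next
  case (Cons x w p P)
  note occ = Cons.prems(2)
  show ?case
  proof (cases "x < a")
    case True
    have "rgw a Q P w"
    proof (rule Cons.IH)
      show "set w \<subseteq> {..<a + length Q}" using Cons.prems by auto
      fix j assume "j < length Q"
      from occ[OF this] obtain y where y: "y < length (p # P)" "(x # w) ! y = a + j" "(p # P) ! y = Q ! j"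
        "\<And>y'. y' < y \<Longrightarrow> (x # w) ! y' < a + j" by blast
      obtain z where z: "y = Suc z" using y(2) True by (cases y) auto
      have "\<forall>y'<z. w ! y' < a + j" using y(4)[of "Suc _"] z by auto
      thus "\<exists>y<length P. w ! y = a + j \<and> P ! y = Q ! j \<and> (\<forall>y'<y. w ! y' < a + j)"
        using y z by (intro exI[of _ z]) auto
    qed
    thus ?thesis using True by (intro rgw.old)
  next
    case False
    define i where "i = x - a"
    have i: "x = a + i" "i < length Q" using False Cons.prems(1) by (auto simp: i_def)
    have "0 < length Q" using i(2) by linarith
    from occ[OF this] obtain y0 where y0: "(x # w) ! y0 = a" "\<And>y'. y' < y0 \<Longrightarrow> (x # w) ! y' < a" by auto
    have "y0 = 0" using y0(2)[of 0] False by (cases y0) auto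
    hence x: "x = a" using y0(1) by simp
    from occ[OF \<open>0 < length Q\<close>] obtain y1 where y1: "(p # P) ! y1 = Q ! 0" "\<And>y'. y' < y1 \<Longrightarrow> (x # w) ! y' < a" by auto
    have "y1 = 0" using y1(2)[of 0] False by (cases y1) auto
    then obtain Q' where Q: "Q = p # Q'" using y1(1) \<open>0 < length Q\<close> by (cases Q) auto
    have "rgw (Suc a) Q' P w"
    proof (rule Cons.IH)
      show "set w \<subseteq> {..<Suc a + length Q'}" using Cons.prems(1) Q by auto
      fix j assume "j < length Q'"
      hence "Suc j < length Q" using Q by simp
      from occ[OF this] obtain y where y: "y < length (p # P)" "(x # w) ! y = a + Suc j" "(p # P) ! y = Q ! Suc j"
        "\<And>y'. y' < y \<Longrightarrow> (x # w) ! y' < a + Suc j" by blast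
      obtain z where z: "y = Suc z" using y(2) x by (cases y) auto
      have "\<forall>y'<z. w ! y' < Suc a + j" using y(4)[of "Suc _"] z by auto
      thus "\<exists>y<length P. w ! y = Suc a + j \<and> P ! y = Q' ! j \<and> (\<forall>y'<y. w ! y' < Suc a + j)"
        using y z Q by (intro exI[of _ z]) auto
    qed
    thus ?thesis unfolding Q x by (rule rgw.new)
  qed
qed

text \<open>The preimage of \<open>{i}\<close> lies in exactly the ideals that contain all atoms of the fibre of \<open>i\<close>. Labels
increase along positions, so the first position of the fibre decides, and there the types agree.\<close>

lemma emb_pull:
  assumes w: "rgw 0 LA LS w" and e: "emb I C LS e" and srt: "sorted_wrt (\<le>) LS"
  shows "emb I C LA (\<lambda>X. e (pull w X))"
proof -
  have len: "length w = length LS" using rgw_length[OF w] .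
  have letters: "w ! y < length LA" if "y < length LS" for y
    using nth_letter[OF rgw_set[OF w]] that len by simp
  have sub: "pull w X \<subseteq> {..<length LS}" for X using pull_subset[of w X] len by simp
  note es = emb_struct[OF e sub]
  have eqs: "pull w (X \<union> Y) = pull w X \<union> pull w Y" "pull w (X \<inter> Y) = pull w X \<inter> pull w Y"
    "pull w ({..<length LA} - X) = {..<length LS} - pull w X" "pull w {} = {}" "pull w {..<length LA} = {..<length LS}" for X Y
    using letters len by (auto simp: pull_def)
  have inj: "pull w X = pull w Y \<Longrightarrow> X \<subseteq> {..<length LA} \<Longrightarrow> X \<subseteq> Y" for X Y
  proof
    fix i assume *: "pull w X = pull w Y" "X \<subseteq> {..<length LA}" "i \<in> X"
    obtain y where "y < length LS" "w ! y = i" using rgw_0_first[OF w, of i] *(2,3) by auto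
    hence "y \<in> pull w X" using *(3) len by (simp add: pull_def)
    hence "y \<in> pull w Y" using *(1) by simp
    thus "i \<in> Y" using \<open>w ! y = i\<close> by (simp add: pull_def)
  qed
  have lab: "(\<forall>i\<in>X. j \<in> LA ! i) \<longleftrightarrow> (\<forall>y\<in>pull w X. j \<in> LS ! y)" if X: "X \<subseteq> {..<length LA}" for X j
  proof
    assume *: "\<forall>i\<in>X. j \<in> LA ! i"
    show "\<forall>y\<in>pull w X. j \<in> LS ! y"
    proof
      fix y assume y: "y \<in> pull w X"
      hence yi: "y < length LS" "w ! y \<in> X" using len by (auto simp: pull_def)
      obtain y0 where y0: "w ! y0 = w ! y" "LS ! y0 = LA ! (w ! y)" "\<forall>y'<y0. w ! y' < w ! y"
        using rgw_0_first[OF w letters[OF yi(1)]] by auto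
      have "y0 \<le> y" using y0(3) by (metis leI less_irrefl)
      hence "LS ! y0 \<le> LS ! y" using sorted_wrt_nth_less[OF srt, of y0 y] yi by (cases "y0 = y") auto
      thus "j \<in> LS ! y" using * yi y0 by auto
    qed
  next
    assume *: "\<forall>y\<in>pull w X. j \<in> LS ! y"
    show "\<forall>i\<in>X. j \<in> LA ! i"
    proof
      fix i assume i: "i \<in> X"
      then obtain y where "y < length LS" "w ! y = i" "LS ! y = LA ! i" using rgw_0_first[OF w, of i] X by auto
      thus "j \<in> LA ! i" using * i len by (auto simp: pull_def)
    qed
  qed
  show ?thesis unfolding emb_def
  proof (intro conjI ballI)
    show "inj_on (\<lambda>X. e (pull w X)) (Pow {..<length LA})"
    proof (rule inj_onI)
      fix X Y assume *: "X \<in> Pow {..<length LA}" "Y \<in> Pow {..<length LA}" "e (pull w X) = e (pull w Y)"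
      hence "pull w X = pull w Y" using es(8)[OF sub] by blast
      thus "X = Y" using inj[of X Y] inj[of Y X] * by auto
    qed
    fix j X assume "j \<in> I" and X: "X \<in> Pow {..<length LA}"
    thus "(\<forall>i\<in>X. j \<in> LA ! i) \<longleftrightarrow> rint C j [e (pull w X)]" using lab[of X j] es(5) by auto
  qed (use es(1,2,3,4) es(6)[OF sub] es(7)[OF sub] in \<open>auto simp: eqs\<close>)
qed

text \<open>The least position in the symmetric difference of two preimages is the first occurrence of the
least letter in which the sets differ.\<close>

lemma lexless_pull:
  assumes w: "rgw 0 LA LS w" and XY: "X \<subseteq> {..<length LA}" "Y \<subseteq> {..<length LA}"
  shows "lexless (pull w X) (pull w Y) \<longleftrightarrow> lexless X Y"
proof -
  have step: "lexless (pull w X) (pull w Y)" if XY: "lexless X Y" "Y \<subseteq> {..<length LA}" for X Y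
  proof -
    obtain m where m: "m \<in> Y" "m \<notin> X" "\<And>i. i < m \<Longrightarrow> i \<in> X \<longleftrightarrow> i \<in> Y"
      using XY(1) by (auto simp: lexless_def)
    obtain y where y: "y < length LS" "w ! y = m" "\<forall>y'<y. w ! y' < m" using rgw_0_first[OF w, of m] m(1) XY(2) by auto
    show ?thesis unfolding lexless_def
      by (rule exI[of _ y]) (use y m rgw_length[OF w] in \<open>auto simp: pull_def\<close>)
  qed
  show ?thesis
    using step[of X Y] step[of Y X] XY lexless_total[of X Y] lexless_asym lexless_irrefl by blast
qed

text \<open>One embedding with range inside another one is dual to a map on positions, since every position of
\<open>LS\<close> lies in the image of exactly one singleton.\<close>

lemma emb_factor:
  assumes eA: "emb I C LA eA" and eS: "emb I C LS eS" and sub: "eA ` Pow {..<length LA} \<subseteq> eS ` Pow {..<length LS}"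
  obtains w where "length w = length LS" "set w \<subseteq> {..<length LA}"
    "\<And>X. X \<subseteq> {..<length LA} \<Longrightarrow> eA X = eS (pull w X)"
    "\<And>i. i < length LA \<Longrightarrow> \<exists>y<length LS. w ! y = i"
    "\<And>i j. i < length LA \<Longrightarrow> j \<in> I \<Longrightarrow> j \<in> LA ! i \<longleftrightarrow> (\<forall>y<length LS. w ! y = i \<longrightarrow> j \<in> LS ! y)"
proof -
  let ?a = "length LA" and ?n = "length LS"
  have "\<exists>Z. Z \<subseteq> {..<?n} \<and> eS Z = eA X" if "X \<subseteq> {..<?a}" for X
  proof -
    have "eA X \<in> eS ` Pow {..<?n}" using sub that by (simp add: image_subset_iff)
    thus ?thesis by (metis imageE PowD)
  qed
  then obtain p where p: "\<And>X. X \<subseteq> {..<?a} \<Longrightarrow> p X \<subseteq> {..<?n} \<and> eS (p X) = eA X" by metis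
  have pI: "p X = Z" if "X \<subseteq> {..<?a}" "Z \<subseteq> {..<?n}" "eS Z = eA X" for X Z
    using emb_struct(8)[OF eS that(2), of "p X"] p[OF that(1)] that(3) by auto
  have un: "p (X \<union> Y) = p X \<union> p Y" and int: "p (X \<inter> Y) = p X \<inter> p Y"
    if "X \<subseteq> {..<?a}" "Y \<subseteq> {..<?a}" for X Y
  proof -
    note pX = p[OF that(1)] and pY = p[OF that(2)]
    note S = emb_struct(6,7)[OF eS conjunct1[OF pX] conjunct1[OF pY]] and A = emb_struct(6,7)[OF eA that]
    show "p (X \<union> Y) = p X \<union> p Y" by (rule pI) (use that pX pY S A in auto)
    have "X \<inter> Y \<subseteq> {..<?a}" "p X \<inter> p Y \<subseteq> {..<?n}" using that pX by auto
    thus "p (X \<inter> Y) = p X \<inter> p Y" by (rule pI) (use pX pY S A in simp)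
  qed
  have p0: "p {} = {}" using emb_struct(3)[OF eA, of "{}"] emb_struct(3)[OF eS, of "{}"] by (intro pI) auto
  have p1: "p {..<?a} = {..<?n}" using emb_struct(4)[OF eA, of "{}"] emb_struct(4)[OF eS, of "{}"] by (intro pI) auto
  have split: "finite X \<Longrightarrow> X \<subseteq> {..<?a} \<Longrightarrow> y \<in> p X \<Longrightarrow> \<exists>i\<in>X. y \<in> p {i}" for X y
  proof (induction X rule: finite_induct)
    case (insert i X)
    have "p (insert i X) = p {i} \<union> p X" using un[of "{i}" X] insert.prems by simp
    thus ?case using insert by auto
  qed (simp add: p0)
  have "\<exists>i<?a. y \<in> p {i}" if "y < ?n" for y
    using split[of "{..<?a}" y] p1 that by auto
  then obtain f where f: "\<And>y. y < ?n \<Longrightarrow> f y < ?a \<and> y \<in> p {f y}" by metis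
  define w where "w = map f [0..<?n]"
  have pull: "pull w X = p X" if X: "X \<subseteq> {..<?a}" for X
  proof -
    have "y \<in> p X \<longleftrightarrow> f y \<in> X" if y: "y < ?n" for y
    proof
      assume "f y \<in> X"
      hence "p X = p {f y} \<union> p X" using un[of "{f y}" X] f[OF y] X by (simp add: insert_absorb)
      thus "y \<in> p X" using f[OF y] by blast
    next
      assume *: "y \<in> p X"
      show "f y \<in> X"
      proof (rule ccontr)
        assume "f y \<notin> X"
        hence "{f y} \<inter> X = {}" by auto
        hence "p {f y} \<inter> p X = {}" using int[of "{f y}" X] f[OF y] X p0 by simp
        thus False using f[OF y] * by blast
      qed
    qed
    thus ?thesis using p[OF X] by (auto simp: pull_def w_def)
  qed
  show thesis
  proof (rule that[of w])
    show "length w = ?n" "set w \<subseteq> {..<?a}" using f by (auto simp: w_def)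
    show eq: "eA X = eS (pull w X)" if "X \<subseteq> {..<?a}" for X using pull[OF that] p[OF that] by simp
    show "\<exists>y<?n. w ! y = i" if i: "i < ?a" for i
    proof -
      have "eA {i} \<noteq> eA {}" using emb_struct(8)[OF eA, of "{i}" "{}"] i by simp
      hence "pull w {i} \<noteq> pull w {}" using eq[of "{i}"] eq[of "{}"] i by auto
      thus ?thesis using \<open>length w = ?n\<close> by (auto simp: pull_def)
    qed
    show "j \<in> LA ! i \<longleftrightarrow> (\<forall>y<?n. w ! y = i \<longrightarrow> j \<in> LS ! y)" if "i < ?a" "j \<in> I" for i j
    proof -
      have "j \<in> LA ! i \<longleftrightarrow> rint C j [eA {i}]" using emb_struct(5)[OF eA, of "{i}"] that by simp
      also have "\<dots> \<longleftrightarrow> rint C j [eS (pull w {i})]" using eq[of "{i}"] that by simp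
      also have "\<dots> \<longleftrightarrow> (\<forall>y\<in>pull w {i}. j \<in> LS ! y)"
        using pull[of "{i}"] p[of "{i}"] that by (intro emb_struct(5)[OF eS]) auto
      finally show ?thesis by (auto simp: pull_def w_def)
    qed
  qed
qed

text \<open>If order is preserved, then the dual map is a restricted growth word. Singletons decrease with their
position in the ordering, so their fibres have increasing first elements.\<close>

lemma ordered_emb_factor:
  assumes eA: "emb I C LA eA" and eS: "emb I C LS eS" and sub: "eA ` Pow {..<length LA} \<subseteq> eS ` Pow {..<length LS}"
    and oA: "\<And>X Y. X \<subseteq> {..<length LA} \<Longrightarrow> Y \<subseteq> {..<length LA} \<Longrightarrow> (eA X, eA Y) \<in> R \<longleftrightarrow> lexless X Y"
    and oS: "\<And>X Y. X \<subseteq> {..<length LS} \<Longrightarrow> Y \<subseteq> {..<length LS} \<Longrightarrow> (eS X, eS Y) \<in> R \<longleftrightarrow> lexless X Y"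
    and gA: "label_seq u I LA" and gS: "label_seq u I LS"
  obtains w where "rgw 0 LA LS w" "\<And>X. X \<subseteq> {..<length LA} \<Longrightarrow> eA X = eS (pull w X)"
proof -
  obtain w where w: "length w = length LS" "set w \<subseteq> {..<length LA}"
    "\<And>X. X \<subseteq> {..<length LA} \<Longrightarrow> eA X = eS (pull w X)"
    "\<And>i. i < length LA \<Longrightarrow> \<exists>y<length LS. w ! y = i"
    and lab: "\<And>i j. i < length LA \<Longrightarrow> j \<in> I \<Longrightarrow> j \<in> LA ! i \<longleftrightarrow> (\<forall>y<length LS. w ! y = i \<longrightarrow> j \<in> LS ! y)"
    using emb_factor[OF eA eS sub] by blast
  have "rgw 0 LA LS w"
  proof (rule rgwI)
    show "length w = length LS" "set w \<subseteq> {..<0 + length LA}" using w by auto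
    fix i assume i: "i < length LA"
    define y where "y = (LEAST y. y < length LS \<and> w ! y = i)"
    have y: "y < length LS" "w ! y = i" using LeastI_ex[OF w(4)[OF i]] by (auto simp: y_def)
    have first: "w ! y' \<noteq> i" if "y' < y" for y'
      using not_less_Least[of y' "\<lambda>y. y < length LS \<and> w ! y = i"] that y(1) by (auto simp: y_def)
    have "j \<in> LS ! y \<longleftrightarrow> j \<in> LA ! i" if j: "j \<in> I" for j
    proof -
      have "j \<in> LS ! y'" if "j \<in> LS ! y" "y' < length LS" "w ! y' = i" for y'
        using label_seq_mono[OF gS, of y y'] first[of y'] that by (cases "y' < y") auto
      thus ?thesis using lab[OF i j] y by blast
    qed
    hence "LS ! y = LA ! i" using label_seq_sub[OF gS y(1)] label_seq_sub[OF gA i] by blast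
    moreover have "w ! y' < i" if y': "y' < y" for y'
    proof (rule ccontr)
      assume "\<not> w ! y' < i"
      hence lt: "i < w ! y'" using first[OF y'] by simp
      have j: "w ! y' < length LA" using nth_letter[OF w(2)] w(1) y' y(1) by simp
      have "lexless {w ! y'} {i}" unfolding lexless_def using lt by (intro exI[of _ i]) auto
      moreover have "pull w Z \<subseteq> {..<length LS}" for Z using pull_subset[of w Z] w(1) by simp
      ultimately have "lexless (pull w {w ! y'}) (pull w {i})"
        using oA[of "{w ! y'}" "{i}"] w(3)[of "{w ! y'}"] w(3)[of "{i}"] i j
          oS[of "pull w {w ! y'}" "pull w {i}"] by simp
      then obtain m where m: "m \<in> pull w {i}" "\<forall>k<m. k \<in> pull w {w ! y'} \<longleftrightarrow> k \<in> pull w {i}"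
        by (auto simp: lexless_def)
      have "y' < m" using m(1) first y' by (metis (mono_tags, lifting) leI le_less_trans mem_Collect_eq nat_less_le pull_def singletonD)
      hence "y' \<in> pull w {i}" using m(2) y' y(1) w(1) by (auto simp: pull_def)
      thus False using first[OF y'] by (simp add: pull_def)
    qed
    ultimately show "\<exists>y<length LS. w ! y = 0 + i \<and> LS ! y = LA ! i \<and> (\<forall>y'<y. w ! y' < 0 + i)"
      using y by auto
  qed
  thus thesis using that w(3) by blast
qed

lemma sorted_wrt_unique:
  fixes xs ys :: "'l::order list"
  shows "sorted_wrt (\<le>) xs \<Longrightarrow> sorted_wrt (\<le>) ys \<Longrightarrow> mset xs = mset ys \<Longrightarrow> xs = ys"
proof (induction xs arbitrary: ys)
  case (Cons x xs)
  then obtain y zs where ys: "ys = y # zs" by (cases ys) auto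
  have "x \<in> set ys" "y \<in> set (x # xs)" using Cons.prems(3) ys
    by (metis list.set_intros(1) mset_eq_setD)+
  hence "x = y" using Cons.prems(1,2) ys by (auto intro: antisym)
  thus ?case using Cons ys by auto
qed simp

text \<open>The label sequence is an isomorphism invariant: it lists the multiset of labels of the atoms in
increasing order. As a consequence, any two natural orderings of one finite structure are conjugate
under its automorphism group.\<close>

lemma emb_label_unique:
  assumes e1: "emb I C L1 e1" and e2: "emb I C L2 e2" and same: "e1 ` Pow {..<length L1} = e2 ` Pow {..<length L2}"
    and g1: "label_seq u I L1" and g2: "label_seq u I L2"
  shows "L1 = L2"
proof -
  obtain w where w: "length w = length L2" "set w \<subseteq> {..<length L1}"
    "\<And>X. X \<subseteq> {..<length L1} \<Longrightarrow> e1 X = e2 (pull w X)"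
    and surj: "\<And>i. i < length L1 \<Longrightarrow> \<exists>y<length L2. w ! y = i"
    and lab: "\<And>i j. i < length L1 \<Longrightarrow> j \<in> I \<Longrightarrow> j \<in> L1 ! i \<longleftrightarrow> (\<forall>y<length L2. w ! y = i \<longrightarrow> j \<in> L2 ! y)"
    using emb_factor[OF e1 e2 equalityD1[OF same]] by blast
  have "card (e1 ` Pow {..<length L1}) = 2 ^ length L1" "card (e2 ` Pow {..<length L2}) = 2 ^ length L2"
    using e1 e2 by (auto simp: emb_def card_image card_Pow)
  hence len: "length L1 = length L2" using same by simp
  have "i \<in> set w" if "i < length L1" for i using surj[OF that] w(1) by (metis nth_mem)
  hence setw: "set w = {..<length L1}" using w(2) by blast
  hence dist: "distinct w" using w(1) len by (simp add: card_distinct)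
  have lab': "L2 ! y = L1 ! (w ! y)" if y: "y < length L2" for y
  proof -
    have wy: "w ! y < length L1" using nth_letter[OF w(2)] w(1) y by simp
    have inj: "y' = y" if "y' < length L2" "w ! y' = w ! y" for y'
      using nth_eq_iff_index_eq[OF dist, of y' y] w(1) y that by simp
    have "j \<in> L1 ! (w ! y) \<longleftrightarrow> j \<in> L2 ! y" if "j \<in> I" for j
      using lab[OF wy that] inj y by metis
    thus ?thesis using label_seq_sub[OF g2 y] label_seq_sub[OF g1 wy] by blast
  qed
  have "L2 = map ((!) L1) w" using lab' w(1) by (intro nth_equalityI) auto
  moreover have "mset w = mset [0..<length L1]" 
    using set_eq_iff_mset_eq_distinct[OF dist distinct_upt[of 0 "length L1"]] setw
    by (simp only: set_upt lessThan_atLeast0 simp_thms)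
  ultimately have "mset L2 = mset (map ((!) L1) [0..<length L1])" by (metis mset_map)
  thus ?thesis using label_seq_sorted[OF g1] label_seq_sorted[OF g2] by (simp add: map_nth sorted_wrt_unique)
qed

section \<open>Permutation groups and their flows\<close>

abbreviation perm_group :: "'a set \<Rightarrow> ('a \<Rightarrow> 'a) set \<Rightarrow> ('a \<Rightarrow> 'a) monoid" where
  "perm_group U A \<equiv> BijGroup U\<lparr>carrier := A\<rparr>"

abbreviation perm_topology :: "'a set \<Rightarrow> ('a \<Rightarrow> 'a) set \<Rightarrow> ('a \<Rightarrow> 'a) topology" where
  "perm_topology U A \<equiv> subtopology (product_topology (\<lambda>_. discrete_topology U) U) A"

locale permutations =
  fixes U :: "'a set" and A :: "('a \<Rightarrow> 'a) set"
  assumes sub: "subgroup A (BijGroup U)"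
begin

abbreviation "G \<equiv> perm_group U A"

sublocale G: group G
  by (rule subgroup.subgroup_is_group[OF sub group_BijGroup])

lemma A_Bij: "g \<in> A \<Longrightarrow> g \<in> Bij U"
  using subgroup.subset[OF sub] by (auto simp: BijGroup_def)

lemma A_mem: "g \<in> A \<Longrightarrow> x \<in> U \<Longrightarrow> g x \<in> U"
  using Bij_imp_funcset[OF A_Bij] by auto

lemma A_topspace: "topspace (perm_topology U A) = A"
  using Bij_imp_funcset[OF A_Bij] Bij_imp_extensional[OF A_Bij] by (auto simp: PiE_def)

lemma mult_apply: "g \<in> A \<Longrightarrow> h \<in> A \<Longrightarrow> x \<in> U \<Longrightarrow> (g \<otimes>\<^bsub>G\<^esub> h) x = g (h x)"
  using A_Bij by (simp add: BijGroup_def compose_eq)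

lemma one_apply: "x \<in> U \<Longrightarrow> \<one>\<^bsub>G\<^esub> x = x"
  by (simp add: BijGroup_def)

lemma mult_mem: "g \<in> A \<Longrightarrow> h \<in> A \<Longrightarrow> g \<otimes>\<^bsub>G\<^esub> h \<in> A"
  using G.m_closed by simp

lemma one_mem: "\<one>\<^bsub>G\<^esub> \<in> A"
  using G.one_closed by simp

lemma inv_mem: "g \<in> A \<Longrightarrow> inv\<^bsub>G\<^esub> g \<in> A"
  using G.inv_closed by simp

lemma inv_apply: assumes "g \<in> A" "x \<in> U" shows "(inv\<^bsub>G\<^esub> g) (g x) = x" "g ((inv\<^bsub>G\<^esub> g) x) = x"
proof -
  have "inv\<^bsub>G\<^esub> g \<otimes>\<^bsub>G\<^esub> g = \<one>\<^bsub>G\<^esub>" "g \<otimes>\<^bsub>G\<^esub> inv\<^bsub>G\<^esub> g = \<one>\<^bsub>G\<^esub>" 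
    by (rule G.l_inv G.r_inv, use assms in simp)+
  thus "(inv\<^bsub>G\<^esub> g) (g x) = x" "g ((inv\<^bsub>G\<^esub> g) x) = x"
    using mult_apply[OF inv_mem[OF assms(1)] assms] mult_apply[OF assms(1) inv_mem[OF assms(1)] assms(2)]
      one_apply[OF assms(2)] by auto
qed

text \<open>The pointwise stabilisers of finite sets form a base at the identity.\<close>

lemma one_neighbourhood:
  assumes "openin (perm_topology U A) V" "\<one>\<^bsub>G\<^esub> \<in> V"
  obtains F where "finite F" "F \<subseteq> U" "\<And>k. k \<in> A \<Longrightarrow> (\<And>a. a \<in> F \<Longrightarrow> k a = a) \<Longrightarrow> k \<in> V"
proof -
  obtain V' where V': "openin (product_topology (\<lambda>_. discrete_topology U) U) V'" "V = V' \<inter> A"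
    using assms(1) by (auto simp: openin_subtopology)
  then obtain N where N: "finite {i \<in> U. N i \<noteq> U}" "\<one>\<^bsub>G\<^esub> \<in> Pi\<^sub>E U N" "Pi\<^sub>E U N \<subseteq> V'"
    using assms(2) unfolding openin_product_topology_alt by (metis (no_types, lifting) IntD1 topspace_discrete_topology Collect_cong)
  show thesis
  proof (rule that[OF N(1)])
    fix k assume k: "k \<in> A" "\<And>a. a \<in> {i \<in> U. N i \<noteq> U} \<Longrightarrow> k a = a"
    have "k \<in> Pi\<^sub>E U N"
    proof (rule PiE_I)
      fix i assume i: "i \<in> U"
      show "k i \<in> N i"
      proof (cases "N i = U")
        case True
        thus ?thesis using A_mem[OF k(1) i] by simp
      next
        case False
        hence "k i = i" using k(2) i by blast
        moreover have "i \<in> N i" using PiE_mem[OF N(2) i] one_apply[OF i] by simp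
        ultimately show ?thesis by simp
      qed
    qed (use Bij_imp_extensional[OF A_Bij[OF k(1)]] in \<open>auto simp: extensional_def\<close>)
    thus "k \<in> V" using N(3) k(1) V'(2) by blast
  qed auto
qed

lemma evaluation_open: assumes "a \<in> U" shows "openin (perm_topology U A) {g \<in> A. g a = b}"
proof (cases "b \<in> U")
  case True
  have "continuous_map (perm_topology U A) (discrete_topology U) (\<lambda>g. g a)"
    by (intro continuous_map_from_subtopology continuous_map_product_projection assms)
  from openin_continuous_map_preimage[OF this, of "{b}"] True show ?thesis by (simp add: A_topspace del: topspace_subtopology)
next
  case False
  hence "{g \<in> A. g a = b} = {}" using A_mem assms by auto
  show ?thesis unfolding \<open>{g \<in> A. g a = b} = {}\<close> by (rule openin_empty)
qed

end

locale permutation_flow = permutations U A for U :: "'a set" and A +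
  fixes Y :: "'y topology" and \<psi> :: "('a \<Rightarrow> 'a) \<Rightarrow> 'y \<Rightarrow> 'y"
  assumes flow: "flow (perm_group U A) (perm_topology U A) Y \<psi>"
begin

lemma action: "group_action G (topspace Y) \<psi>"
  and compact: "compact_space Y" and Hausdorff: "Hausdorff_space Y" and nonempty: "topspace Y \<noteq> {}"
  and continuous: "continuous_map (prod_topology (perm_topology U A) Y) Y (\<lambda>(g, x). \<psi> g x)"
  using flow by (auto simp: flow_def)

lemma act_mem: "g \<in> A \<Longrightarrow> y \<in> topspace Y \<Longrightarrow> \<psi> g y \<in> topspace Y"
  using group_action.element_image[OF action] by simp

lemma act_mult: "g \<in> A \<Longrightarrow> h \<in> A \<Longrightarrow> y \<in> topspace Y \<Longrightarrow> \<psi> (g \<otimes>\<^bsub>G\<^esub> h) y = \<psi> g (\<psi> h y)"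
  using group_action.composition_rule[OF action, of y g h] by simp

lemma act_one: "y \<in> topspace Y \<Longrightarrow> \<psi> \<one>\<^bsub>G\<^esub> y = y"
  using group_action.id_eq_one[OF action] by (metis restrict_apply')

lemma act_continuous: assumes "g \<in> A" shows "continuous_map Y Y (\<psi> g)"
proof -
  have "continuous_map Y (prod_topology (perm_topology U A) Y) (\<lambda>y. (g, y))"
    unfolding continuous_map_pairwise using assms by (simp add: comp_def A_topspace del: topspace_subtopology)
  from continuous_map_compose[OF this continuous] show ?thesis by (simp add: comp_def)
qed

text \<open>Compactness of the flow makes continuity at the identity uniform in the point (tube lemma).\<close>

lemma uniformly_fixed:
  assumes f: "continuous_map Y euclideanreal f" and e: "0 < e"
  obtains F where "finite F" "F \<subseteq> U"
    "\<And>k y. k \<in> A \<Longrightarrow> (\<And>a. a \<in> F \<Longrightarrow> k a = a) \<Longrightarrow> y \<in> topspace Y \<Longrightarrow> \<bar>f (\<psi> k y) - f y\<bar> < e"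
proof -
  let ?P = "prod_topology (perm_topology U A) Y"
  define d where "d p = \<bar>(f \<circ> (\<lambda>(g, x). \<psi> g x)) p - (f \<circ> snd) p\<bar>" for p
  have "continuous_map ?P euclideanreal d"
    unfolding d_def
    by (intro continuous_map_real_abs continuous_map_diff continuous_map_compose[OF continuous f]
        continuous_map_compose[OF continuous_map_snd f])
  from openin_continuous_map_preimage[OF this, of "{..<e}"]
  have W: "openin ?P {p \<in> topspace ?P. d p \<in> {..<e}}" by simp
  have "(\<one>\<^bsub>G\<^esub>, y) \<in> {p \<in> topspace ?P. d p \<in> {..<e}}" if "y \<in> topspace Y" for y
    using one_mem e act_one[OF that] that by (simp add: d_def A_topspace del: topspace_subtopology)
  hence "{\<one>\<^bsub>G\<^esub>} \<times> topspace Y \<subseteq> {p \<in> topspace ?P. d p \<in> {..<e}}" by blast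
  from tube_lemma_right[OF W _ _ this] compact one_mem
  obtain V V2 where V: "openin (perm_topology U A) V" "\<one>\<^bsub>G\<^esub> \<in> V" "topspace Y \<subseteq> V2"
    "V \<times> V2 \<subseteq> {p \<in> topspace ?P. d p \<in> {..<e}}"
    by (auto simp: compact_space_def A_topspace simp del: topspace_subtopology)
  obtain F where F: "finite F" "F \<subseteq> U" "\<And>k. k \<in> A \<Longrightarrow> (\<And>a. a \<in> F \<Longrightarrow> k a = a) \<Longrightarrow> k \<in> V"
    using one_neighbourhood[OF V(1,2)] by blast
  show thesis
  proof (rule that[OF F(1,2)])
    fix k y assume k: "k \<in> A" "\<And>a. a \<in> F \<Longrightarrow> k a = a" and y: "y \<in> topspace Y"
    have "(k, y) \<in> V \<times> V2" using F(3)[OF k] V(3) y by auto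
    hence "d (k, y) < e" using V(4) by auto
    thus "\<bar>f (\<psi> k y) - f y\<bar> < e" by (simp add: d_def)
  qed
qed

lemma separation:
  assumes "y1 \<in> topspace Y" "y2 \<in> topspace Y" "y1 \<noteq> y2"
  obtains f where "continuous_map Y euclideanreal f" "\<And>y. y \<in> topspace Y \<Longrightarrow> 0 \<le> f y \<and> f y \<le> 1" "f y1 = 0" "f y2 = 1"
proof -
  have "normal_space Y" using compact_Hausdorff_or_regular_imp_normal_space compact Hausdorff by blast
  hence "completely_regular_space Y"
    using normal_imp_completely_regular_space_gen Hausdorff_imp_t1_space[OF Hausdorff] by blast
  moreover have "closedin Y {y2}" using Hausdorff assms(2) by (simp add: closedin_Hausdorff_singleton)
  ultimately obtain f :: "'y \<Rightarrow> real" where f: "continuous_map Y (top_of_set {0..1}) f" "f y1 = 0" "f ` {y2} \<subseteq> {1}"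
    using assms unfolding completely_regular_space_def by (metis DiffI singletonD)
  show thesis
  proof (rule that[of f])
    show "continuous_map Y euclideanreal f" using f(1) by (simp add: continuous_map_in_subtopology)
    show "0 \<le> f y \<and> f y \<le> 1" if "y \<in> topspace Y" for y
      using f(1) that by (auto simp: continuous_map_in_subtopology image_subset_iff Pi_iff)
  qed (use f in auto)
qed

end

section \<open>The Ramsey property of a permutation group\<close>

definition ordered_emb :: "'j set \<Rightarrow> ('a, 'j) ideal_struct \<Rightarrow> ('a \<times> 'a) set \<Rightarrow> 'j set list \<Rightarrow> (nat set \<Rightarrow> 'a) \<Rightarrow> bool" where
  "ordered_emb I C R L e \<longleftrightarrow> emb I C L e \<and>
    (\<forall>X Y. X \<subseteq> {..<length L} \<longrightarrow> Y \<subseteq> {..<length L} \<longrightarrow> ((e X, e Y) \<in> R \<longleftrightarrow> lexless X Y))"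

lemma label_seq_Cons_iff: "label_seq u I ({} # T) \<longleftrightarrow> sorted_wrt (\<le>) T \<and>
     (\<forall>U\<in>set T. U \<subseteq> I \<and> (\<forall>i\<in>U. \<forall>j\<in>I. i < j \<longrightarrow> j \<in> U)) \<and> (u \<longrightarrow> {} \<notin> set T)"
  unfolding label_seq_def by simp

lemma label_seq_tl: "label_seq u I L \<Longrightarrow> L = {} # tl L"
  unfolding label_seq_def by (elim exE conjE) simp

lemma emb_cong:
  assumes "emb I C L e" "\<And>X. X \<subseteq> {..<length L} \<Longrightarrow> e X = e' X"
  shows "emb I C L e'"
proof -
  have "e ({..<length L} - X) = e' ({..<length L} - X)" for X by (rule assms(2)) auto
  moreover have "e (X \<inter> Y) = e' (X \<inter> Y)" if "X \<subseteq> {..<length L}" for X Y by (rule assms(2)) (use that in auto)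
  ultimately show ?thesis using assms unfolding emb_def inj_on_def by (simp add: image_subset_iff)
qed

lemma ordered_emb_cong:
  "ordered_emb I C R L e \<Longrightarrow> (\<And>X. X \<subseteq> {..<length L} \<Longrightarrow> e X = e' X) \<Longrightarrow> ordered_emb I C R L e'"
  using emb_cong[of I C L e e'] unfolding ordered_emb_def by simp

lemma ordered_emb_pull:
  assumes "rgw 0 LA LS w" "ordered_emb I C R LS e" "sorted_wrt (\<le>) LS"
  shows "ordered_emb I C R LA (\<lambda>X. e (pull w X))"
  using assms emb_pull[OF assms(1) _ assms(3), of I C e] lexless_pull[OF assms(1)] pull_subset[of w] rgw_length[OF assms(1)]
  by (simp add: ordered_emb_def)

lemma ordered_emb_pull_factor:
  assumes "ordered_emb I C R LA eA" "ordered_emb I C R LS eS" "eA ` Pow {..<length LA} \<subseteq> eS ` Pow {..<length LS}"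
    and "label_seq u I LA" "label_seq u I LS"
  shows "\<exists>w. rgw 0 LA LS w \<and> (\<forall>X. X \<subseteq> {..<length LA} \<longrightarrow> eA X = eS (pull w X))"
proof -
  note A = assms(1)[unfolded ordered_emb_def] and S = assms(2)[unfolded ordered_emb_def]
  obtain w where "rgw 0 LA LS w" "\<And>X. X \<subseteq> {..<length LA} \<Longrightarrow> eA X = eS (pull w X)"
    by (rule ordered_emb_factor[OF conjunct1[OF A] conjunct1[OF S] assms(3) _ _ assms(4,5), where R = R])
      (use A S in simp_all)
  thus ?thesis by blast
qed

text \<open>What the Ramsey argument uses about the group. Two situations are covered. If \<open>ord\<close> holds, the group
preserves the ordering \<open>R\<close>, and all embeddings are ordered; this is the automorphism group of the
ordered limit. Otherwise the group is that of the unordered limit and \<open>R\<close> is an arbitrary normal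
ordering. The embeddings \<open>adm\<close> are those between
which the group is transitive.\<close>

locale ramsey_action = permutations U A for U :: "'a set" and A +
  fixes u :: bool and I :: "'j::linorder set" and C :: "('a, 'j) ideal_struct" and R :: "('a \<times> 'a) set" and ord :: bool
  fixes adm
  defines adm_def: "adm \<equiv> (if ord then ordered_emb I C R else emb I C)"
  assumes univ: "univ C = U"
    and covered: "\<And>X. finite X \<Longrightarrow> X \<subseteq> U \<Longrightarrow> \<exists>L e. label_seq u I L \<and> ordered_emb I C R L e \<and> X \<subseteq> e ` Pow {..<length L}"
    and universal: "\<And>L. label_seq u I L \<Longrightarrow> \<exists>e. adm L e"
    and homogeneous: "\<And>L e e'. label_seq u I L \<Longrightarrow> adm L e \<Longrightarrow> adm L e' \<Longrightarrow> \<exists>g\<in>A. \<forall>X. X \<subseteq> {..<length L} \<longrightarrow> g (e X) = e' X"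
    and translate: "\<And>g L e. g \<in> A \<Longrightarrow> adm L e \<Longrightarrow> adm L (\<lambda>X. g (e X))"
begin

lemma ordered_adm: "ordered_emb I C R L e \<Longrightarrow> adm L e"
  by (auto simp: adm_def ordered_emb_def)

lemma adm_emb: "adm L e \<Longrightarrow> emb I C L e"
  by (auto simp: adm_def ordered_emb_def split: if_splits)

lemma adm_pull: "rgw 0 LA LS w \<Longrightarrow> adm LS e \<Longrightarrow> sorted_wrt (\<le>) LS \<Longrightarrow> adm LA (\<lambda>X. e (pull w X))"
  using ordered_emb_pull emb_pull by (auto simp: adm_def split: if_splits)

lemma adm_mem: "adm L e \<Longrightarrow> X \<subseteq> {..<length L} \<Longrightarrow> e X \<in> U"
  using emb_struct(1)[OF adm_emb] univ by simp

text \<open>The dual Ramsey theorem for the group. Finitely many colourings \<open>c i\<close>, each of which sees a group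
element only through its restriction to a finite substructure, can be made constant, after a common
left translation, on finite sets of elements that carry this substructure to one and the same order
type with respect to \<open>R\<close>.\<close>

lemma homogeneous_translate:
  fixes Ls :: "nat \<Rightarrow> 'j set list" and es :: "nat \<Rightarrow> nat set \<Rightarrow> 'a" and c :: "nat \<Rightarrow> ('a \<Rightarrow> 'a) \<Rightarrow> nat"
  assumes label_seq: "\<And>i. i < m \<Longrightarrow> label_seq u I (Ls i)" and adm: "\<And>i. i < m \<Longrightarrow> adm (Ls i) (es i)"
    and Phi: "\<And>i. i < m \<Longrightarrow> finite (Phi i)" "\<And>i. i < m \<Longrightarrow> Phi i \<subseteq> A"
    and ordered: "\<And>i g. i < m \<Longrightarrow> g \<in> Phi i \<Longrightarrow> ordered_emb I C R (Ls i) (\<lambda>X. g (es i X))"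
    and r: "\<And>i g. i < m \<Longrightarrow> g \<in> A \<Longrightarrow> c i g < r"
    and local: "\<And>i g g'. i < m \<Longrightarrow> g \<in> A \<Longrightarrow> g' \<in> A \<Longrightarrow>
       (\<And>X. X \<subseteq> {..<length (Ls i)} \<Longrightarrow> g (es i X) = g' (es i X)) \<Longrightarrow> c i g = c i g'"
  shows "\<exists>h\<in>A. \<forall>i<m. \<forall>g\<in>Phi i. \<forall>g'\<in>Phi i. c i (h \<otimes>\<^bsub>G\<^esub> g) = c i (h \<otimes>\<^bsub>G\<^esub> g')"
proof (cases "m = 0")
  case True
  thus ?thesis using one_mem by blast
next
  case False
  hence "0 < r" using r[of 0, OF _ one_mem] by simp
  define Z where "Z = (\<Union>i<m. \<Union>g\<in>Phi i. (\<lambda>X. g (es i X)) ` Pow {..<length (Ls i)})"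
  have "finite Z" unfolding Z_def using Phi(1) by auto
  moreover have "Z \<subseteq> U" unfolding Z_def using adm_mem[OF adm] A_mem Phi(2) by blast
  ultimately have "\<exists>L e. label_seq u I L \<and> ordered_emb I C R L e \<and> Z \<subseteq> e ` Pow {..<length L}" by (rule covered)
  then obtain LS eS where S: "label_seq u I LS" "ordered_emb I C R LS eS" "Z \<subseteq> eS ` Pow {..<length LS}"
    by blast
  define P where "P = tl LS"
  have P: "LS = {} # P" using label_seq_tl[OF S(1)] by (simp add: P_def)
  note gP = S(1)[unfolded P label_seq_Cons_iff]
  have L: "Ls i = {} # tl (Ls i)" if "i < m" for i using label_seq_tl[OF label_seq[OF that]] .
  have Lsort: "sorted_wrt (\<le>) (tl (Ls i))" if "i < m" for i
    using label_seq[OF that] L[OF that] label_seq_Cons_iff by metis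
  let ?Qs = "map (\<lambda>i. tl (Ls i)) [0..<m]"
  obtain T where T: "sorted_wrt (\<le>) T" "set T \<subseteq> set P" and
    ramsey: "\<And>c :: nat \<Rightarrow> nat list \<Rightarrow> nat. (\<And>i w. c i w < r) \<Longrightarrow>
      (\<exists>g. rgw 0 ({} # P) ({} # T) g \<and>
        (\<forall>i<length ?Qs. \<exists>q. \<forall>f. rgw 0 ({} # ?Qs ! i) ({} # P) f \<longrightarrow> c i (wsubst 0 f g) = q))"
  proof (rule dual_ramsey[of P ?Qs r "{}"])
    show "sorted_wrt (\<le>) P" using gP by simp
    show "sorted_wrt (\<le>) Q" if "Q \<in> set ?Qs" for Q using that Lsort by auto
  qed blast
  define LT where "LT = {} # T"
  have gT: "label_seq u I LT" unfolding LT_def label_seq_Cons_iff using T gP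
    by (intro conjI ballI[where A = "set T"] impI) (meson subsetD)+
  from universal[OF gT] obtain eT where eT: "adm LT eT" ..
  note sT = label_seq_sorted[OF gT]
  have "\<exists>g\<in>A. \<forall>X. X \<subseteq> {..<length (Ls i)} \<longrightarrow> g (es i X) = eT (pull w X)"
    if "i < m" "rgw 0 (Ls i) LT w" for i w
    by (rule homogeneous[OF label_seq[OF that(1)] adm[OF that(1)] adm_pull[OF that(2) eT sT]])
  \<comment> \<open>A word \<open>w\<close> describes a copy of the \<open>i\<close>-th structure inside the large structure \<open>eT\<close>; \<open>gam i w\<close> is a group
element that realises this copy, so that colourings of group elements become colourings of words.\<close>
  then obtain gam where gam: "\<And>i w. i < m \<Longrightarrow> rgw 0 (Ls i) LT w \<Longrightarrow> gam i w \<in> A \<and>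
     (\<forall>X. X \<subseteq> {..<length (Ls i)} \<longrightarrow> gam i w (es i X) = eT (pull w X))" by metis
  define cc where "cc i w = (if i < m \<and> rgw 0 (Ls i) LT w then c i (gam i w) else 0)" for i w
  have "cc i w < r" for i w using r gam \<open>0 < r\<close> by (simp add: cc_def)
  then obtain g where g: "rgw 0 LS LT g"
    and gc: "\<And>i. i < m \<Longrightarrow> \<exists>q. \<forall>f. rgw 0 (Ls i) LS f \<longrightarrow> cc i (wsubst 0 f g) = q"
    using ramsey[of cc] L unfolding P LT_def by (auto simp del: upt_Suc)
  obtain h where h: "h \<in> A" "\<And>X. X \<subseteq> {..<length LS} \<Longrightarrow> h (eS X) = eT (pull g X)"
  proof -
    from homogeneous[OF S(1) ordered_adm[OF S(2)] adm_pull[OF g eT sT]]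
    obtain h where "h \<in> A" "\<forall>X. X \<subseteq> {..<length LS} \<longrightarrow> h (eS X) = eT (pull g X)" by (elim bexE)
    thus thesis using that by simp
  qed
  have "\<exists>q. \<forall>k\<in>Phi i. c i (h \<otimes>\<^bsub>G\<^esub> k) = q" if i: "i < m" for i
  proof -
    obtain q where q: "\<And>f. rgw 0 (Ls i) LS f \<Longrightarrow> cc i (wsubst 0 f g) = q" using gc[OF i] by blast
    have "c i (h \<otimes>\<^bsub>G\<^esub> k) = q" if k: "k \<in> Phi i" for k
    proof -
      have kA: "k \<in> A" using Phi(2)[OF i] k by blast
      have "(\<lambda>X. k (es i X)) ` Pow {..<length (Ls i)} \<subseteq> eS ` Pow {..<length LS}"
        using S(3) i k unfolding Z_def by blast
      from ordered_emb_pull_factor[OF ordered[OF i k] S(2) this label_seq[OF i] S(1)]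
      obtain f where f: "rgw 0 (Ls i) LS f" "\<And>X. X \<subseteq> {..<length (Ls i)} \<Longrightarrow> k (es i X) = eS (pull f X)"
        by auto
      have fg: "rgw 0 (Ls i) LT (wsubst 0 f g)" by (rule rgw_wsubst[OF f(1) g])
      have "c i (h \<otimes>\<^bsub>G\<^esub> k) = c i (gam i (wsubst 0 f g))"
      proof (rule local[OF i])
        show "h \<otimes>\<^bsub>G\<^esub> k \<in> A" by (rule mult_mem[OF h(1) kA])
        show "gam i (wsubst 0 f g) \<in> A" using gam[OF i fg] by blast
        fix X assume X: "X \<subseteq> {..<length (Ls i)}"
        have "(h \<otimes>\<^bsub>G\<^esub> k) (es i X) = h (k (es i X))" by (rule mult_apply[OF h(1) kA adm_mem[OF adm[OF i] X]])
        also have "\<dots> = h (eS (pull f X))" using f(2)[OF X] by simp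
        also have "\<dots> = eT (pull g (pull f X))"
          using pull_subset[of f X] rgw_length[OF f(1)] by (intro h(2)) simp
        also have "\<dots> = eT (pull (wsubst 0 f g) X)"
          using rgw_set[OF g] rgw_length[OF f(1)] by (subst pull_wsubst) auto
        also have "\<dots> = gam i (wsubst 0 f g) (es i X)" using gam[OF i fg] X by simp
        finally show "(h \<otimes>\<^bsub>G\<^esub> k) (es i X) = gam i (wsubst 0 f g) (es i X)" .
      qed
      also have "\<dots> = cc i (wsubst 0 f g)" using i fg by (simp add: cc_def)
      finally show ?thesis using q[OF f(1)] by simp
    qed
    thus ?thesis by blast
  qed
  hence "\<forall>i<m. \<forall>g\<in>Phi i. \<forall>g'\<in>Phi i. c i (h \<otimes>\<^bsub>G\<^esub> g) = c i (h \<otimes>\<^bsub>G\<^esub> g')" by metis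
  thus ?thesis using h(1) by blast
qed

end

section \<open>Almost constant orbits\<close>

lemma (in permutation_flow) act_inv:
  assumes "g \<in> A" "y \<in> topspace Y" shows "\<psi> g (\<psi> (inv\<^bsub>G\<^esub> g) y) = y"
proof -
  have "\<psi> g (\<psi> (inv\<^bsub>G\<^esub> g) y) = \<psi> (g \<otimes>\<^bsub>G\<^esub> inv\<^bsub>G\<^esub> g) y"
    by (rule act_mult[OF assms(1) inv_mem[OF assms(1)] assms(2), symmetric])
  also have "g \<otimes>\<^bsub>G\<^esub> inv\<^bsub>G\<^esub> g = \<one>\<^bsub>G\<^esub>" by (rule G.r_inv) (use assms in simp)
  finally show ?thesis using act_one[OF assms(2)] by metis
qed

text \<open>A grid of mesh \<open>1/10\<close> turns a function with values in \<open>[0,1]\<close> into a colouring. It is fine enough, because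
in the end the values \<open>0\<close> and \<open>1\<close> have to be told apart up to three errors of \<open>1/10\<close>.\<close>

lemma floor_close:
  fixes a b :: real
  assumes "0 \<le> a" "0 \<le> b" "nat \<lfloor>10 * a\<rfloor> = nat \<lfloor>10 * b\<rfloor>"
  shows "\<bar>a - b\<bar> < 1/10"
proof -
  have "0 \<le> \<lfloor>10 * a\<rfloor>" "0 \<le> \<lfloor>10 * b\<rfloor>" using assms by auto
  hence "\<lfloor>10 * a\<rfloor> = \<lfloor>10 * b\<rfloor>" using assms(3) by linarith
  thus ?thesis by linarith
qed

definition unit_function :: "'y topology \<Rightarrow> ('y \<Rightarrow> real) \<Rightarrow> bool" where
  "unit_function Y f \<longleftrightarrow> continuous_map Y euclideanreal f \<and> (\<forall>y\<in>topspace Y. 0 \<le> f y \<and> f y \<le> 1)"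

text \<open>By compactness there is a single point \<open>y\<close> at which, for every continuous \<open>f\<close>, the value of \<open>f\<close> at the
translate of \<open>y\<close> by the inverse of \<open>g\<close> depends, up to a small error, only on the order type that \<open>g\<close>
induces on a suitable finite set. The condition for finitely many functions and group elements is closed
and, by \<open>homogeneous_translate\<close>, can be satisfied by a translate of an arbitrary point.\<close>

lemma (in ramsey_action) almost_constant_point:
  fixes Y :: "'y topology"
  assumes flow: "flow G (perm_topology U A) Y \<psi>"
  shows "\<exists>y\<in>topspace Y. \<forall>f. unit_function Y f \<longrightarrow>
    (\<exists>F. finite F \<and> F \<subseteq> U \<and>
      (\<forall>L e g1 g2. label_seq u I L \<longrightarrow> adm L e \<longrightarrow> F \<subseteq> e ` Pow {..<length L} \<longrightarrow> g1 \<in> A \<longrightarrow> g2 \<in> A \<longrightarrow>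
         ordered_emb I C R L (\<lambda>X. g1 (e X)) \<longrightarrow> ordered_emb I C R L (\<lambda>X. g2 (e X)) \<longrightarrow>
         \<bar>f (\<psi> (inv\<^bsub>G\<^esub> g1) y) - f (\<psi> (inv\<^bsub>G\<^esub> g2) y)\<bar> \<le> 3/10))"
proof -
  interpret permutation_flow U A Y \<psi> by unfold_locales (rule flow)
  define modulus where "modulus f F \<longleftrightarrow> finite F \<and> F \<subseteq> U \<and>
     (\<forall>k y. k \<in> A \<longrightarrow> (\<forall>a\<in>F. k a = a) \<longrightarrow> y \<in> topspace Y \<longrightarrow> \<bar>f (\<psi> k y) - f y\<bar> < 1/10)"
    for f :: "'y \<Rightarrow> real" and F
  have "\<exists>F. modulus f F" if f: "unit_function Y f" for f
  proof -
    have cont: "continuous_map Y euclideanreal f" and pos: "0 < (1/10 :: real)"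
      using f by (auto simp: unit_function_def)
    show ?thesis
    proof (rule uniformly_fixed[OF cont pos])
      fix F assume F: "finite F" "F \<subseteq> U"
        "\<And>k y. k \<in> A \<Longrightarrow> (\<And>a. a \<in> F \<Longrightarrow> k a = a) \<Longrightarrow> y \<in> topspace Y \<Longrightarrow> \<bar>f (\<psi> k y) - f y\<bar> < 1/10"
      show ?thesis unfolding modulus_def by (intro exI[of _ F] conjI F(1,2) allI impI, rule F(3)) auto
    qed
  qed
  then obtain F where F: "\<And>f. unit_function Y f \<Longrightarrow> modulus f (F f)" by metis
  define valid where "valid x \<longleftrightarrow> (case x of (f, L, e, Phi) \<Rightarrow> unit_function Y f \<and> label_seq u I L \<and> adm L e \<and>
     F f \<subseteq> e ` Pow {..<length L} \<and> finite Phi \<and> Phi \<subseteq> A \<and> (\<forall>g\<in>Phi. ordered_emb I C R L (\<lambda>X. g (e X))))"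
    for x :: "('y \<Rightarrow> real) \<times> 'j set list \<times> (nat set \<Rightarrow> 'a) \<times> ('a \<Rightarrow> 'a) set"
  define K where "K x = (case x of (f, L, e, Phi) \<Rightarrow>
     {y \<in> topspace Y. \<forall>g1\<in>Phi. \<forall>g2\<in>Phi. \<bar>f (\<psi> (inv\<^bsub>G\<^esub> g1) y) - f (\<psi> (inv\<^bsub>G\<^esub> g2) y)\<bar> \<le> 3/10})"
    for x :: "('y \<Rightarrow> real) \<times> 'j set list \<times> (nat set \<Rightarrow> 'a) \<times> ('a \<Rightarrow> 'a) set"
  have closed: "closedin Y (K x)" if x: "valid x" for x
  proof -
    obtain f L e Phi where xe: "x = (f, L, e, Phi)" by (cases x)
    have f: "continuous_map Y euclideanreal f" and Phi: "Phi \<subseteq> A"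
      using x unfolding valid_def xe unit_function_def by auto
    define W where "W g1 g2 = {y \<in> topspace Y. \<bar>(f \<circ> \<psi> (inv\<^bsub>G\<^esub> g1)) y - (f \<circ> \<psi> (inv\<^bsub>G\<^esub> g2)) y\<bar> \<in> {3/10<..}}" for g1 g2
    have "openin Y (W g1 g2)" if "g1 \<in> Phi" "g2 \<in> Phi" for g1 g2
      unfolding W_def using that Phi
      by (intro openin_continuous_map_preimage[where Y = euclideanreal] continuous_map_real_abs continuous_map_diff
          continuous_map_compose[OF act_continuous f] inv_mem) auto
    hence "openin Y (\<Union>g1\<in>Phi. \<Union>g2\<in>Phi. W g1 g2)" by (intro openin_Union ballI) auto
    moreover have "topspace Y - K x = (\<Union>g1\<in>Phi. \<Union>g2\<in>Phi. W g1 g2)"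
      unfolding K_def xe W_def by (auto simp flip: not_le)
    moreover have "K x \<subseteq> topspace Y" by (auto simp: K_def xe)
    ultimately show ?thesis by (simp add: closedin_def)
  qed
  have finite_case: "topspace Y \<inter> (\<Inter>x\<in>S. K x) \<noteq> {}" if S: "finite S" "\<forall>x\<in>S. valid x" for S
  proof -
    obtain xs where xs: "set xs = S" using finite_list[OF S(1)] by blast
    define fs Ls es Phi where "fs i = fst (xs ! i)" and "Ls i = fst (snd (xs ! i))"
      and "es i = fst (snd (snd (xs ! i)))" and "Phi i = snd (snd (snd (xs ! i)))" for i
    have "valid (xs ! i)" if "i < length xs" for i using S(2) xs nth_mem[OF that] by blast
    hence v: "unit_function Y (fs i)" "label_seq u I (Ls i)" "adm (Ls i) (es i)"
      "F (fs i) \<subseteq> es i ` Pow {..<length (Ls i)}" "finite (Phi i)" "Phi i \<subseteq> A"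
      "\<And>g. g \<in> Phi i \<Longrightarrow> ordered_emb I C R (Ls i) (\<lambda>X. g (es i X))" if "i < length xs" for i
      using that unfolding valid_def fs_def Ls_def es_def Phi_def by (auto simp: case_prod_unfold)
    obtain y0 where y0: "y0 \<in> topspace Y" using nonempty by blast
    \<comment> \<open>Replacing \<open>g\<close> by a representative of its restriction makes the colour depend on the restriction only,
at the cost of an error of \<open>1/10\<close>.\<close>
    define rep where "rep i g = (SOME k. k \<in> A \<and> (\<forall>X. X \<subseteq> {..<length (Ls i)} \<longrightarrow> k (es i X) = g (es i X)))" for i g
    have rep: "rep i g \<in> A" "\<And>X. X \<subseteq> {..<length (Ls i)} \<Longrightarrow> rep i g (es i X) = g (es i X)" if "g \<in> A" for i g
      using someI[of "\<lambda>k. k \<in> A \<and> (\<forall>X. X \<subseteq> {..<length (Ls i)} \<longrightarrow> k (es i X) = g (es i X))" g] that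
      unfolding rep_def by auto
    define c where "c i g = nat \<lfloor>10 * fs i (\<psi> (inv\<^bsub>G\<^esub> (rep i g)) y0)\<rfloor>" for i g
    have unit: "0 \<le> fs i (\<psi> (inv\<^bsub>G\<^esub> g) y0)" "fs i (\<psi> (inv\<^bsub>G\<^esub> g) y0) \<le> 1" if "i < length xs" "g \<in> A" for i g
      using v(1)[OF that(1)] act_mem[OF inv_mem[OF that(2)] y0] by (auto simp: unit_function_def)
    \<comment> \<open>The value \<open>10\<close> is attained if the function is \<open>1\<close>, hence eleven colours.\<close>
    have c11: "c i g < 11" if "i < length xs" "g \<in> A" for i g
    proof -
      have "\<lfloor>10 * fs i (\<psi> (inv\<^bsub>G\<^esub> (rep i g)) y0)\<rfloor> < 11"
        using unit(2)[OF that(1) rep(1)[OF that(2), of i]] by linarith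
      thus ?thesis unfolding c_def by linarith
    qed
    have c_local: "c i g = c i g'" if "\<And>X. X \<subseteq> {..<length (Ls i)} \<Longrightarrow> g (es i X) = g' (es i X)" for i g g'
      using that unfolding c_def rep_def by (auto cong: conj_cong)
    obtain h where h: "h \<in> A" and hc: "\<And>i g g'. i < length xs \<Longrightarrow> g \<in> Phi i \<Longrightarrow> g' \<in> Phi i \<Longrightarrow>
       c i (h \<otimes>\<^bsub>G\<^esub> g) = c i (h \<otimes>\<^bsub>G\<^esub> g')"
      using homogeneous_translate[of "length xs" Ls es Phi c 11, OF v(2) v(3) v(5) v(6) v(7) c11 c_local] by blast
    define y where "y = \<psi> (inv\<^bsub>G\<^esub> h) y0"
    have y: "y \<in> topspace Y" unfolding y_def by (rule act_mem[OF inv_mem[OF h] y0])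
    have near: "\<bar>fs i (\<psi> (inv\<^bsub>G\<^esub> (rep i (h \<otimes>\<^bsub>G\<^esub> g))) y0) - fs i (\<psi> (inv\<^bsub>G\<^esub> g) y)\<bar> < 1/10"
      if i: "i < length xs" and g: "g \<in> Phi i" for i g
    proof -
      have gA: "g \<in> A" using v(6)[OF i] g by blast
      define p where "p = h \<otimes>\<^bsub>G\<^esub> g"
      define k where "k = rep i p"
      have p: "p \<in> A" unfolding p_def by (rule mult_mem[OF h gA])
      have k: "k \<in> A" unfolding k_def by (rule rep(1)[OF p])
      have "inv\<^bsub>G\<^esub> p = inv\<^bsub>G\<^esub> g \<otimes>\<^bsub>G\<^esub> inv\<^bsub>G\<^esub> h" unfolding p_def by (rule G.inv_mult_group) (use h gA in simp_all)
      hence "\<psi> (inv\<^bsub>G\<^esub> p) y0 = \<psi> (inv\<^bsub>G\<^esub> g) y"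
        unfolding y_def using act_mult[OF inv_mem[OF gA] inv_mem[OF h] y0] by metis
      define s where "s = inv\<^bsub>G\<^esub> k \<otimes>\<^bsub>G\<^esub> p"
      have s: "s \<in> A" unfolding s_def by (rule mult_mem[OF inv_mem[OF k] p])
      have py: "\<psi> (inv\<^bsub>G\<^esub> p) y0 \<in> topspace Y" by (rule act_mem[OF inv_mem[OF p] y0])
      have "\<psi> s (\<psi> (inv\<^bsub>G\<^esub> p) y0) = \<psi> (inv\<^bsub>G\<^esub> k) (\<psi> p (\<psi> (inv\<^bsub>G\<^esub> p) y0))"
        unfolding s_def by (rule act_mult[OF inv_mem[OF k] p py])
      hence sy: "\<psi> s (\<psi> (inv\<^bsub>G\<^esub> p) y0) = \<psi> (inv\<^bsub>G\<^esub> k) y0" using act_inv[OF p y0] by metis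
      have "s a = a" if a: "a \<in> F (fs i)" for a
      proof -
        obtain X where X: "X \<subseteq> {..<length (Ls i)}" "a = es i X" using v(4)[OF i] a by blast
        have aU: "a \<in> U" unfolding X(2) by (rule adm_mem[OF v(3)[OF i] X(1)])
        have "s a = (inv\<^bsub>G\<^esub> k) (p a)" unfolding s_def by (rule mult_apply[OF inv_mem[OF k] p aU])
        also have "p a = k a" unfolding k_def X(2) by (rule rep(2)[OF p X(1), symmetric])
        also have "(inv\<^bsub>G\<^esub> k) (k a) = a" by (rule inv_apply(1)[OF k aU])
        finally show ?thesis .
      qed
      hence "\<bar>fs i (\<psi> s (\<psi> (inv\<^bsub>G\<^esub> p) y0)) - fs i (\<psi> (inv\<^bsub>G\<^esub> p) y0)\<bar> < 1/10"
        using F[OF v(1)[OF i]] s py unfolding modulus_def by blast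
      thus ?thesis unfolding sy unfolding \<open>\<psi> (inv\<^bsub>G\<^esub> p) y0 = \<psi> (inv\<^bsub>G\<^esub> g) y\<close> unfolding k_def p_def .
    qed
    have "y \<in> K (xs ! i)" if i: "i < length xs" for i
    proof -
      have "\<bar>fs i (\<psi> (inv\<^bsub>G\<^esub> g1) y) - fs i (\<psi> (inv\<^bsub>G\<^esub> g2) y)\<bar> \<le> 3/10" if g: "g1 \<in> Phi i" "g2 \<in> Phi i" for g1 g2
      proof -
        have gA: "g1 \<in> A" "g2 \<in> A" using v(6)[OF i] g by auto
        have "\<bar>fs i (\<psi> (inv\<^bsub>G\<^esub> (rep i (h \<otimes>\<^bsub>G\<^esub> g1))) y0) - fs i (\<psi> (inv\<^bsub>G\<^esub> (rep i (h \<otimes>\<^bsub>G\<^esub> g2))) y0)\<bar> < 1/10"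
          by (rule floor_close[OF unit(1)[OF i rep(1)] unit(1)[OF i rep(1)]])
            (use hc[OF i g] mult_mem[OF h] gA in \<open>simp_all add: c_def\<close>)
        thus ?thesis using near[OF i g(1)] near[OF i g(2)] by linarith
      qed
      thus ?thesis unfolding K_def using y by (simp add: case_prod_unfold fs_def Phi_def)
    qed
    hence "y \<in> K x" if "x \<in> S" for x using that xs by (metis in_set_conv_nth)
    thus ?thesis using y by blast
  qed
  have "\<Inter> (insert (topspace Y) (K ` Collect valid)) \<noteq> {}"
  proof (rule compact_space_fip[THEN iffD1, OF compact, rule_format], intro conjI ballI allI impI)
    fix S assume "S \<in> insert (topspace Y) (K ` Collect valid)"
    thus "closedin Y S" using closed by auto
  next
    fix \<F> assume Fi: "finite \<F> \<and> \<F> \<subseteq> insert (topspace Y) (K ` Collect valid)"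
    hence "finite (\<F> - {topspace Y})" "\<F> - {topspace Y} \<subseteq> K ` Collect valid" by auto
    then obtain S where S: "S \<subseteq> Collect valid" "finite S" "\<F> - {topspace Y} = K ` S"
      using finite_subset_image by metis
    hence "topspace Y \<inter> (\<Inter>x\<in>S. K x) \<noteq> {}" by (intro finite_case) auto
    moreover have "topspace Y \<inter> (\<Inter>x\<in>S. K x) \<subseteq> \<Inter>\<F>" using S(3) by blast
    ultimately show "\<Inter>\<F> \<noteq> {}" by blast
  qed
  then obtain y where y: "y \<in> topspace Y" "\<And>x. valid x \<Longrightarrow> y \<in> K x" by auto
  show ?thesis
  proof (intro bexI[OF _ y(1)] allI impI)
    fix f assume f: "unit_function Y f"
    show "\<exists>F. finite F \<and> F \<subseteq> U \<and>
      (\<forall>L e g1 g2. label_seq u I L \<longrightarrow> adm L e \<longrightarrow> F \<subseteq> e ` Pow {..<length L} \<longrightarrow> g1 \<in> A \<longrightarrow> g2 \<in> A \<longrightarrow>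
         ordered_emb I C R L (\<lambda>X. g1 (e X)) \<longrightarrow> ordered_emb I C R L (\<lambda>X. g2 (e X)) \<longrightarrow>
         \<bar>f (\<psi> (inv\<^bsub>G\<^esub> g1) y) - f (\<psi> (inv\<^bsub>G\<^esub> g2) y)\<bar> \<le> 3/10)"
    proof (rule exI[of _ "F f"], intro conjI allI impI)
      show "finite (F f)" "F f \<subseteq> U" using F[OF f] by (auto simp: modulus_def)
      fix L e g1 g2 assume *: "label_seq u I L" "adm L e" "F f \<subseteq> e ` Pow {..<length L}" "g1 \<in> A" "g2 \<in> A"
        "ordered_emb I C R L (\<lambda>X. g1 (e X))" "ordered_emb I C R L (\<lambda>X. g2 (e X))"
      hence "valid (f, L, e, {g1, g2})" using f by (simp add: valid_def)
      from y(2)[OF this] show "\<bar>f (\<psi> (inv\<^bsub>G\<^esub> g1) y) - f (\<psi> (inv\<^bsub>G\<^esub> g2) y)\<bar> \<le> 3/10"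
        unfolding K_def by simp
    qed
  qed
qed

text \<open>If the group preserves \<open>R\<close>, all its elements induce the same order type, and the almost constant
orbit of \<open>y\<close> is constant, since continuous functions separate points.\<close>

lemma (in ramsey_action) fixed_point:
  fixes Y :: "'y topology"
  assumes flow: "flow G (perm_topology U A) Y \<psi>" and ord: ord
  shows "\<exists>y\<in>topspace Y. \<forall>g\<in>A. \<psi> g y = y"
proof -
  interpret permutation_flow U A Y \<psi> by unfold_locales (rule flow)
  obtain y where y: "y \<in> topspace Y" and yf: "\<And>f. unit_function Y f \<Longrightarrow>
    (\<exists>F. finite F \<and> F \<subseteq> U \<and>
      (\<forall>L e g1 g2. label_seq u I L \<longrightarrow> adm L e \<longrightarrow> F \<subseteq> e ` Pow {..<length L} \<longrightarrow> g1 \<in> A \<longrightarrow> g2 \<in> A \<longrightarrow>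
         ordered_emb I C R L (\<lambda>X. g1 (e X)) \<longrightarrow> ordered_emb I C R L (\<lambda>X. g2 (e X)) \<longrightarrow>
         \<bar>f (\<psi> (inv\<^bsub>G\<^esub> g1) y) - f (\<psi> (inv\<^bsub>G\<^esub> g2) y)\<bar> \<le> 3/10))"
    using almost_constant_point[OF flow] by blast
  have "\<psi> g y = y" if g: "g \<in> A" for g
  proof (rule ccontr)
    assume "\<psi> g y \<noteq> y"
    then obtain f where f: "continuous_map Y euclideanreal f" "\<And>y. y \<in> topspace Y \<Longrightarrow> 0 \<le> f y \<and> f y \<le> 1"
      "f (\<psi> g y) = 0" "f y = 1"
      using separation[OF act_mem[OF g y] y] by blast
    hence "unit_function Y f" by (simp add: unit_function_def)
    from yf[OF this] obtain F where F: "finite F" "F \<subseteq> U" and close: "\<And>L e g1 g2. label_seq u I L \<Longrightarrow> adm L e \<Longrightarrow>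
         F \<subseteq> e ` Pow {..<length L} \<Longrightarrow> g1 \<in> A \<Longrightarrow> g2 \<in> A \<Longrightarrow>
         ordered_emb I C R L (\<lambda>X. g1 (e X)) \<Longrightarrow> ordered_emb I C R L (\<lambda>X. g2 (e X)) \<Longrightarrow>
         \<bar>f (\<psi> (inv\<^bsub>G\<^esub> g1) y) - f (\<psi> (inv\<^bsub>G\<^esub> g2) y)\<bar> \<le> 3/10" by blast
    from covered[OF F] obtain L e where L: "label_seq u I L" "ordered_emb I C R L e" "F \<subseteq> e ` Pow {..<length L}"
      by (elim exE conjE)
    note ad = ordered_adm[OF L(2)]
    have oo: "ordered_emb I C R L (\<lambda>X. g (e X))" if "g \<in> A" for g
      using translate[OF that ad] ord by (simp add: adm_def)
    have "\<bar>f (\<psi> (inv\<^bsub>G\<^esub> (inv\<^bsub>G\<^esub> g)) y) - f (\<psi> (inv\<^bsub>G\<^esub> \<one>\<^bsub>G\<^esub>) y)\<bar> \<le> 3/10"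
      by (rule close[OF L(1) ad L(3) inv_mem[OF g] one_mem oo[OF inv_mem[OF g]] oo[OF one_mem]])
    moreover have "inv\<^bsub>G\<^esub> (inv\<^bsub>G\<^esub> g) = g" by (rule G.inv_inv) (use g in simp)
    moreover have "\<psi> (inv\<^bsub>G\<^esub> \<one>\<^bsub>G\<^esub>) y = y" unfolding G.inv_one by (rule act_one[OF y])
    ultimately have "\<bar>f (\<psi> g y) - f y\<bar> \<le> 3/10" by metis
    thus False using f(3,4) by simp
  qed
  thus ?thesis using y by blast
qed

section \<open>Limits of unordered structures\<close>

lemma tuples_map: "xs \<in> tuples n A \<Longrightarrow> h ` A \<subseteq> B \<Longrightarrow> map h xs \<in> tuples n B"
  unfolding tuples_def by auto

lemma struct_iso_compose:
  assumes h: "struct_iso L M N h" and k: "struct_iso L N P k"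
  shows "struct_iso L M P (k \<circ> h)"
proof -
  have "h ` univ M \<subseteq> univ N" using h by (auto simp: struct_iso_def bij_betw_def)
  hence t: "map h xs \<in> tuples n (univ N)" if "xs \<in> tuples n (univ M)" for xs n
    using tuples_map[OF that] by blast
  have "bij_betw (k \<circ> h) (univ M) (univ P)"
    using assms by (auto simp: struct_iso_def intro: bij_betw_trans)
  thus ?thesis using assms t unfolding struct_iso_def by auto
qed

lemma struct_iso_inv:
  assumes h: "struct_iso L M N h" and M: "is_struct L M"
  shows "struct_iso L N M (inv_into (univ M) h)"
proof -
  let ?k = "inv_into (univ M) h"
  have bij: "bij_betw h (univ M) (univ N)" using h by (simp add: struct_iso_def)
  have t: "map ?k ys \<in> tuples n (univ M)" "map h (map ?k ys) = ys" if "ys \<in> tuples n (univ N)" for ys n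
  proof -
    show "map ?k ys \<in> tuples n (univ M)"
      using that bij_betw_inv_into[OF bij] by (intro tuples_map[OF that]) (auto simp: bij_betw_def)
    show "map h (map ?k ys) = ys"
      using that bij by (auto simp: tuples_def bij_betw_def f_inv_into_f subset_iff intro!: map_idI)
  qed
  show ?thesis unfolding struct_iso_def
  proof (intro conjI ballI)
    show "bij_betw ?k (univ N) (univ M)" by (rule bij_betw_inv_into[OF bij])
    fix f ys assume f: "f \<in> fsyms L" and ys: "ys \<in> tuples (farity L f) (univ N)"
    have "h (fint M f (map ?k ys)) = fint N f ys"
      using h f t[OF ys] unfolding struct_iso_def by metis
    moreover have "fint M f (map ?k ys) \<in> univ M" using M f t(1)[OF ys] by (simp add: is_struct_def)
    ultimately show "?k (fint N f ys) = fint M f (map ?k ys)"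
      using bij by (metis bij_betw_def inv_into_f_f)
  next
    fix r ys assume r: "r \<in> rsyms L" and ys: "ys \<in> tuples (rarity L r) (univ N)"
    show "rint N r ys \<longleftrightarrow> rint M r (map ?k ys)"
      using h r t[OF ys] unfolding struct_iso_def by metis
  qed
qed

lemma struct_iso_cong:
  assumes "struct_iso L M N h" "is_struct L M" "\<And>x. x \<in> univ M \<Longrightarrow> h x = k x"
  shows "struct_iso L M N k"
proof -
  have m: "map h xs = map k xs" if "xs \<in> tuples n (univ M)" for xs n
    using that assms(3) by (auto simp: tuples_def)
  have "bij_betw h (univ M) (univ N) = bij_betw k (univ M) (univ N)" by (rule bij_betw_cong) (rule assms(3))
  thus ?thesis using assms m unfolding struct_iso_def is_struct_def by metis
qed

text \<open>Automorphisms are extensional functions here; composition and inversion in the group of bijections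
restrict the values outside the universe accordingly.\<close>

lemma subgroup_automorphisms:
  assumes M: "is_struct L M"
  shows "subgroup (automorphisms L M) (BijGroup (univ M))"
proof (rule group.subgroupI[OF group_BijGroup])
  show "automorphisms L M \<subseteq> carrier (BijGroup (univ M))" by (auto simp: automorphisms_def BijGroup_def)
  have "struct_iso L M M (\<lambda>x. x)" by (auto simp: struct_iso_def bij_betw_def)
  hence "(\<lambda>x\<in>univ M. x) \<in> automorphisms L M"
    using struct_iso_cong[OF _ M, of M "\<lambda>x. x" "\<lambda>x\<in>univ M. x"] id_Bij by (simp add: automorphisms_def)
  thus "automorphisms L M \<noteq> {}" by blast
  fix g assume g: "g \<in> automorphisms L M"
  hence gB: "g \<in> Bij (univ M)" and gi: "struct_iso L M M g" by (auto simp: automorphisms_def)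
  show "inv\<^bsub>BijGroup (univ M)\<^esub> g \<in> automorphisms L M"
    unfolding inv_BijGroup[OF gB] automorphisms_def
    using struct_iso_cong[OF struct_iso_inv[OF gi M] M] restrict_inv_into_Bij[OF gB] by simp
  fix h assume h: "h \<in> automorphisms L M"
  hence hB: "h \<in> Bij (univ M)" and hi: "struct_iso L M M h" by (auto simp: automorphisms_def)
  have "struct_iso L M M (compose (univ M) g h)"
    by (rule struct_iso_cong[OF struct_iso_compose[OF hi gi] M]) (simp add: compose_eq)
  thus "g \<otimes>\<^bsub>BijGroup (univ M)\<^esub> h \<in> automorphisms L M"
    using compose_Bij[OF gB hB] gB hB by (simp add: BijGroup_def automorphisms_def)
qed

lemma Aut_eq: "Aut L M = perm_group (univ M) (automorphisms L M)"
  "Aut_topology L M = perm_topology (univ M) (automorphisms L M)"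
  by (simp_all add: Aut_def Aut_topology_def)

lemma hull_substructure:
  assumes "is_struct L M" "X \<subseteq> univ M"
  shows "substructure L M (substructure L M hull X)" "X \<subseteq> substructure L M hull X"
proof -
  have U: "substructure L M (univ M)" using assms(1) by (simp add: substructure_def induced_def)
  let ?F = "{S. substructure L M S \<and> X \<subseteq> S}"
  have mem: "univ M \<in> ?F" using U assms(2) by simp
  have "is_struct L (induced M (\<Inter>?F))"
    unfolding is_struct_def
  proof (intro ballI)
    fix f xs assume f: "f \<in> fsyms L" and xs: "xs \<in> tuples (farity L f) (univ (induced M (\<Inter>?F)))"
    have "fint M f xs \<in> S" if S: "S \<in> ?F" for S
    proof -
      have "xs \<in> tuples (farity L f) S" using xs S by (auto simp: tuples_def induced_def)
      thus ?thesis using S f by (auto simp: substructure_def is_struct_def induced_def)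
    qed
    thus "fint (induced M (\<Inter>?F)) f xs \<in> univ (induced M (\<Inter>?F))" by (simp add: induced_def)
  qed
  moreover have "\<Inter>?F \<subseteq> univ M" using mem by blast
  ultimately show "substructure L M (substructure L M hull X)" by (simp add: substructure_def[of L M "\<Inter>_"] hull_def)
  show "X \<subseteq> substructure L M hull X" by (rule hull_subset)
qed

lemma iso_induced:
  assumes "S \<subseteq> univ C"
  shows "struct_iso (ideal_lang I) (pow_alg L) (induced C S) e \<longleftrightarrow> emb I C L e \<and> e ` Pow {..<length L} = S"
proof -
  have "e ` Pow {..<length L} = S \<Longrightarrow> emb I (induced C S) L e \<longleftrightarrow> emb I C L e"
    using assms unfolding emb_def induced_def by auto
  moreover have "univ (induced C S) = S" by (simp add: induced_def)
  ultimately show ?thesis unfolding struct_iso_pow_alg by metis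
qed

lemma emb_substructure:
  assumes e: "emb I C L e"
  shows "substructure (ideal_lang K) C (e ` Pow {..<length L})"
proof -
  note es = emb_struct[OF e]
  have "is_struct (ideal_lang K) (induced C (e ` Pow {..<length L}))"
    unfolding is_struct_ideal_lang induced_def
    by (auto simp: es(2) es(6) es(7) es(3)[OF empty_subsetI] es(4)[OF empty_subsetI] intro!: imageI)
  thus ?thesis using es(1) by (auto simp: substructure_def)
qed

lemma pow_alg_struct: "is_struct (ideal_lang I) (pow_alg L)"
  unfolding is_struct_ideal_lang by (auto simp: pow_alg_def)

lemma emb_compose_iso:
  assumes e: "struct_iso (ideal_lang I) (pow_alg L) M e" and k: "struct_iso (ideal_lang I) M (induced C S) k" and S: "S \<subseteq> univ C"
  shows "emb I C L (k \<circ> e)" "(k \<circ> e) ` Pow {..<length L} = S"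
  using struct_iso_compose[OF e k] unfolding iso_induced[OF S] by auto

text \<open>Labels are upward closed and therefore form a chain; atoms are ordered by decreasing label, with
ties broken by an arbitrary injection into the natural numbers.\<close>

lemma exists_proper_ordering:
  assumes M: "M \<in> ideal_class u I"
  shows "\<exists>S. proper_ordering I M S"
proof -
  have fin: "finite (univ M)" and mono: "\<And>i j. i \<in> I \<Longrightarrow> j \<in> I \<Longrightarrow> i < j \<Longrightarrow> pset M i \<subseteq> pset M j"
    using M unfolding ideal_class_iff by auto
  have "finite (atoms M)" using fin by (simp add: atoms_def)
  then obtain f :: "'a \<Rightarrow> nat" where f: "inj_on f (atoms M)" using finite_imp_inj_to_nat_seg by blast
  define lab where "lab a = {j \<in> I. a \<in> pset M j}" for a
  have chain: "lab a \<subseteq> lab b \<or> lab b \<subseteq> lab a" for a b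
  proof (rule ccontr)
    assume "\<not> (lab a \<subseteq> lab b \<or> lab b \<subseteq> lab a)"
    then obtain i j where "i \<in> lab a" "i \<notin> lab b" "j \<in> lab b" "j \<notin> lab a" by blast
    thus False using mono[of i j] mono[of j i] by (cases i j rule: linorder_cases) (auto simp: lab_def)
  qed
  define S where "S = {(a, b). a \<in> atoms M \<and> b \<in> atoms M \<and> (lab b \<subset> lab a \<or> (lab a = lab b \<and> f a < f b))}"
  have "trans S" by (rule transI) (auto simp: S_def)
  moreover have "irrefl S" by (auto simp: S_def irrefl_def)
  moreover have "total_on (atoms M) S"
  proof (rule total_onI)
    fix a b assume ab: "a \<in> atoms M" "b \<in> atoms M" "a \<noteq> b"
    hence "f a \<noteq> f b" using f by (auto dest: inj_onD)
    thus "(a, b) \<in> S \<or> (b, a) \<in> S" using ab chain[of a b] by (auto simp: S_def)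
  qed
  ultimately have lin: "linear_ordering (atoms M) S"
    unfolding linear_ordering_def strict_linear_order_on_def by (auto simp: S_def)
  have mem: "(a, b) \<in> S" if ab: "a \<in> atoms M" "b \<in> atoms M" "i \<in> I" "a \<in> pset M i" "b \<notin> pset M i" for a b i
  proof -
    have "i \<in> lab a" "i \<notin> lab b" using ab by (auto simp: lab_def)
    thus ?thesis using chain[of a b] ab by (auto simp: S_def)
  qed
  have "proper_ordering I M S"
    unfolding proper_ordering_def by (intro conjI lin ballI impI, rule mem) blast+
  thus ?thesis ..
qed

lemma class_pow_alg:
  assumes "M \<in> ideal_class u I"
  obtains L e where "label_seq u I L" "struct_iso (ideal_lang I) (pow_alg L) M e"
  using exists_proper_ordering[OF assms] class_iso[OF assms] by metis

text \<open>The age of a structure is described by structures on natural numbers, so that sets of positions are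
coded by numbers.\<close>

lemma class_contains:
  fixes L :: "'j::linorder set list"
  assumes g: "label_seq u I L"
  obtains M :: "(nat, 'j) ideal_struct" and h where "M \<in> ideal_class u I" "struct_iso (ideal_lang I) (pow_alg L) M h"
proof -
  define M :: "(nat, 'j) ideal_struct" where "M = \<lparr>univ = set_encode ` Pow {..<length L},
    fint = (\<lambda>f xs. set_encode (fint (pow_alg L) f (map set_decode xs))),
    rint = (\<lambda>j xs. rint (pow_alg L) j (map set_decode xs))\<rparr>"
  have dec: "set_decode (set_encode X) = X" if "X \<subseteq> {..<length L}" for X
    using that finite_subset by (intro set_encode_inverse) auto
  have "inj_on set_encode (Pow {..<length L})"
    by (rule inj_on_inverseI[where g = set_decode]) (use dec in auto)
  hence "emb I M L set_encode" unfolding emb_def by (auto simp: M_def pow_alg_def dec)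
  hence iso: "struct_iso (ideal_lang I) (pow_alg L) M set_encode" by (simp add: struct_iso_pow_alg M_def)
  show thesis by (rule that[OF iso_in_class[OF iso g] iso])
qed

lemma homogeneous_automorphism:
  assumes "homogeneous L M" "is_struct L M" "substructure L M S" "finite S" "substructure L M T" "finite T"
    "struct_iso L (induced M S) (induced M T) h"
  obtains g where "g \<in> automorphisms L M" "\<And>x. x \<in> S \<Longrightarrow> g x = h x"
proof -
  obtain g where g: "struct_iso L M M g" "\<And>x. x \<in> S \<Longrightarrow> g x = h x"
    using assms unfolding homogeneous_def by blast
  let ?g = "restrict g (univ M)"
  have iso: "struct_iso L M M ?g" by (rule struct_iso_cong[OF g(1) assms(2)]) simp
  hence "?g \<in> Bij (univ M)" by (simp add: Bij_def struct_iso_def)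
  hence "?g \<in> automorphisms L M" using iso by (simp add: automorphisms_def)
  moreover have "S \<subseteq> univ M" using assms(3) by (simp add: substructure_def)
  ultimately show thesis using that[of ?g] g(2) by (simp add: subset_iff)
qed

lemma emb_automorphism:
  assumes g: "struct_iso (ideal_lang I) C C g" and e: "emb I C L e"
  shows "emb I C L (\<lambda>X. g (e X))"
proof -
  have bij: "bij_betw g (univ C) (univ C)" using g by (simp add: struct_iso_def)
  have eq: "g (bjoin C x y) = bjoin C (g x) (g y)" "g (bmeet C x y) = bmeet C (g x) (g y)" "g (bneg C x) = bneg C (g x)"
    "g (bzero C) = bzero C" "g (bone C) = bone C" "j \<in> I \<Longrightarrow> rint C j [x] \<longleftrightarrow> rint C j [g x]"
    if "x \<in> univ C" "y \<in> univ C" for x y j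
    using g that unfolding struct_iso_def by (auto simp: ideal_lang_def ball_bool_sym tuples_simps)
  have eU: "e X \<in> univ C" if "X \<subseteq> {..<length L}" for X using emb_struct(1)[OF e that] .
  have inj: "inj_on g (univ C)" and gU: "\<And>x. x \<in> univ C \<Longrightarrow> g x \<in> univ C" using bij by (auto simp: bij_betw_def)
  show ?thesis unfolding emb_def
  proof (intro conjI ballI)
    show "inj_on (\<lambda>X. g (e X)) (Pow {..<length L})"
    proof (rule inj_onI)
      fix X Y assume XY: "X \<in> Pow {..<length L}" "Y \<in> Pow {..<length L}" "g (e X) = g (e Y)"
      hence "e X = e Y" using inj_onD[OF inj XY(3)] eU by simp
      thus "X = Y" using emb_struct(8)[OF e, of X Y] XY by simp
    qed
    show "(\<lambda>X. g (e X)) ` Pow {..<length L} \<subseteq> univ C" using gU eU by auto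
    have e0: "e {} \<in> univ C" by (rule eU) simp
    show "g (e {}) = bzero C" using eq(4)[OF e0 e0] emb_struct(3)[OF e, of "{}"] by simp
    show "g (e {..<length L}) = bone C" using eq(5)[OF e0 e0] emb_struct(4)[OF e, of "{}"] by simp
    fix X assume "X \<in> Pow {..<length L}"
    hence X: "X \<subseteq> {..<length L}" by simp
    show "g (e ({..<length L} - X)) = bneg C (g (e X))"
      using eq(3)[OF eU[OF X] eU[OF X]] emb_struct(2)[OF e X] by simp
    { fix Y assume "Y \<in> Pow {..<length L}"
      hence Y: "Y \<subseteq> {..<length L}" by simp
      show "g (e (X \<union> Y)) = bjoin C (g (e X)) (g (e Y))"
        using eq(1)[OF eU[OF X] eU[OF Y]] emb_struct(6)[OF e X Y] by simp
      show "g (e (X \<inter> Y)) = bmeet C (g (e X)) (g (e Y))"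
        using eq(2)[OF eU[OF X] eU[OF Y]] emb_struct(7)[OF e X Y] by simp }
    fix j assume j: "j \<in> I"
    show "(\<forall>i\<in>X. j \<in> L ! i) \<longleftrightarrow> rint C j [g (e X)]"
      using eq(6)[OF eU[OF X] eU[OF X] j] emb_struct(5)[OF e X j] by simp
  qed
qed

text \<open>The unordered limit. The following facts translate age and homogeneity into statements about
embeddings of standard structures.\<close>

locale ideal_limit =
  fixes u :: bool and I :: "'j::linorder set" and C :: "('a, 'j) ideal_struct"
  assumes limit: "fraisse_limit (ideal_lang I) (ideal_class u I :: (nat, 'j) ideal_struct set) C"
begin

lemma struct: "is_struct (ideal_lang I) C" and loc_fin: "locally_finite (ideal_lang I) C"
  and homog: "homogeneous (ideal_lang I) C" and age: "has_age (ideal_lang I) (ideal_class u I :: (nat, 'j) ideal_struct set) C"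
  using limit by (auto simp: fraisse_limit_def)

lemma finite_substructure_emb:
  assumes S: "substructure (ideal_lang I) C S" "finite S"
  obtains L e where "label_seq u I L" "emb I C L e" "e ` Pow {..<length L} = S"
proof -
  obtain M :: "(nat, 'j) ideal_struct" and h where M: "M \<in> ideal_class u I" "struct_iso (ideal_lang I) (induced C S) M h"
    using age S unfolding has_age_def isomorphic_def by blast
  obtain L e where L: "label_seq u I L" "struct_iso (ideal_lang I) (pow_alg L) M e" by (rule class_pow_alg[OF M(1)])
  have "is_struct (ideal_lang I) (induced C S)" "S \<subseteq> univ C" using S(1) by (auto simp: substructure_def)
  from emb_compose_iso[OF L(2) struct_iso_inv[OF M(2) this(1)] this(2)] show thesis using that[OF L(1)] by blast
qed

lemma finite_in_substructure:
  assumes "finite X" "X \<subseteq> univ C"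
  obtains S where "substructure (ideal_lang I) C S" "finite S" "X \<subseteq> S"
  using hull_substructure[OF struct assms(2)] loc_fin assms unfolding locally_finite_def by blast

lemma emb_exists: assumes "label_seq u I L" shows "\<exists>e. emb I C L e"
proof -
  obtain M :: "(nat, 'j) ideal_struct" and h where M: "M \<in> ideal_class u I" "struct_iso (ideal_lang I) (pow_alg L) M h"
    by (rule class_contains[OF assms])
  obtain S k where S: "substructure (ideal_lang I) C S" "struct_iso (ideal_lang I) (induced C S) M k"
    using age M(1) unfolding has_age_def isomorphic_def by blast
  have "is_struct (ideal_lang I) (induced C S)" "S \<subseteq> univ C" using S(1) by (auto simp: substructure_def)
  from emb_compose_iso(1)[OF M(2) struct_iso_inv[OF S(2) this(1)] this(2)] show ?thesis by blast
qed

lemma emb_homogeneous: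
  assumes "emb I C L e" "emb I C L e'"
  shows "\<exists>g\<in>automorphisms (ideal_lang I) C. \<forall>X. X \<subseteq> {..<length L} \<longrightarrow> g (e X) = e' X"
proof -
  let ?S = "e ` Pow {..<length L}" and ?T = "e' ` Pow {..<length L}"
  have sub: "substructure (ideal_lang I) C ?S" "substructure (ideal_lang I) C ?T" using assms emb_substructure by blast+
  hence "?S \<subseteq> univ C" "?T \<subseteq> univ C" by (auto simp: substructure_def)
  hence iso: "struct_iso (ideal_lang I) (pow_alg L) (induced C ?S) e" "struct_iso (ideal_lang I) (pow_alg L) (induced C ?T) e'"
    using assms by (auto simp: iso_induced)
  from struct_iso_compose[OF struct_iso_inv[OF iso(1) pow_alg_struct] iso(2)]
  obtain g where g: "g \<in> automorphisms (ideal_lang I) C"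
    "\<And>x. x \<in> ?S \<Longrightarrow> g x = (e' \<circ> inv_into (univ (pow_alg L)) e) x"
    using homogeneous_automorphism[OF homog struct sub(1) _ sub(2)] by blast
  have "inv_into (univ (pow_alg L)) e (e X) = X" if "X \<subseteq> {..<length L}" for X
    using assms(1) that by (intro inv_into_f_f) (auto simp: emb_def pow_alg_def)
  hence "g (e X) = e' X" if "X \<subseteq> {..<length L}" for X using g(2)[of "e X"] that by simp
  thus ?thesis using g(1) by blast
qed

end

section \<open>Extreme amenability of the ordered limit\<close>

definition ideal_reduct :: "('a, bool_sym, 'j ord_sym) struct \<Rightarrow> ('a, 'j) ideal_struct" where
  "ideal_reduct M = \<lparr>univ = univ M, fint = fint M, rint = (\<lambda>j xs. rint M (Pred j) xs)\<rparr>"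

text \<open>The reduct and the ordering of an ordered structure, so that the ordered limit can be treated with
the notions for unordered ones.\<close>

definition less_rel :: "('a, bool_sym, 'j ord_sym) struct \<Rightarrow> ('a \<times> 'a) set" where
  "less_rel M = {(x, y). x \<in> univ M \<and> y \<in> univ M \<and> rint M Less [x, y]}"

lemma univ_reduct [simp]: "univ (ideal_reduct M) = univ M"
  by (simp add: ideal_reduct_def)

lemma reduct_induced: "ideal_reduct (induced M S) = induced (ideal_reduct M) S"
  by (simp add: ideal_reduct_def induced_def)

lemma reduct_expansion: "ideal_reduct (ord_expansion A R) = A"
  by (simp add: ideal_reduct_def ord_expansion_def)

lemma is_struct_ord: "is_struct (ord_lang I) M \<longleftrightarrow> is_struct (ideal_lang I) (ideal_reduct M)"
  by (simp add: is_struct_def ord_lang_def ideal_lang_def ideal_reduct_def)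

lemma substructure_ord: "substructure (ord_lang I) M S \<longleftrightarrow> substructure (ideal_lang I) (ideal_reduct M) S"
  by (simp add: substructure_def is_struct_ord reduct_induced)

lemma struct_iso_ord: "struct_iso (ord_lang I) M N h \<longleftrightarrow>
   struct_iso (ideal_lang I) (ideal_reduct M) (ideal_reduct N) h \<and>
   (\<forall>x\<in>univ M. \<forall>y\<in>univ M. rint M Less [x, y] \<longleftrightarrow> rint N Less [h x, h y])"
  unfolding struct_iso_def by (auto simp: ord_lang_def ideal_lang_def ideal_reduct_def tuples_simps)

locale ordered_limit =
  fixes u :: bool and I :: "'j::linorder set" and C :: "('a, bool_sym, 'j ord_sym) struct"
  assumes limit: "fraisse_limit (ord_lang I) (class_NA I (ideal_class u I :: (nat, 'j) ideal_struct set)) C"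
begin

lemma struct: "is_struct (ord_lang I) C" and loc_fin: "locally_finite (ord_lang I) C"
  and homog: "homogeneous (ord_lang I) C"
  and age: "has_age (ord_lang I) (class_NA I (ideal_class u I :: (nat, 'j) ideal_struct set)) C"
  using limit by (auto simp: fraisse_limit_def)

abbreviation "oemb \<equiv> ordered_emb I (ideal_reduct C) (less_rel C)"

lemma oemb_compose_iso:
  fixes M :: "('b, 'j) ideal_struct"
  assumes e: "struct_iso (ideal_lang I) (pow_alg L) M e"
    and o: "\<forall>X\<in>Pow {..<length L}. \<forall>Y\<in>Pow {..<length L}. (e X, e Y) \<in> R \<longleftrightarrow> lexless X Y"
    and h: "struct_iso (ord_lang I) (induced C S) (ord_expansion M R) h"
    and S: "substructure (ord_lang I) C S"
  shows "\<exists>k. oemb L k \<and> k ` Pow {..<length L} = S"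
proof -
  have Sstr: "is_struct (ord_lang I) (induced C S)" and SU: "S \<subseteq> univ (ideal_reduct C)"
    using S by (auto simp: substructure_def)
  define k where "k = inv_into (univ (induced C S)) h"
  have "struct_iso (ord_lang I) (ord_expansion M R) (induced C S) k" unfolding k_def by (rule struct_iso_inv[OF h Sstr])
  hence k: "struct_iso (ideal_lang I) M (induced (ideal_reduct C) S) k"
    and ko: "\<And>x y. x \<in> univ M \<Longrightarrow> y \<in> univ M \<Longrightarrow> (x, y) \<in> R \<longleftrightarrow> rint C Less [k x, k y]"
    unfolding struct_iso_ord reduct_induced reduct_expansion by (auto simp: ord_expansion_def induced_def)
  note ke = emb_compose_iso[OF e k SU]
  have eM: "e X \<in> univ M" if "X \<subseteq> {..<length L}" for X
    using e that unfolding struct_iso_pow_alg by auto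
  have "((k \<circ> e) X, (k \<circ> e) Y) \<in> less_rel C \<longleftrightarrow> lexless X Y" if XY: "X \<subseteq> {..<length L}" "Y \<subseteq> {..<length L}" for X Y
  proof -
    have "(k \<circ> e) X \<in> univ C" "(k \<circ> e) Y \<in> univ C" using emb_struct(1)[OF ke(1)] XY by auto
    hence "((k \<circ> e) X, (k \<circ> e) Y) \<in> less_rel C \<longleftrightarrow> (e X, e Y) \<in> R"
      using ko[OF eM[OF XY(1)] eM[OF XY(2)]] by (simp add: less_rel_def)
    thus ?thesis using o XY by simp
  qed
  thus ?thesis using ke unfolding ordered_emb_def by blast
qed

lemma finite_substructure_oemb:
  assumes S: "substructure (ord_lang I) C S" "finite S"
  shows "\<exists>L e. label_seq u I L \<and> oemb L e \<and> e ` Pow {..<length L} = S"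
proof -
  obtain N h where N: "N \<in> class_NA I (ideal_class u I :: (nat, 'j) ideal_struct set)"
    "struct_iso (ord_lang I) (induced C S) N h"
    using age S unfolding has_age_def isomorphic_def by blast
  obtain M R where M: "N = ord_expansion M R" "M \<in> ideal_class u I" "natural_ordering I M R"
    using N(1) unfolding class_NA_def by blast
  obtain L0 e0 where "label_seq u I L0" "struct_iso (ideal_lang I) (pow_alg L0) M e0" by (rule class_pow_alg[OF M(2)])
  from M(3)[unfolded iso_natural_ordering[OF this(2,1)]] obtain L e where L: "label_seq u I L"
    "struct_iso (ideal_lang I) (pow_alg L) M e"
    "\<forall>X\<in>Pow {..<length L}. \<forall>Y\<in>Pow {..<length L}. (e X, e Y) \<in> R \<longleftrightarrow> lexless X Y" by blast
  from oemb_compose_iso[OF L(2,3) N(2)[unfolded M(1)] S(1)] L(1) show ?thesis by blast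
qed

lemma oemb_exists:
  assumes g: "label_seq u I L" shows "\<exists>e. oemb L e"
proof -
  obtain M :: "(nat, 'j) ideal_struct" and h where M: "M \<in> ideal_class u I" "struct_iso (ideal_lang I) (pow_alg L) M h"
    by (rule class_contains[OF g])
  have h: "inj_on h (Pow {..<length L})" "h ` Pow {..<length L} = univ M"
    using M(2) by (auto simp: struct_iso_pow_alg emb_def)
  define R where "R = {(h X, h Y) | X Y. X \<subseteq> {..<length L} \<and> Y \<subseteq> {..<length L} \<and> lexless X Y}"
  have o: "\<forall>X\<in>Pow {..<length L}. \<forall>Y\<in>Pow {..<length L}. (h X, h Y) \<in> R \<longleftrightarrow> lexless X Y"
  proof (intro ballI)
    fix X Y assume XY: "X \<in> Pow {..<length L}" "Y \<in> Pow {..<length L}"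
    have "h X = h X' \<and> h Y = h Y' \<longleftrightarrow> X = X' \<and> Y = Y'" if "X' \<subseteq> {..<length L}" "Y' \<subseteq> {..<length L}" for X' Y'
      using inj_on_eq_iff[OF h(1)] XY that by simp
    thus "(h X, h Y) \<in> R \<longleftrightarrow> lexless X Y" using XY unfolding R_def by auto
  qed
  have "R \<subseteq> univ M \<times> univ M" using h(2) by (auto simp: R_def)
  hence "natural_ordering I M R" unfolding iso_natural_ordering[OF M(2) g] using g M(2) o by blast
  hence "ord_expansion M R \<in> class_NA I (ideal_class u I)" using M(1) unfolding class_NA_def by blast
  then obtain S k where "substructure (ord_lang I) C S" "struct_iso (ord_lang I) (induced C S) (ord_expansion M R) k"
    using age unfolding has_age_def isomorphic_def by blast
  from oemb_compose_iso[OF M(2) o this(2,1)] show ?thesis by blast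
qed

lemma oemb_homogeneous:
  assumes "oemb L e" "oemb L e'"
  shows "\<exists>g\<in>automorphisms (ord_lang I) C. \<forall>X. X \<subseteq> {..<length L} \<longrightarrow> g (e X) = e' X"
proof -
  let ?S = "e ` Pow {..<length L}" and ?T = "e' ` Pow {..<length L}"
  have emb: "emb I (ideal_reduct C) L e" "emb I (ideal_reduct C) L e'"
    and o: "\<And>X Y. X \<subseteq> {..<length L} \<Longrightarrow> Y \<subseteq> {..<length L} \<Longrightarrow> (e X, e Y) \<in> less_rel C \<longleftrightarrow> lexless X Y"
      "\<And>X Y. X \<subseteq> {..<length L} \<Longrightarrow> Y \<subseteq> {..<length L} \<Longrightarrow> (e' X, e' Y) \<in> less_rel C \<longleftrightarrow> lexless X Y"
    using assms by (auto simp: ordered_emb_def)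
  have sub: "substructure (ord_lang I) C ?S" "substructure (ord_lang I) C ?T"
    unfolding substructure_ord using emb emb_substructure by blast+
  hence SU: "?S \<subseteq> univ (ideal_reduct C)" "?T \<subseteq> univ (ideal_reduct C)" by (auto simp: substructure_def)
  hence iso: "struct_iso (ideal_lang I) (pow_alg L) (induced (ideal_reduct C) ?S) e"
    "struct_iso (ideal_lang I) (pow_alg L) (induced (ideal_reduct C) ?T) e'"
    using emb by (auto simp: iso_induced)
  define k where "k = e' \<circ> inv_into (univ (pow_alg L)) e"
  have "inv_into (univ (pow_alg L)) e (e X) = X" if "X \<subseteq> {..<length L}" for X
    using emb(1) that by (intro inv_into_f_f) (auto simp: emb_def pow_alg_def)
  hence k: "k (e X) = e' X" if "X \<subseteq> {..<length L}" for X using that by (simp add: k_def)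
  have "struct_iso (ideal_lang I) (induced (ideal_reduct C) ?S) (induced (ideal_reduct C) ?T) k"
    unfolding k_def by (rule struct_iso_compose[OF struct_iso_inv[OF iso(1) pow_alg_struct] iso(2)])
  moreover have "rint C Less [x, y] \<longleftrightarrow> rint C Less [k x, k y]" if xy: "x \<in> ?S" "y \<in> ?S" for x y
  proof -
    obtain X Y where XY: "X \<subseteq> {..<length L}" "Y \<subseteq> {..<length L}" "x = e X" "y = e Y" using xy by blast
    have "e X \<in> univ C" "e Y \<in> univ C" "e' X \<in> univ C" "e' Y \<in> univ C" using SU XY(1,2) by auto
    thus ?thesis using o(1)[OF XY(1,2)] o(2)[OF XY(1,2)] k[OF XY(1)] k[OF XY(2)] XY(3,4) by (simp add: less_rel_def)
  qed
  ultimately have "struct_iso (ord_lang I) (induced C ?S) (induced C ?T) k"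
    unfolding struct_iso_ord reduct_induced by (simp add: induced_def)
  then obtain g where "g \<in> automorphisms (ord_lang I) C" "\<And>x. x \<in> ?S \<Longrightarrow> g x = k x"
    using homogeneous_automorphism[OF homog struct sub(1) _ sub(2)] by blast
  thus ?thesis using k by (intro bexI[of _ g]) simp_all
qed

lemma oemb_automorphism:
  assumes g: "g \<in> automorphisms (ord_lang I) C" and e: "oemb L e"
  shows "oemb L (\<lambda>X. g (e X))"
proof -
  have gi: "struct_iso (ideal_lang I) (ideal_reduct C) (ideal_reduct C) g"
    and go: "\<And>x y. x \<in> univ C \<Longrightarrow> y \<in> univ C \<Longrightarrow> rint C Less [x, y] \<longleftrightarrow> rint C Less [g x, g y]"
    and gU: "\<And>x. x \<in> univ C \<Longrightarrow> g x \<in> univ C"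
    using g unfolding automorphisms_def struct_iso_ord by (auto simp: struct_iso_def bij_betw_def)
  have emb: "emb I (ideal_reduct C) L e" using e by (simp add: ordered_emb_def)
  have eU: "e X \<in> univ C" if "X \<subseteq> {..<length L}" for X using emb_struct(1)[OF emb that] by simp
  have "(g (e X), g (e Y)) \<in> less_rel C \<longleftrightarrow> (e X, e Y) \<in> less_rel C" if "X \<subseteq> {..<length L}" "Y \<subseteq> {..<length L}" for X Y
    using go[OF eU[OF that(1)] eU[OF that(2)]] eU[OF that(1)] eU[OF that(2)] gU by (simp add: less_rel_def)
  thus ?thesis using e emb_automorphism[OF gi emb] unfolding ordered_emb_def by simp
qed

theorem Aut_extremely_amenable:
  "extremely_amenable TYPE('y) (Aut (ord_lang I) C) (Aut_topology (ord_lang I) C)"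
proof -
  interpret permutations "univ C" "automorphisms (ord_lang I) C"
    by (rule permutations.intro[OF subgroup_automorphisms[OF struct]])
  interpret ramsey_action "univ C" "automorphisms (ord_lang I) C" u I "ideal_reduct C" "less_rel C" True oemb
  proof (unfold_locales, goal_cases)
    case 1
    show ?case by simp
  next
    case (2 X)
    have fin: "finite (substructure (ord_lang I) C hull X)" using loc_fin 2 by (simp add: locally_finite_def)
    from finite_substructure_oemb[OF hull_substructure(1)[OF struct 2(2)] fin] hull_substructure(2)[OF struct 2(2)]
    show ?case by metis
  next
    case (3 L)
    thus ?case using oemb_exists by simp
  next
    case (4 L e e')
    thus ?case using oemb_homogeneous by simp
  next
    case (5 g L e)
    thus ?case using oemb_automorphism by simp
  qed simp
  show ?thesis unfolding extremely_amenable_def Aut_eq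
  proof (intro allI impI)
    fix Y :: "'y topology" and \<psi>
    assume "flow G (perm_topology (univ C) (automorphisms (ord_lang I) C)) Y \<psi>"
    from fixed_point[OF this TrueI] show "\<exists>y\<in>topspace Y. \<forall>g\<in>carrier G. \<psi> g y = y" by simp
  qed
qed

end

section \<open>The space of normal orderings\<close>

text \<open>Every word becomes a restricted growth word after renaming its letters in the order of their first
occurrence, the parameters getting the types of these occurrences. The map \<open>s\<close> names the letters \<open>D\<close>
that have been seen already.\<close>

lemma relabel_by_first_occurrence:
  fixes P :: "'l::order list"
  assumes "length w = length P" "inj_on s D" "s ` D = {..<a}" "sorted_wrt (\<le>) P"
  shows "\<exists>Q s'. rgw a Q P (map s' w) \<and> (\<forall>x\<in>D. s' x = s x) \<and> inj_on s' (D \<union> set w) \<and>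
    s' ` (D \<union> set w) = {..<a + length Q} \<and> sorted_wrt (\<le>) Q"
  using assms
proof (induction w P arbitrary: s D a rule: list_induct2)
  case Nil
  thus ?case by (intro exI[of _ "[]"] exI[of _ s]) (auto intro: rgw.intros)
next
  case (Cons x w p P)
  show ?case
  proof (cases "x \<in> D")
    case True
    from Cons.IH[OF Cons.prems(1,2)] Cons.prems(3) obtain Q s' where *: "rgw a Q P (map s' w)" "\<forall>x\<in>D. s' x = s x"
      "inj_on s' (D \<union> set w)" "s' ` (D \<union> set w) = {..<a + length Q}" "sorted_wrt (\<le>) Q" by auto
    have "s' x < a" using *(2) True Cons.prems(2) by auto
    moreover have "D \<union> set (x # w) = D \<union> set w" using True by auto
    ultimately show ?thesis using * by (intro exI[of _ Q] exI[of _ s']) (auto intro: rgw.old)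
  next
    case False
    have 1: "inj_on (s(x := a)) (insert x D)"
      using Cons.prems(1,2) False by (auto simp: inj_on_def)
    have 2: "(s(x := a)) ` insert x D = {..<Suc a}"
      using Cons.prems(2) False by (auto simp: lessThan_Suc fun_upd_image)
    from Cons.IH[OF 1 2] Cons.prems(3) obtain Q s' where *: "rgw (Suc a) Q P (map s' w)" "\<forall>y\<in>insert x D. s' y = (s(x := a)) y"
      "inj_on s' (insert x D \<union> set w)" "s' ` (insert x D \<union> set w) = {..<Suc a + length Q}" "sorted_wrt (\<le>) Q" by auto
    have eq: "D \<union> set (x # w) = insert x D \<union> set w" by auto
    have "sorted_wrt (\<le>) (p # Q)" using *(5) rgw_labels[OF *(1)] Cons.prems(3) by auto
    moreover have "s' x = a" using *(2) by simp
    moreover have "\<forall>y\<in>D. s' y = s y" using *(2) False by auto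
    moreover have "rgw a (p # Q) (p # P) (map s' (x # w))" using *(1) \<open>s' x = a\<close> by (simp add: rgw.new)
    moreover have "{..<Suc a + length Q} = {..<a + length (p # Q)}" by simp
    ultimately show ?thesis using *(3,4) unfolding eq by (intro exI[of _ "p # Q"] exI[of _ s'] conjI) simp_all
  qed
qed

text \<open>A natural ordering induces a natural ordering on each substructure: the word dual to the inclusion
is renamed by first occurrences, which are the largest atoms below the atoms of the substructure.\<close>

lemma restrict_ordered_emb:
  assumes S: "label_seq u I LS" "ordered_emb I C R LS eS" and L: "label_seq u I L" "emb I C L e"
    and sub: "e ` Pow {..<length L} \<subseteq> eS ` Pow {..<length LS}"
  shows "\<exists>e'. ordered_emb I C R L e' \<and> e' ` Pow {..<length L} = e ` Pow {..<length L}"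
proof -
  have emS: "emb I C LS eS" using S(2) by (simp add: ordered_emb_def)
  obtain w where w: "length w = length LS" "set w \<subseteq> {..<length L}"
    "\<And>X. X \<subseteq> {..<length L} \<Longrightarrow> e X = eS (pull w X)"
    and surj: "\<And>i. i < length L \<Longrightarrow> \<exists>y<length LS. w ! y = i"
    "\<And>i j. i < length L \<Longrightarrow> j \<in> I \<Longrightarrow> j \<in> L ! i \<longleftrightarrow> (\<forall>y<length LS. w ! y = i \<longrightarrow> j \<in> LS ! y)"
    using emb_factor[OF L(2) emS sub] by blast
  have "i \<in> set w" if "i < length L" for i using surj(1)[OF that] w(1) by (metis nth_mem)
  hence setw: "set w = {..<length L}" using w(2) by blast
  obtain Q s where Q: "rgw 0 Q LS (map s w)" and s: "inj_on s {..<length L}" "s ` {..<length L} = {..<length Q}"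
    and srt: "sorted_wrt (\<le>) Q"
    using relabel_by_first_occurrence[OF w(1), of "\<lambda>x. x" "{}" 0] label_seq_sorted[OF S(1)] setw by auto
  have gQ: "label_seq u I Q"
  proof -
    have LS: "LS = {} # tl LS" by (rule label_seq_tl[OF S(1)])
    have "rgw 0 Q ({} # tl LS) (map s w)" using Q LS by simp
    then obtain Q' v where Q': "Q = {} # Q'" "rgw 1 Q' (tl LS) v" by (auto elim: rgw_Cons)
    have "set Q' \<subseteq> set (tl LS)" by (rule rgw_labels[OF Q'(2)])
    moreover have "sorted_wrt (\<le>) Q'" using srt Q'(1) by simp
    moreover have "label_seq u I ({} # tl LS)" using S(1) LS by simp
    ultimately show ?thesis unfolding Q'(1) label_seq_Cons_iff by (simp add: subset_iff) metis
  qed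
  define e' where "e' X = eS (pull (map s w) X)" for X
  have o: "ordered_emb I C R Q e'" unfolding e'_def by (rule ordered_emb_pull[OF Q S(2) label_seq_sorted[OF S(1)]])
  have "pull (map s w) X = pull w {i \<in> {..<length L}. s i \<in> X}" for X
    using w(1,2) nth_letter[OF w(2)] by (auto simp: pull_def)
  hence e': "e' X = e {i \<in> {..<length L}. s i \<in> X}" for X unfolding e'_def by (subst w(3)) auto
  have range: "e' ` Pow {..<length Q} = e ` Pow {..<length L}"
  proof (intro equalityI subsetI)
    fix x assume "x \<in> e ` Pow {..<length L}"
    then obtain X where X: "X \<subseteq> {..<length L}" "x = e X" by blast
    have "{i \<in> {..<length L}. s i \<in> s ` X} = X" using inj_on_image_mem_iff[OF s(1) _ X(1)] X(1) by auto
    hence "x = e' (s ` X)" using e' X(2) by simp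
    moreover have "s ` X \<subseteq> {..<length Q}" using X(1) s(2) by blast
    ultimately show "x \<in> e' ` Pow {..<length Q}" by blast
  qed (auto simp: e')
  have "Q = L" using emb_label_unique[OF _ L(2) range gQ L(1)] o by (simp add: ordered_emb_def)
  thus ?thesis using o range by blast
qed

lemma natural_ordering_emb:
  assumes L: "label_seq u I L" "emb I C L e" and S: "S = e ` Pow {..<length L}"
  shows "natural_ordering I (induced C S) (R \<inter> S \<times> S) \<longleftrightarrow> (\<exists>e'. ordered_emb I C R L e' \<and> e' ` Pow {..<length L} = S)"
proof -
  have SU: "S \<subseteq> univ C" using emb_struct(1)[OF L(2)] S by auto
  have iso: "struct_iso (ideal_lang I) (pow_alg L) (induced C S) e" using L(2) S iso_induced[OF SU] by blast
  have U: "univ (induced C S) = S" by (simp add: induced_def)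
  have "natural_ordering I (induced C S) (R \<inter> S \<times> S) \<longleftrightarrow> (\<exists>L' e'. label_seq u I L' \<and> emb I C L' e' \<and> e' ` Pow {..<length L'} = S \<and>
       (\<forall>X\<in>Pow {..<length L'}. \<forall>Y\<in>Pow {..<length L'}. (e' X, e' Y) \<in> R \<inter> S \<times> S \<longleftrightarrow> lexless X Y))"
    unfolding iso_natural_ordering[OF iso L(1)] U iso_induced[OF SU] by simp
  also have "\<dots> \<longleftrightarrow> (\<exists>L' e'. label_seq u I L' \<and> ordered_emb I C R L' e' \<and> e' ` Pow {..<length L'} = S)"
  proof -
    have "emb I C L' e' \<and> e' ` Pow {..<length L'} = S \<and>
       (\<forall>X\<in>Pow {..<length L'}. \<forall>Y\<in>Pow {..<length L'}. (e' X, e' Y) \<in> R \<inter> S \<times> S \<longleftrightarrow> lexless X Y) \<longleftrightarrow>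
       ordered_emb I C R L' e' \<and> e' ` Pow {..<length L'} = S" for L' e'
      unfolding ordered_emb_def by auto
    thus ?thesis by simp
  qed
  also have "\<dots> \<longleftrightarrow> (\<exists>e'. ordered_emb I C R L e' \<and> e' ` Pow {..<length L} = S)"
  proof -
    have "L' = L" if "label_seq u I L'" "ordered_emb I C R L' e'" "e' ` Pow {..<length L'} = S" for L' e'
      using emb_label_unique[OF _ L(2) _ that(1) L(1), of e'] that S by (simp add: ordered_emb_def)
    thus ?thesis using L(1) by blast
  qed
  finally show ?thesis .
qed

lemma natural_linear: "natural_ordering I M R \<Longrightarrow> linear_ordering (univ M) R"
  by (simp add: natural_ordering_def)

lemma pullback_homeomorphic:
  assumes "inj_on f A" "f ` A \<subseteq> topspace T"
  shows "pullback_topology A f T homeomorphic_space subtopology T (f ` A)"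
proof -
  have top: "topspace (pullback_topology A f T) = A" using assms(2) by (auto simp: topspace_pullback_topology)
  have "homeomorphic_map (pullback_topology A f T) (subtopology T (f ` A)) f"
  proof (rule bijective_open_imp_homeomorphic_map)
    have "continuous_map (pullback_topology A f T) T (id \<circ> f)" by (rule continuous_map_pullback) simp
    thus "continuous_map (pullback_topology A f T) (subtopology T (f ` A)) f"
      using top by (simp add: continuous_map_in_subtopology)
    show "open_map (pullback_topology A f T) (subtopology T (f ` A)) f"
      unfolding open_map_def openin_pullback_topology openin_subtopology by blast
    show "f ` topspace (pullback_topology A f T) = topspace (subtopology T (f ` A))"
      using top assms(2) by auto
    show "inj_on f (topspace (pullback_topology A f T))" using top assms(1) by simp
  qed
  thus ?thesis by (rule homeomorphic_map_imp_homeomorphic_space)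
qed

text \<open>The complement is defined by the negated condition, and it is open because a basic open set of the
power of a discrete space may prescribe the finitely many coordinates in \<open>D\<close>.\<close>

lemma closedin_finitely_determined:
  assumes D: "finite D" "D \<subseteq> K"
    and det: "\<And>f g. f \<in> PiE K (\<lambda>_. B) \<Longrightarrow> g \<in> PiE K (\<lambda>_. B) \<Longrightarrow> (\<And>k. k \<in> D \<Longrightarrow> f k = g k) \<Longrightarrow> Q f \<Longrightarrow> Q g"
  shows "closedin (product_topology (\<lambda>_. discrete_topology B) K) {f \<in> PiE K (\<lambda>_. B). Q f}"
proof -
  have "openin (product_topology (\<lambda>_. discrete_topology B) K) {f \<in> PiE K (\<lambda>_. B). \<not> Q f}"
    unfolding openin_product_topology_alt
  proof
    fix f assume f: "f \<in> {f \<in> PiE K (\<lambda>_. B). \<not> Q f}"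
    let ?V = "\<lambda>k. if k \<in> D then {f k} else B"
    have fB: "f k \<in> B" if "k \<in> K" for k using f that by auto
    show "\<exists>U. finite {i \<in> K. U i \<noteq> topspace (discrete_topology B)} \<and> (\<forall>i\<in>K. openin (discrete_topology B) (U i)) \<and>
       f \<in> Pi\<^sub>E K U \<and> Pi\<^sub>E K U \<subseteq> {f \<in> PiE K (\<lambda>_. B). \<not> Q f}"
    proof (intro exI[of _ ?V] conjI)
      show "finite {i \<in> K. ?V i \<noteq> topspace (discrete_topology B)}"
        by (rule finite_subset[OF _ D(1)]) auto
      show "\<forall>i\<in>K. openin (discrete_topology B) (?V i)" using fB by auto
      show "f \<in> Pi\<^sub>E K ?V" using f by (auto simp: PiE_iff)
      show "Pi\<^sub>E K ?V \<subseteq> {f \<in> PiE K (\<lambda>_. B). \<not> Q f}"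
      proof
        fix g assume g: "g \<in> Pi\<^sub>E K ?V"
        have gB: "g \<in> PiE K (\<lambda>_. B)"
        proof (rule PiE_I)
          fix k assume "k \<in> K"
          thus "g k \<in> B" using PiE_mem[OF g, of k] fB by (auto split: if_splits)
        qed (use g in \<open>auto simp: PiE_def extensional_def\<close>)
        moreover have "g k = f k" if "k \<in> D" for k using PiE_mem[OF g, of k] that D(2) by auto
        ultimately show "g \<in> {f \<in> PiE K (\<lambda>_. B). \<not> Q f}" using f det[of g f] by auto
      qed
    qed
  qed
  moreover have "PiE K (\<lambda>_. B) - {f \<in> PiE K (\<lambda>_. B). Q f} = {f \<in> PiE K (\<lambda>_. B). \<not> Q f}" by auto
  ultimately show ?thesis by (simp add: closedin_def)
qed

context ideal_limit
begin

abbreviation "U \<equiv> univ C"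
abbreviation "A \<equiv> automorphisms (ideal_lang I) C"
abbreviation "NO \<equiv> normal_orderings I C"

text \<open>The identification of an ordering with a point of the cube.\<close>

definition char_fun :: "('a \<times> 'a) set \<Rightarrow> 'a \<times> 'a \<Rightarrow> bool" where "char_fun R = (\<lambda>p\<in>U \<times> U. p \<in> R)"

abbreviation "cube \<equiv> product_topology (\<lambda>_. discrete_topology (UNIV :: bool set)) (U \<times> U)"

lemma normal_topology_eq: "normal_topology I C = pullback_topology NO char_fun cube"
  unfolding normal_topology_def char_fun_def ..

lemma NO_linear: "R \<in> NO \<Longrightarrow> linear_ordering U R" and NO_subset: "R \<in> NO \<Longrightarrow> R \<subseteq> U \<times> U"
  by (auto simp: normal_orderings_def linear_ordering_def)

text \<open>By uniqueness of label sequences, an ordering of the limit is normal iff each copy of a standard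
structure can be reparametrised so as to become ordered.\<close>

lemma NO_iff: "R \<in> NO \<longleftrightarrow> linear_ordering U R \<and>
   (\<forall>L e. label_seq u I L \<longrightarrow> emb I C L e \<longrightarrow> (\<exists>e'. ordered_emb I C R L e' \<and> e' ` Pow {..<length L} = e ` Pow {..<length L}))"
  (is "_ \<longleftrightarrow> _ \<and> ?Q")
proof -
  have "(\<forall>S. substructure (ideal_lang I) C S \<and> finite S \<longrightarrow> natural_ordering I (induced C S) (R \<inter> S \<times> S)) \<longleftrightarrow> ?Q"
  proof (intro iffI allI impI)
    fix L e assume *: "\<forall>S. substructure (ideal_lang I) C S \<and> finite S \<longrightarrow> natural_ordering I (induced C S) (R \<inter> S \<times> S)"
      and L: "label_seq u I L" "emb I C L e"
    have "substructure (ideal_lang I) C (e ` Pow {..<length L})" "finite (e ` Pow {..<length L})"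
      using emb_substructure[OF L(2)] by auto
    with * have "natural_ordering I (induced C (e ` Pow {..<length L})) (R \<inter> (e ` Pow {..<length L}) \<times> (e ` Pow {..<length L}))" by blast
    thus "\<exists>e'. ordered_emb I C R L e' \<and> e' ` Pow {..<length L} = e ` Pow {..<length L}"
      unfolding natural_ordering_emb[OF L refl] .
  next
    fix S assume *: ?Q and S: "substructure (ideal_lang I) C S \<and> finite S"
    obtain L e where L: "label_seq u I L" "emb I C L e" "e ` Pow {..<length L} = S"
      using finite_substructure_emb S by blast
    show "natural_ordering I (induced C S) (R \<inter> S \<times> S)"
      unfolding natural_ordering_emb[OF L(1,2) L(3)[symmetric]] using * L by blast
  qed
  thus ?thesis unfolding normal_orderings_def by blast
qed

lemma NO_cover:
  assumes "R \<in> NO" "finite X" "X \<subseteq> U"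
  shows "\<exists>L e. label_seq u I L \<and> ordered_emb I C R L e \<and> X \<subseteq> e ` Pow {..<length L}"
proof -
  obtain S where S: "substructure (ideal_lang I) C S" "finite S" "X \<subseteq> S" by (rule finite_in_substructure[OF assms(2,3)])
  obtain L e where L: "label_seq u I L" "emb I C L e" "e ` Pow {..<length L} = S" by (rule finite_substructure_emb[OF S(1,2)])
  obtain e' where "ordered_emb I C R L e'" "e' ` Pow {..<length L} = S"
    using assms(1) L unfolding NO_iff by blast
  thus ?thesis using L(1) S(3) by blast
qed

lemma char_fun_inj: "inj_on char_fun NO"
proof (rule inj_onI)
  fix R R' assume R: "R \<in> NO" "R' \<in> NO" "char_fun R = char_fun R'"
  have "p \<in> R \<longleftrightarrow> p \<in> R'" if "p \<in> U \<times> U" for p using fun_cong[OF R(3), of p] that by (simp add: char_fun_def)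
  thus "R = R'" using NO_subset[OF R(1)] NO_subset[OF R(2)] by blast
qed

lemma char_fun_cube: "char_fun R \<in> topspace cube"
  by (simp add: char_fun_def)

lemma topspace_normal: "topspace (normal_topology I C) = NO"
  unfolding normal_topology_eq topspace_pullback_topology using char_fun_cube by auto

definition local_set :: "'a set \<Rightarrow> ('a \<times> 'a \<Rightarrow> bool) set" where
  "local_set S = {f \<in> PiE (U \<times> U) (\<lambda>_. UNIV). natural_ordering I (induced C S) ({p. f p} \<inter> S \<times> S)}"

lemma closed_local_set:
  assumes "finite S" "S \<subseteq> U" shows "closedin cube (local_set S)"
  unfolding local_set_def
proof (rule closedin_finitely_determined[of "S \<times> S"])
  fix f g :: "'a \<times> 'a \<Rightarrow> bool"
  assume "\<And>k. k \<in> S \<times> S \<Longrightarrow> f k = g k" and n: "natural_ordering I (induced C S) ({p. f p} \<inter> S \<times> S)"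
  hence "{p. f p} \<inter> S \<times> S = {p. g p} \<inter> S \<times> S" by blast
  thus "natural_ordering I (induced C S) ({p. g p} \<inter> S \<times> S)" using n by simp
qed (use assms in auto)

text \<open>Being a normal ordering is a condition on finite substructures only; linearity follows, since any
three points lie in one of them.\<close>

lemma char_fun_image: "char_fun ` NO = topspace cube \<inter> \<Inter> (local_set ` {S. substructure (ideal_lang I) C S \<and> finite S})"
proof (intro equalityI subsetI)
  fix f assume "f \<in> char_fun ` NO"
  then obtain R where R: "R \<in> NO" "f = char_fun R" by blast
  have "{p. char_fun R p} \<inter> S \<times> S = R \<inter> S \<times> S" if "S \<subseteq> U" for S using that by (auto simp: char_fun_def)
  hence "f \<in> local_set S" if "substructure (ideal_lang I) C S" "finite S" for S
    using R that char_fun_cube[of R] by (simp add: local_set_def normal_orderings_def substructure_def)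
  thus "f \<in> topspace cube \<inter> \<Inter> (local_set ` {S. substructure (ideal_lang I) C S \<and> finite S})"
    using char_fun_cube R(2) by auto
next
  fix f assume f: "f \<in> topspace cube \<inter> \<Inter> (local_set ` {S. substructure (ideal_lang I) C S \<and> finite S})"
  define R where "R = {p \<in> U \<times> U. f p}"
  have nat: "natural_ordering I (induced C S) (R \<inter> S \<times> S)" if S: "substructure (ideal_lang I) C S" "finite S" for S
  proof -
    have "S \<subseteq> U" using S by (simp add: substructure_def)
    hence "{p. f p} \<inter> S \<times> S = R \<inter> S \<times> S" by (auto simp: R_def)
    moreover have "f \<in> local_set S" using f S by blast
    ultimately show ?thesis by (simp add: local_set_def)
  qed
  have lin: "\<exists>S. linear_ordering S (R \<inter> S \<times> S) \<and> {x, y, z} \<subseteq> S" if xyz: "x \<in> U" "y \<in> U" "z \<in> U" for x y z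
  proof -
    obtain S where S: "substructure (ideal_lang I) C S" "finite S" "{x, y, z} \<subseteq> S"
      by (rule finite_in_substructure[of "{x, y, z}"]) (use xyz in auto)
    show ?thesis using natural_linear[OF nat[OF S(1,2)]] S(3) by (auto simp: induced_def)
  qed
  have "linear_ordering U R" unfolding linear_ordering_def strict_linear_order_on_def
  proof (intro conjI)
    show "R \<subseteq> U \<times> U" by (auto simp: R_def)
    show "trans R"
    proof (rule transI)
      fix x y z assume xy: "(x, y) \<in> R" "(y, z) \<in> R"
      then obtain S where S: "linear_ordering S (R \<inter> S \<times> S)" "{x, y, z} \<subseteq> S" using lin[of x y z] by (auto simp: R_def)
      hence "trans (R \<inter> S \<times> S)" by (simp add: linear_ordering_def strict_linear_order_on_def)
      from transD[OF this, of x y z] show "(x, z) \<in> R" using xy S(2) by simp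
    qed
    show "irrefl R"
    proof (rule irreflI, rule notI)
      fix x assume x: "(x, x) \<in> R"
      then obtain S where S: "linear_ordering S (R \<inter> S \<times> S)" "{x, x, x} \<subseteq> S" using lin[of x x x] by (auto simp: R_def)
      thus False using x by (auto simp: linear_ordering_def strict_linear_order_on_def irrefl_def)
    qed
    show "total_on U R"
    proof (rule total_onI)
      fix x y assume xy: "x \<in> U" "y \<in> U" "x \<noteq> y"
      then obtain S where S: "linear_ordering S (R \<inter> S \<times> S)" "{x, y, y} \<subseteq> S" using lin[of x y y] by auto
      thus "(x, y) \<in> R \<or> (y, x) \<in> R" using xy by (auto simp: linear_ordering_def strict_linear_order_on_def total_on_def)
    qed
  qed
  hence "R \<in> NO" using nat by (simp add: normal_orderings_def)
  moreover have "f = char_fun R"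
  proof
    fix p
    have "f \<in> PiE (U \<times> U) (\<lambda>_. UNIV)" using f by simp
    hence "p \<notin> U \<times> U \<Longrightarrow> f p = undefined" by (rule PiE_arb)
    thus "f p = char_fun R p" by (cases "p \<in> U \<times> U") (auto simp: char_fun_def R_def)
  qed
  ultimately show "f \<in> char_fun ` NO" by blast
qed

lemma char_fun_closed: "closedin cube (char_fun ` NO)"
proof -
  have "closedin cube (\<Inter> (insert (topspace cube) (local_set ` {S. substructure (ideal_lang I) C S \<and> finite S})))"
  proof (rule closedin_Inter)
    fix W assume "W \<in> insert (topspace cube) (local_set ` {S. substructure (ideal_lang I) C S \<and> finite S})"
    thus "closedin cube W" using closed_local_set closedin_topspace[of cube]
      by (auto simp: substructure_def simp del: topspace_product_topology)
  qed simp
  thus ?thesis unfolding char_fun_image by simp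
qed

lemma cube_compact: "compact_space cube" and cube_Hausdorff: "Hausdorff_space cube"
  by (simp_all add: compact_space_product_topology Hausdorff_space_product_topology compact_space_discrete_topology)

lemma normal_compact: "compact_space (normal_topology I C)" and normal_Hausdorff: "Hausdorff_space (normal_topology I C)"
proof -
  have h: "normal_topology I C homeomorphic_space subtopology cube (char_fun ` NO)"
    unfolding normal_topology_eq using char_fun_inj char_fun_cube by (intro pullback_homeomorphic) auto
  have "compactin cube (char_fun ` NO)" by (rule closedin_compact_space[OF cube_compact char_fun_closed])
  thus "compact_space (normal_topology I C)"
    using homeomorphic_compact_space[OF h] by (simp add: compact_space_subtopology)
  show "Hausdorff_space (normal_topology I C)"
    using homeomorphic_Hausdorff_space[OF h] Hausdorff_space_subtopology[OF cube_Hausdorff] by simp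
qed

text \<open>Compactness of the cube: for finitely many finite substructures, a natural ordering of a larger
finite substructure meets all conditions.\<close>

lemma NO_nonempty: "NO \<noteq> {}"
proof -
  let ?Sub = "{S. substructure (ideal_lang I) C S \<and> finite S}"
  have finite_case: "topspace cube \<inter> \<Inter> (local_set ` F) \<noteq> {}" if F: "F \<subseteq> ?Sub" "finite F" for F
  proof -
    have "finite (\<Union>F)" "\<Union>F \<subseteq> U" using F by (auto simp: substructure_def)
    then obtain T where T: "substructure (ideal_lang I) C T" "finite T" "\<Union>F \<subseteq> T" by (rule finite_in_substructure)
    obtain LT eT where LT: "label_seq u I LT" "emb I C LT eT" "eT ` Pow {..<length LT} = T" by (rule finite_substructure_emb[OF T(1,2)])
    define R where "R = {(eT X, eT Y) | X Y. X \<subseteq> {..<length LT} \<and> Y \<subseteq> {..<length LT} \<and> lexless X Y}"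
    have "(eT X, eT Y) \<in> R \<longleftrightarrow> lexless X Y" if XY: "X \<subseteq> {..<length LT}" "Y \<subseteq> {..<length LT}" for X Y
    proof -
      have "eT X = eT X' \<and> eT Y = eT Y' \<longleftrightarrow> X = X' \<and> Y = Y'" if "X' \<subseteq> {..<length LT}" "Y' \<subseteq> {..<length LT}" for X' Y'
        using emb_struct(8)[OF LT(2)] XY that by simp
      thus ?thesis using XY unfolding R_def by auto
    qed
    hence o: "ordered_emb I C R LT eT" using LT(2) by (simp add: ordered_emb_def)
    have "char_fun R \<in> local_set S" if "S \<in> F" for S
    proof -
      have S: "substructure (ideal_lang I) C S" "finite S" "S \<subseteq> T" "S \<subseteq> U" using F that T(3) by (auto simp: substructure_def)
      obtain L e where L: "label_seq u I L" "emb I C L e" "e ` Pow {..<length L} = S" by (rule finite_substructure_emb[OF S(1,2)])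
      have "\<exists>e'. ordered_emb I C R L e' \<and> e' ` Pow {..<length L} = e ` Pow {..<length L}"
        by (rule restrict_ordered_emb[OF LT(1) o L(1,2)]) (use L(3) LT(3) S(3) in simp)
      hence "natural_ordering I (induced C S) (R \<inter> S \<times> S)"
        unfolding natural_ordering_emb[OF L(1,2) L(3)[symmetric]] using L(3) by simp
      moreover have "{p. char_fun R p} \<inter> S \<times> S = R \<inter> S \<times> S" using S(4) by (auto simp: char_fun_def)
      ultimately show ?thesis using char_fun_cube[of R] by (simp add: local_set_def)
    qed
    thus ?thesis using char_fun_cube[of R] by blast
  qed
  have "\<Inter> (insert (topspace cube) (local_set ` ?Sub)) \<noteq> {}"
  proof (rule compact_space_fip[THEN iffD1, OF cube_compact, rule_format], intro conjI ballI allI impI)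
    fix W assume "W \<in> insert (topspace cube) (local_set ` ?Sub)"
    thus "closedin cube W" using closed_local_set closedin_topspace[of cube]
      by (auto simp: substructure_def simp del: topspace_product_topology)
  next
    fix \<F> assume Fi: "finite \<F> \<and> \<F> \<subseteq> insert (topspace cube) (local_set ` ?Sub)"
    hence "finite (\<F> - {topspace cube})" "\<F> - {topspace cube} \<subseteq> local_set ` ?Sub" by blast+
    from finite_subset_image[OF this]
    obtain F where F: "F \<subseteq> ?Sub" "finite F" "\<F> - {topspace cube} = local_set ` F"
      by (elim exE conjE)
    have "topspace cube \<inter> \<Inter> (local_set ` F) \<noteq> {}" by (rule finite_case[OF F(1,2)])
    moreover have "topspace cube \<inter> \<Inter> (local_set ` F) \<subseteq> \<Inter>\<F>" using F(3) by blast
    ultimately show "\<Inter>\<F> \<noteq> {}" by blast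
  qed
  thus ?thesis using char_fun_image by auto
qed

end

section \<open>The flow of normal orderings\<close>

sublocale ideal_limit \<subseteq> permutations "univ C" "automorphisms (ideal_lang I) C"
  by (rule permutations.intro[OF subgroup_automorphisms[OF struct]])

context ideal_limit
begin

abbreviation "T \<equiv> perm_topology U A"
abbreviation "X \<equiv> normal_topology I C"

text \<open>The action on arbitrary relations, without the restriction to normal orderings.\<close>

definition act :: "('a \<Rightarrow> 'a) \<Rightarrow> ('a \<times> 'a) set \<Rightarrow> ('a \<times> 'a) set" where
  "act g R = {(a, b). a \<in> U \<and> b \<in> U \<and> ((inv\<^bsub>G\<^esub> g) a, (inv\<^bsub>G\<^esub> g) b) \<in> R}"

lemma emb_translate: "g \<in> A \<Longrightarrow> emb I C L e \<Longrightarrow> emb I C L (\<lambda>X. g (e X))"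
  by (rule emb_automorphism) (auto simp: automorphisms_def)

lemma normal_action_eq:
  assumes g: "g \<in> A" shows "normal_action I C g = (\<lambda>R\<in>NO. act g R)"
proof -
  have "inv_into U g a = (inv\<^bsub>G\<^esub> g) a" if "a \<in> U" for a
  proof (rule inv_into_f_eq)
    show "inj_on g U" using A_Bij[OF g] by (simp add: Bij_def bij_betw_def)
    show "(inv\<^bsub>G\<^esub> g) a \<in> U" by (rule A_mem[OF inv_mem[OF g] that])
    show "g ((inv\<^bsub>G\<^esub> g) a) = a" by (rule inv_apply(2)[OF g that])
  qed
  thus ?thesis unfolding normal_action_def act_def by (intro restrict_ext) auto
qed

lemma act_subset: "act g R \<subseteq> U \<times> U"
  by (auto simp: act_def)

lemma act_iff: "g \<in> A \<Longrightarrow> a \<in> U \<Longrightarrow> b \<in> U \<Longrightarrow> (g a, g b) \<in> act g R \<longleftrightarrow> (a, b) \<in> R"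
  using A_mem[of g] inv_apply(1)[of g] by (simp add: act_def)

lemma ordered_emb_act:
  assumes g: "g \<in> A" and e: "ordered_emb I C R L e"
  shows "ordered_emb I C (act g R) L (\<lambda>X. g (e X))"
proof -
  have "emb I C L e" using e by (simp add: ordered_emb_def)
  thus ?thesis using e emb_translate[OF g] act_iff[OF g] emb_struct(1)[of I C L e] by (simp add: ordered_emb_def)
qed

lemma ordered_emb_act_inv:
  assumes g: "g \<in> A" and e: "ordered_emb I C (act g R) L e"
  shows "ordered_emb I C R L (\<lambda>X. (inv\<^bsub>G\<^esub> g) (e X))"
proof -
  have "emb I C L e" using e by (simp add: ordered_emb_def)
  thus ?thesis using e emb_translate[OF inv_mem[OF g]] emb_struct(1)[of I C L e]
    by (simp add: ordered_emb_def act_def)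
qed

lemma act_NO:
  assumes g: "g \<in> A" and R: "R \<in> NO"
  shows "act g R \<in> NO"
  unfolding NO_iff
proof (intro conjI allI impI)
  let ?i = "inv\<^bsub>G\<^esub> g"
  have lin: "trans R" "irrefl R" "total_on U R"
    using NO_linear[OF R] by (auto simp: linear_ordering_def strict_linear_order_on_def)
  show "linear_ordering U (act g R)"
    unfolding linear_ordering_def strict_linear_order_on_def
  proof (intro conjI act_subset)
    show "trans (act g R)" using lin(1) by (auto simp: act_def trans_def)
    show "irrefl (act g R)" using lin(2) by (auto simp: act_def irrefl_def)
    show "total_on U (act g R)"
    proof (rule total_onI)
      fix x y assume xy: "x \<in> U" "y \<in> U" "x \<noteq> y"
      have "?i x \<noteq> ?i y" using inv_apply(2)[OF g xy(1)] inv_apply(2)[OF g xy(2)] xy(3) by metis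
      thus "(x, y) \<in> act g R \<or> (y, x) \<in> act g R"
        using lin(3) xy A_mem[OF inv_mem[OF g]] by (auto simp: total_on_def act_def)
    qed
  qed
  fix L e assume L: "label_seq u I L" "emb I C L e"
  obtain e' where e': "ordered_emb I C R L e'" "e' ` Pow {..<length L} = (\<lambda>X. ?i (e X)) ` Pow {..<length L}"
    using R emb_translate[OF inv_mem[OF g] L(2)] L(1) unfolding NO_iff by blast
  have "(\<lambda>X. g (e' X)) ` Pow {..<length L} = g ` (\<lambda>X. ?i (e X)) ` Pow {..<length L}"
    unfolding e'(2)[symmetric] by (simp add: image_image)
  also have "\<dots> = e ` Pow {..<length L}"
    unfolding image_image using inv_apply(2)[OF g emb_struct(1)[OF L(2)]] by (intro image_cong) auto
  finally show "\<exists>e'. ordered_emb I C (act g R) L e' \<and> e' ` Pow {..<length L} = e ` Pow {..<length L}"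
    using ordered_emb_act[OF g e'(1)] by blast
qed

lemma act_mult:
  assumes "g \<in> A" "h \<in> A" shows "act (g \<otimes>\<^bsub>G\<^esub> h) R = act g (act h R)"
proof -
  have eq: "inv\<^bsub>G\<^esub> (g \<otimes>\<^bsub>G\<^esub> h) = inv\<^bsub>G\<^esub> h \<otimes>\<^bsub>G\<^esub> inv\<^bsub>G\<^esub> g" by (rule G.inv_mult_group) (use assms in simp_all)
  define k gi hi where "k = inv\<^bsub>G\<^esub> (g \<otimes>\<^bsub>G\<^esub> h)" and "gi = inv\<^bsub>G\<^esub> g" and "hi = inv\<^bsub>G\<^esub> h"
  have k: "k a = hi (gi a)" if "a \<in> U" for a
    unfolding k_def gi_def hi_def eq by (rule mult_apply[OF inv_mem[OF assms(2)] inv_mem[OF assms(1)] that])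
  have mem: "gi a \<in> U" if "a \<in> U" for a unfolding gi_def by (rule A_mem[OF inv_mem[OF assms(1)] that])
  show ?thesis unfolding act_def k_def[symmetric] gi_def[symmetric] hi_def[symmetric]
    by (intro Collect_cong) (auto simp: k mem)
qed

lemma act_one: "R \<subseteq> U \<times> U \<Longrightarrow> act \<one>\<^bsub>G\<^esub> R = R"
proof -
  assume R: "R \<subseteq> U \<times> U"
  define k where "k = inv\<^bsub>G\<^esub> \<one>\<^bsub>G\<^esub>"
  have k: "k a = a" if "a \<in> U" for a unfolding k_def G.inv_one by (rule one_apply[OF that])
  show ?thesis unfolding act_def k_def[symmetric] using R by (auto simp: k)
qed

lemma act_inverse: "g \<in> A \<Longrightarrow> R \<subseteq> U \<times> U \<Longrightarrow> act g (act (inv\<^bsub>G\<^esub> g) R) = R" "g \<in> A \<Longrightarrow> R \<subseteq> U \<times> U \<Longrightarrow> act (inv\<^bsub>G\<^esub> g) (act g R) = R"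
proof -
  assume g: "g \<in> A" and R: "R \<subseteq> U \<times> U"
  have r: "g \<otimes>\<^bsub>G\<^esub> inv\<^bsub>G\<^esub> g = \<one>\<^bsub>G\<^esub>" by (rule G.r_inv) (use g in simp)
  have l: "inv\<^bsub>G\<^esub> g \<otimes>\<^bsub>G\<^esub> g = \<one>\<^bsub>G\<^esub>" by (rule G.l_inv) (use g in simp)
  show "act g (act (inv\<^bsub>G\<^esub> g) R) = R" unfolding act_mult[OF g inv_mem[OF g], symmetric] r by (rule act_one[OF R])
  show "act (inv\<^bsub>G\<^esub> g) (act g R) = R" unfolding act_mult[OF inv_mem[OF g] g, symmetric] l by (rule act_one[OF R])
qed

lemma normal_group_action: "group_action G NO (normal_action I C)"
proof -
  have Bij: "normal_action I C g \<in> Bij NO" if g: "g \<in> A" for g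
  proof -
    have "bij_betw (\<lambda>R\<in>NO. act g R) NO NO"
    proof (rule bij_betw_byWitness[where f' = "act (inv\<^bsub>G\<^esub> g)"])
      show "\<forall>R\<in>NO. act (inv\<^bsub>G\<^esub> g) ((\<lambda>R\<in>NO. act g R) R) = R" using act_inverse(2)[OF g] NO_subset by simp
      show "\<forall>R\<in>NO. (\<lambda>R\<in>NO. act g R) (act (inv\<^bsub>G\<^esub> g) R) = R"
        using act_inverse(1)[OF g] NO_subset act_NO[OF inv_mem[OF g]] by simp
      show "(\<lambda>R\<in>NO. act g R) ` NO \<subseteq> NO" using act_NO[OF g] by auto
      show "act (inv\<^bsub>G\<^esub> g) ` NO \<subseteq> NO" using act_NO[OF inv_mem[OF g]] by auto
    qed
    thus ?thesis unfolding Bij_def normal_action_eq[OF g] by simp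
  qed
  have "normal_action I C \<in> hom G (BijGroup NO)"
  proof (rule homI)
    fix g assume "g \<in> carrier G"
    thus "normal_action I C g \<in> carrier (BijGroup NO)" using Bij by (simp add: BijGroup_def)
  next
    fix g h assume "g \<in> carrier G" "h \<in> carrier G"
    hence gh: "g \<in> A" "h \<in> A" by auto
    have "normal_action I C (g \<otimes>\<^bsub>G\<^esub> h) = compose NO (normal_action I C g) (normal_action I C h)"
      unfolding normal_action_eq[OF gh(1)] normal_action_eq[OF gh(2)] normal_action_eq[OF mult_mem[OF gh]]
        act_mult[OF gh] compose_def
      using act_NO[OF gh(2)] by (auto intro!: restrict_ext)
    moreover have "normal_action I C g \<otimes>\<^bsub>BijGroup NO\<^esub> normal_action I C h = compose NO (normal_action I C g) (normal_action I C h)"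
      unfolding BijGroup_def using Bij[OF gh(1)] Bij[OF gh(2)] by simp
    ultimately show "normal_action I C (g \<otimes>\<^bsub>G\<^esub> h) = normal_action I C g \<otimes>\<^bsub>BijGroup NO\<^esub> normal_action I C h" by metis
  qed
  thus ?thesis
    unfolding group_action_def by (intro group_hom.intro group_hom_axioms.intro G.is_group group_BijGroup)
qed

lemma openin_membership: assumes "p \<in> U \<times> U" shows "openin X {R \<in> NO. (p \<in> R) = v}"
proof -
  have "openin cube {f \<in> topspace cube. f p \<in> {v}}"
    by (rule openin_continuous_map_preimage[OF continuous_map_product_projection[OF assms]]) simp
  moreover have "{R \<in> NO. (p \<in> R) = v} = char_fun -` {f \<in> topspace cube. f p \<in> {v}} \<inter> NO"
    using assms char_fun_cube by (auto simp: char_fun_def simp del: topspace_product_topology)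
  ultimately show ?thesis unfolding normal_topology_eq openin_pullback_topology by blast
qed

lemma openin_agreement:
  assumes "finite D" "D \<subseteq> U \<times> U"
  shows "openin X {R' \<in> NO. \<forall>p\<in>D. p \<in> R' \<longleftrightarrow> p \<in> R}"
proof -
  have "openin X (topspace X \<inter> \<Inter> ((\<lambda>p. {R' \<in> NO. (p \<in> R') = (p \<in> R)}) ` D))"
    by (rule openin_Int_Inter) (use assms openin_membership in auto)
  moreover have "topspace X \<inter> \<Inter> ((\<lambda>p. {R' \<in> NO. (p \<in> R') = (p \<in> R)}) ` D) = {R' \<in> NO. \<forall>p\<in>D. p \<in> R' \<longleftrightarrow> p \<in> R}"
    unfolding topspace_normal by auto
  ultimately show ?thesis by metis
qed

lemma agreement_neighbourhood:
  assumes "openin X W" "R \<in> W"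
  obtains D where "finite D" "D \<subseteq> U \<times> U" "\<And>R'. R' \<in> NO \<Longrightarrow> (\<And>p. p \<in> D \<Longrightarrow> p \<in> R' \<longleftrightarrow> p \<in> R) \<Longrightarrow> R' \<in> W"
proof -
  obtain V where V: "openin cube V" "W = char_fun -` V \<inter> NO"
    using assms(1) unfolding normal_topology_eq openin_pullback_topology by blast
  hence RV: "char_fun R \<in> V" using assms(2) by blast
  from V(1)[unfolded openin_product_topology_alt] RV obtain N where
    N: "finite {p \<in> U \<times> U. N p \<noteq> (UNIV :: bool set)}" "char_fun R \<in> Pi\<^sub>E (U \<times> U) N" "Pi\<^sub>E (U \<times> U) N \<subseteq> V"
    by (simp only: topspace_discrete_topology) blast
  show thesis
  proof (rule that[OF N(1)])
    fix R' assume R': "R' \<in> NO" "\<And>p. p \<in> {p \<in> U \<times> U. N p \<noteq> UNIV} \<Longrightarrow> p \<in> R' \<longleftrightarrow> p \<in> R"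
    have "char_fun R' \<in> Pi\<^sub>E (U \<times> U) N"
    proof (rule PiE_I)
      fix p assume p: "p \<in> U \<times> U"
      show "char_fun R' p \<in> N p"
      proof (cases "N p = UNIV")
        case False
        hence "char_fun R' p = char_fun R p" using R'(2)[of p] p by (simp add: char_fun_def)
        thus ?thesis using PiE_mem[OF N(2) p] by simp
      qed simp
    qed (simp add: char_fun_def)
    thus "R' \<in> W" using N(3) V(2) R'(1) by blast
  qed auto
qed

text \<open>For fixed \<open>a\<close>, \<open>b\<close>, whether \<open>(a, b)\<close> lies in the translate of \<open>R\<close> by \<open>g\<close> depends only on the points that
\<open>g\<close> maps to \<open>a\<close> and \<open>b\<close>, and on a single coordinate of \<open>R\<close>.\<close>

lemma normal_continuous: "continuous_map (prod_topology T X) X (\<lambda>(g, R). normal_action I C g R)"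
proof -
  let ?P = "prod_topology T X" and ?f = "\<lambda>(g, R). normal_action I C g R"
  have top: "topspace ?P = A \<times> NO" unfolding topspace_prod_topology A_topspace topspace_normal ..
  have f: "?f p = act (fst p) (snd p)" if "p \<in> A \<times> NO" for p
    using that normal_action_eq by (auto simp: case_prod_unfold)
  have comp: "continuous_map ?P (discrete_topology (UNIV :: bool set)) (\<lambda>q. char_fun (?f q) p)" if p: "p \<in> U \<times> U" for p
  proof -
    obtain a b where ab: "p = (a, b)" "a \<in> U" "b \<in> U" using p by blast
    have op: "openin ?P {q \<in> topspace ?P. char_fun (?f q) p = v}" for v
    proof -
      let ?B = "\<lambda>a' b'. {g \<in> A. g a' = a} \<inter> {g \<in> A. g b' = b}"
      have "{q \<in> topspace ?P. char_fun (?f q) p = v} = (\<Union>a'\<in>U. \<Union>b'\<in>U. ?B a' b' \<times> {R \<in> NO. ((a', b') \<in> R) = v})" (is "?l = ?r")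
      proof (intro equalityI subsetI)
        fix q assume q: "q \<in> ?l"
        then obtain g R where gR: "q = (g, R)" "g \<in> A" "R \<in> NO" unfolding top by blast
        define a' b' where "a' = (inv\<^bsub>G\<^esub> g) a" and "b' = (inv\<^bsub>G\<^esub> g) b"
        have U': "a' \<in> U" "b' \<in> U" unfolding a'_def b'_def using A_mem[OF inv_mem[OF gR(2)]] ab by auto
        have "g a' = a" "g b' = b" unfolding a'_def b'_def using inv_apply(2)[OF gR(2)] ab by auto
        moreover have "((a', b') \<in> R) = v"
          using q gR f[of q] ab by (simp add: char_fun_def act_def a'_def b'_def)
        ultimately show "q \<in> ?r" using gR U' by blast
      next
        fix q assume "q \<in> ?r"
        then obtain a' b' g R where *: "a' \<in> U" "b' \<in> U" "q = (g, R)" "g \<in> A" "g a' = a" "g b' = b" "R \<in> NO" "((a', b') \<in> R) = v"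
          by blast
        have "(p \<in> act g R) = v" using act_iff[OF *(4,1,2), of R] * ab by simp
        thus "q \<in> ?l" using * f[of q] p unfolding top by (simp add: char_fun_def)
      qed
      moreover have "openin ?P ?r"
        by (intro openin_Union ballI) (auto intro!: openin_prod_Times_iff[THEN iffD2] openin_Int evaluation_open openin_membership)
      ultimately show ?thesis by simp
    qed
    show ?thesis unfolding continuous_map_def
    proof (intro conjI allI impI)
      fix V :: "bool set" assume "openin (discrete_topology UNIV) V"
      have "{q \<in> topspace ?P. char_fun (?f q) p \<in> V} = (\<Union>v\<in>V. {q \<in> topspace ?P. char_fun (?f q) p = v})" by auto
      moreover have "openin ?P (\<Union>v\<in>V. {q \<in> topspace ?P. char_fun (?f q) p = v})" using op by (intro openin_Union) auto
      ultimately show "openin ?P {q \<in> topspace ?P. char_fun (?f q) p \<in> V}" by simp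
    qed simp
  qed
  have "continuous_map ?P cube (char_fun \<circ> ?f)"
    unfolding continuous_map_componentwise using comp by (auto simp: char_fun_def comp_def)
  moreover have "topspace ?P \<subseteq> ?f -` NO" unfolding top using f act_NO by auto
  ultimately show ?thesis unfolding normal_topology_eq by (rule continuous_map_pullback')
qed

lemma normal_flow: "flow G T X (normal_action I C)"
  unfolding flow_def topspace_normal
  using normal_compact normal_Hausdorff NO_nonempty normal_group_action normal_continuous by blast

text \<open>On a finite substructure any two normal orderings are conjugate by an automorphism of that
substructure, which extends to the limit by homogeneity. This is why orbits are dense.\<close>

lemma conjugate_on_finite:
  assumes R: "R \<in> NO" "R' \<in> NO" and D: "finite D" "D \<subseteq> U \<times> U"
  shows "\<exists>g\<in>A. \<forall>p\<in>D. p \<in> act g R \<longleftrightarrow> p \<in> R'"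
proof -
  have "finite (fst ` D \<union> snd ` D)" "fst ` D \<union> snd ` D \<subseteq> U" using D by auto
  then obtain S where S: "substructure (ideal_lang I) C S" "finite S" "fst ` D \<union> snd ` D \<subseteq> S"
    by (rule finite_in_substructure)
  obtain L e where L: "label_seq u I L" "emb I C L e" "e ` Pow {..<length L} = S" by (rule finite_substructure_emb[OF S(1,2)])
  obtain e1 where e1: "ordered_emb I C R L e1" using R(1) L unfolding NO_iff by blast
  obtain e2 where e2: "ordered_emb I C R' L e2" "e2 ` Pow {..<length L} = S" using R(2) L unfolding NO_iff by blast
  have em: "emb I C L e1" "emb I C L e2" using e1 e2 by (auto simp: ordered_emb_def)
  obtain g where g: "g \<in> A" "\<And>X. X \<subseteq> {..<length L} \<Longrightarrow> g (e1 X) = e2 X" using emb_homogeneous[OF em] by blast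
  have "ordered_emb I C (act g R) L e2"
    by (rule ordered_emb_cong[OF ordered_emb_act[OF g(1) e1] g(2)])
  hence "p \<in> act g R \<longleftrightarrow> p \<in> R'" if "p \<in> S \<times> S" for p
    using e2 that unfolding ordered_emb_def by auto
  moreover have "D \<subseteq> S \<times> S" using S(3) by (force simp: subset_iff)
  ultimately show ?thesis using g(1) by blast
qed

lemma normal_minimal: "minimal_flow G T X (normal_action I C)"
  unfolding minimal_flow_def
proof (intro conjI normal_flow allI impI)
  fix F assume F: "closedin X F \<and> F \<noteq> {} \<and> (\<forall>g\<in>carrier G. \<forall>x\<in>F. normal_action I C g x \<in> F)"
  have sub: "F \<subseteq> NO" using F closedin_subset topspace_normal by metis
  obtain R where R: "R \<in> F" using F by blast
  have "R' \<in> F" if R': "R' \<in> NO" for R'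
  proof (rule ccontr)
    assume "R' \<notin> F"
    moreover have "openin X (NO - F)" using F topspace_normal by (metis closedin_def)
    ultimately obtain D where D: "finite D" "D \<subseteq> U \<times> U"
      "\<And>R''. R'' \<in> NO \<Longrightarrow> (\<And>p. p \<in> D \<Longrightarrow> p \<in> R'' \<longleftrightarrow> p \<in> R') \<Longrightarrow> R'' \<in> NO - F"
      using agreement_neighbourhood[of "NO - F" R'] R' by blast
    obtain g where g: "g \<in> A" "\<forall>p\<in>D. p \<in> act g R \<longleftrightarrow> p \<in> R'"
      using conjugate_on_finite[OF _ R' D(1,2), of R] R sub by blast
    have "act g R \<in> NO - F" by (rule D(3)[OF act_NO[OF g(1)]]) (use R sub g(2) in auto)
    moreover have "normal_action I C g R \<in> F" using F g(1) R by simp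
    moreover have "normal_action I C g R = act g R" using normal_action_eq[OF g(1)] R sub by auto
    ultimately show False by simp
  qed
  thus "F = topspace X" using sub topspace_normal by blast
qed

end

section \<open>Universality\<close>

context ideal_limit
begin

lemma normal_ramsey_action:
  assumes R: "R \<in> NO"
  shows "ramsey_action U A u I C R False"
proof (unfold_locales, goal_cases)
  case 1
  show ?case by simp
next
  case (2 X)
  thus ?case using NO_cover[OF R] by simp
next
  case (3 L)
  thus ?case using emb_exists by simp
next
  case (4 L e e')
  thus ?case using emb_homogeneous by simp
next
  case (5 g L e)
  thus ?case using emb_translate by simp
qed

text \<open>The factor map. For a normal ordering \<open>R\<close> and a point \<open>y\<close> from \<open>almost_constant_point\<close>, the closure \<open>K\<close> of
the orbit of \<open>(R, y)\<close> is the graph of a function: if two points lay over the same ordering, then some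
continuous function with values \<open>0\<close> and \<open>1\<close> at them would distinguish translates of \<open>y\<close> by elements that
induce the same order type on a large finite set. Its projections are closed and invariant, hence
everything by minimality of both flows, and a function with closed graph into a compact space is continuous.\<close>

lemma normal_universal:
  fixes Y :: "'y topology"
  assumes min: "minimal_flow G T Y \<psi>"
  shows "flow_factor G X (normal_action I C) Y \<psi>"
proof -
  let ?Z = "prod_topology X Y"
  have flow: "flow G T Y \<psi>" using min by (simp add: minimal_flow_def)
  interpret Y: permutation_flow U A Y \<psi> by unfold_locales (rule flow)
  interpret N: permutation_flow U A X "normal_action I C" by unfold_locales (rule normal_flow)
  obtain R where R: "R \<in> NO" using NO_nonempty by blast
  interpret RA: ramsey_action U A u I C R False "emb I C" by (rule normal_ramsey_action[OF R]) simp
  from RA.almost_constant_point[OF flow] obtain y where y: "y \<in> topspace Y" and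
    close: "\<forall>f. unit_function Y f \<longrightarrow> (\<exists>F. finite F \<and> F \<subseteq> U \<and>
      (\<forall>L e g1 g2. label_seq u I L \<longrightarrow> emb I C L e \<longrightarrow> F \<subseteq> e ` Pow {..<length L} \<longrightarrow> g1 \<in> A \<longrightarrow> g2 \<in> A \<longrightarrow>
         ordered_emb I C R L (\<lambda>X. g1 (e X)) \<longrightarrow> ordered_emb I C R L (\<lambda>X. g2 (e X)) \<longrightarrow>
         \<bar>f (\<psi> (inv\<^bsub>G\<^esub> g1) y) - f (\<psi> (inv\<^bsub>G\<^esub> g2) y)\<bar> \<le> 3/10))" by (elim bexE)
  have actN: "normal_action I C g S = act g S" if "g \<in> A" "S \<in> NO" for g S
    using normal_action_eq[OF that(1)] that(2) by simp
  define orb where "orb = (\<lambda>g. (act g R, \<psi> g y)) ` A"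
  define K where "K = ?Z closure_of orb"
  have top: "topspace ?Z = NO \<times> topspace Y" unfolding topspace_prod_topology topspace_normal ..
  have orb_sub: "orb \<subseteq> topspace ?Z" unfolding orb_def top using act_NO R Y.act_mem[OF _ y] by blast
  have K_closed: "closedin ?Z K" unfolding K_def by simp
  have K_sub: "K \<subseteq> NO \<times> topspace Y" using closedin_subset[OF K_closed] unfolding top .
  have K_nonempty: "K \<noteq> {}" using closure_of_subset[OF orb_sub] one_mem by (auto simp: K_def orb_def)
  have K_inv: "(act g S, \<psi> g z) \<in> K" if g: "g \<in> A" and Sz: "(S, z) \<in> K" for g S z
  proof -
    define m where "m = (\<lambda>p. (normal_action I C g (fst p), \<psi> g (snd p)))"
    have "continuous_map ?Z ?Z m"
      unfolding m_def continuous_map_pairwise comp_def fst_conv snd_conv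
      by (intro conjI continuous_map_compose[OF continuous_map_fst N.act_continuous[OF g], unfolded comp_def]
        continuous_map_compose[OF continuous_map_snd Y.act_continuous[OF g], unfolded comp_def])
    hence "m ` K \<subseteq> ?Z closure_of (m ` orb)" unfolding K_def by (rule continuous_map_image_closure_subset)
    moreover have "m ` orb \<subseteq> orb"
    proof
      fix q assume "q \<in> m ` orb"
      then obtain h where h: "h \<in> A" "q = m (act h R, \<psi> h y)" unfolding orb_def by blast
      have "q = (act (g \<otimes>\<^bsub>G\<^esub> h) R, \<psi> (g \<otimes>\<^bsub>G\<^esub> h) y)"
        unfolding h(2) m_def fst_conv snd_conv actN[OF g act_NO[OF h(1) R]] act_mult[OF g h(1)] Y.act_mult[OF g h(1) y] ..
      thus "q \<in> orb" unfolding orb_def using mult_mem[OF g h(1)] by blast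
    qed
    ultimately have "m ` K \<subseteq> K" unfolding K_def using closure_of_mono by blast
    hence "m (S, z) \<in> K" using Sz by blast
    thus ?thesis using actN[OF g, of S] K_sub Sz by (auto simp: m_def)
  qed
  have fst_K: "fst ` K = NO"
  proof -
    have "closedin X (fst ` K)" using closed_map_fst[OF Y.compact, of X] K_closed by (simp add: closed_map_def)
    moreover have "\<forall>g\<in>carrier G. \<forall>S\<in>fst ` K. normal_action I C g S \<in> fst ` K"
    proof (intro ballI)
      fix g S assume gS: "g \<in> carrier G" "S \<in> fst ` K"
      then obtain z where z: "(S, z) \<in> K" by auto
      have "act g S \<in> fst ` K" using K_inv[OF _ z, of g] gS(1) by force
      moreover have "S \<in> NO" using z K_sub by blast
      ultimately show "normal_action I C g S \<in> fst ` K" using actN[of g S] gS(1) by simp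
    qed
    moreover have "fst ` K \<noteq> {}" using K_nonempty by simp
    ultimately have "fst ` K = topspace X"
      using normal_minimal[unfolded minimal_flow_def, THEN conjunct2, THEN spec, of "fst ` K"] by simp
    thus ?thesis unfolding topspace_normal .
  qed
  have snd_K: "snd ` K = topspace Y"
  proof -
    have "closedin Y (snd ` K)" using closed_map_snd[OF normal_compact, of Y] K_closed by (simp add: closed_map_def)
    moreover have "\<forall>g\<in>carrier G. \<forall>z\<in>snd ` K. \<psi> g z \<in> snd ` K"
    proof (intro ballI)
      fix g z assume gz: "g \<in> carrier G" "z \<in> snd ` K"
      then obtain S where z: "(S, z) \<in> K" by auto
      show "\<psi> g z \<in> snd ` K" using K_inv[OF _ z, of g] gz(1) by force
    qed
    moreover have "snd ` K \<noteq> {}" using K_nonempty by simp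
    ultimately show ?thesis
      using min[unfolded minimal_flow_def, THEN conjunct2, THEN spec, of "snd ` K"] by simp
  qed
  have single: "z1 = z2" if z: "(S, z1) \<in> K" "(S, z2) \<in> K" for S z1 z2
  proof (rule ccontr)
    assume ne: "z1 \<noteq> z2"
    have S: "S \<in> NO" and zY: "z1 \<in> topspace Y" "z2 \<in> topspace Y" using z K_sub by auto
    obtain f where f: "continuous_map Y euclideanreal f" "\<And>y. y \<in> topspace Y \<Longrightarrow> 0 \<le> f y \<and> f y \<le> 1" "f z1 = 0" "f z2 = 1"
      using Y.separation[OF zY ne] by blast
    have uf: "unit_function Y f" using f(1,2) by (simp add: unit_function_def)
    from close[rule_format, OF uf] obtain F where F: "finite F" "F \<subseteq> U" and Fc: "\<forall>L e g1 g2. label_seq u I L \<longrightarrow> emb I C L e \<longrightarrow>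
         F \<subseteq> e ` Pow {..<length L} \<longrightarrow> g1 \<in> A \<longrightarrow> g2 \<in> A \<longrightarrow>
         ordered_emb I C R L (\<lambda>X. g1 (e X)) \<longrightarrow> ordered_emb I C R L (\<lambda>X. g2 (e X)) \<longrightarrow>
         \<bar>f (\<psi> (inv\<^bsub>G\<^esub> g1) y) - f (\<psi> (inv\<^bsub>G\<^esub> g2) y)\<bar> \<le> 3/10" by (elim exE conjE)
    from NO_cover[OF S F] obtain L e where L: "label_seq u I L" "ordered_emb I C S L e" "F \<subseteq> e ` Pow {..<length L}"
      by (elim exE conjE)
    have em: "emb I C L e" using L(2) by (simp add: ordered_emb_def)
    define D where "D = e ` Pow {..<length L} \<times> e ` Pow {..<length L}"
    have D: "finite D" "D \<subseteq> U \<times> U" using emb_struct(1)[OF em] by (auto simp: D_def)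
    let ?W = "{S' \<in> NO. \<forall>p\<in>D. p \<in> S' \<longleftrightarrow> p \<in> S}"
    have W: "openin X ?W" by (rule openin_agreement[OF D])
    \<comment> \<open>Near \<open>(S, z)\<close> there are points of the orbit whose ordering agrees with \<open>S\<close> on the range of \<open>e\<close>.\<close>
    have approx: "\<exists>g\<in>A. f (\<psi> g y) \<in> V \<and> ordered_emb I C R L (\<lambda>X. (inv\<^bsub>G\<^esub> g) (e X))"
      if V: "open V" "f z \<in> V" and zK: "(S, z) \<in> K" for V z
    proof -
      let ?V = "{z \<in> topspace Y. f z \<in> V}"
      have oV: "openin Y ?V" by (rule openin_continuous_map_preimage[OF f(1)]) (use V(1) in simp)
      have "openin ?Z (?W \<times> ?V)" using W oV by (simp only: openin_prod_Times_iff simp_thms)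
      moreover have "z \<in> topspace Y" using zK K_sub by blast
      hence "(S, z) \<in> ?W \<times> ?V" using S V(2) by simp
      moreover have "(S, z) \<in> ?Z closure_of orb" using zK by (simp add: K_def)
      ultimately have "\<exists>q. q \<in> orb \<and> q \<in> ?W \<times> ?V" unfolding in_closure_of by meson
      then obtain q where "q \<in> orb" "q \<in> ?W \<times> ?V" by (elim exE conjE)
      then obtain g where g: "g \<in> A" "act g R \<in> ?W" "\<psi> g y \<in> ?V" unfolding orb_def by blast
      have "ordered_emb I C (act g R) L e"
      proof -
        have "(e Z1, e Z2) \<in> act g R \<longleftrightarrow> (e Z1, e Z2) \<in> S" if "Z1 \<subseteq> {..<length L}" "Z2 \<subseteq> {..<length L}" for Z1 Z2
        proof -
          have "(e Z1, e Z2) \<in> D" using that by (auto simp: D_def)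
          thus ?thesis using g(2) by blast
        qed
        thus ?thesis using L(2) unfolding ordered_emb_def by simp
      qed
      from ordered_emb_act_inv[OF g(1) this] show ?thesis using g(1,3) by blast
    qed
    obtain g1 where g1: "g1 \<in> A" "f (\<psi> g1 y) \<in> {..<1/10}" "ordered_emb I C R L (\<lambda>X. (inv\<^bsub>G\<^esub> g1) (e X))"
      using approx[of "{..<1/10}" z1] f(3) z(1) by auto
    obtain g2 where g2: "g2 \<in> A" "f (\<psi> g2 y) \<in> {9/10<..}" "ordered_emb I C R L (\<lambda>X. (inv\<^bsub>G\<^esub> g2) (e X))"
      using approx[of "{9/10<..}" z2] f(4) z(2) by auto
    have ii: "inv\<^bsub>G\<^esub> (inv\<^bsub>G\<^esub> g) = g" if "g \<in> A" for g by (rule G.inv_inv) (use that in simp)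
    have "\<bar>f (\<psi> (inv\<^bsub>G\<^esub> (inv\<^bsub>G\<^esub> g1)) y) - f (\<psi> (inv\<^bsub>G\<^esub> (inv\<^bsub>G\<^esub> g2)) y)\<bar> \<le> 3/10"
      by (rule Fc[rule_format, OF L(1) em L(3) inv_mem[OF g1(1)] inv_mem[OF g2(1)] g1(3) g2(3)])
    thus False unfolding ii[OF g1(1)] ii[OF g2(1)] using g1(2) g2(2) by simp
  qed
  define p where "p S = (THE z. (S, z) \<in> K)" for S
  have p: "p S = z" if "(S, z) \<in> K" for S z
    unfolding p_def using that single by (intro the_equality) auto
  have pK: "(S, p S) \<in> K" if "S \<in> NO" for S
  proof -
    obtain z where "(S, z) \<in> K" using fst_K \<open>S \<in> NO\<close> by force
    thus ?thesis using p by metis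
  qed
  have "continuous_map X Y p"
    unfolding continuous_map_closedin
  proof (intro conjI allI impI)
    show "p \<in> topspace X \<rightarrow> topspace Y" using pK K_sub unfolding topspace_normal by blast
    fix D assume D: "closedin Y D"
    have "closedin ?Z (K \<inter> topspace X \<times> D)"
      by (intro closedin_Int K_closed) (simp add: closedin_prod_Times_iff D)
    hence "closedin X (fst ` (K \<inter> topspace X \<times> D))" using closed_map_fst[OF Y.compact, of X] by (simp add: closed_map_def)
    moreover have "fst ` (K \<inter> topspace X \<times> D) = {S \<in> topspace X. p S \<in> D}"
      unfolding topspace_normal
    proof (intro equalityI subsetI)
      fix S assume "S \<in> fst ` (K \<inter> NO \<times> D)"
      then obtain z where "(S, z) \<in> K" "S \<in> NO" "z \<in> D" by auto
      thus "S \<in> {S \<in> NO. p S \<in> D}" using p[of S z] by simp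
    next
      fix S assume "S \<in> {S \<in> NO. p S \<in> D}"
      hence "(S, p S) \<in> K \<inter> NO \<times> D" using pK by simp
      thus "S \<in> fst ` (K \<inter> NO \<times> D)" by (rule image_eqI[rotated]) simp
    qed
    ultimately show "closedin X {S \<in> topspace X. p S \<in> D}" by simp
  qed
  moreover have "p ` topspace X = topspace Y"
  proof (intro equalityI subsetI)
    fix z assume "z \<in> topspace Y"
    then obtain S where S: "(S, z) \<in> K" unfolding snd_K[symmetric] by auto
    hence "S \<in> NO" using K_sub by blast
    thus "z \<in> p ` topspace X" unfolding topspace_normal using p[OF S] by (intro image_eqI[of _ _ S]) simp_all
  next
    fix z assume "z \<in> p ` topspace X"
    then obtain S where "S \<in> NO" "z = p S" unfolding topspace_normal by blast
    thus "z \<in> topspace Y" using pK[of S] K_sub by blast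
  qed
  moreover have "p (normal_action I C g S) = \<psi> g (p S)" if "g \<in> A" "S \<in> NO" for g S
    unfolding actN[OF that] by (rule p[OF K_inv[OF that(1) pK[OF that(2)]]])
  ultimately show ?thesis unfolding flow_factor_def topspace_normal by auto
qed

theorem normal_orderings_universal_minimal:
  "universal_minimal_flow TYPE('x) (Aut (ideal_lang I) C) (Aut_topology (ideal_lang I) C)
     (normal_topology I C) (normal_action I C)"
  unfolding universal_minimal_flow_def Aut_eq using normal_minimal normal_universal by blast

end

text \<open>The three classes are instances of \<open>ideal_class u I\<close>, with \<open>u\<close> telling whether the free atom is unique.\<close>

theorem theorem8:
  fixes J I :: "'j::linorder set" and z :: 'j
    and B :: "(nat, 'j) ideal_struct set"
    and C :: "('a, 'j) ideal_struct"
    and C_ord :: "('b, bool_sym, 'j ord_sym) struct"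
  assumes "countable J"
    and "(I = J \<and> B = class_B J) \<or> (I = {z} \<and> B = class_B_u z) \<or> (I = J \<and> B = class_B_J_u J)"
    and "fraisse_limit (ideal_lang I) B C"
    and "fraisse_limit (ord_lang I) (class_NA I B) C_ord"
  shows "universal_minimal_flow TYPE('x) (Aut (ideal_lang I) C) (Aut_topology (ideal_lang I) C)
           (normal_topology I C) (normal_action I C) \<and>
         extremely_amenable TYPE('y) (Aut (ord_lang I) C_ord) (Aut_topology (ord_lang I) C_ord)"
proof -
  obtain u where B: "B = ideal_class u I"
  proof -
    have "B = ideal_class False I \<or> B = ideal_class True I"
      using assms(2) class_B_u_eq[of z] by (auto simp: ideal_class_def)
    thus thesis using that by blast
  qed
  interpret C: ideal_limit u I C by unfold_locales (use assms(3) B in simp)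
  interpret C_ord: ordered_limit u I C_ord by unfold_locales (use assms(4) B in simp)
  show ?thesis using C.normal_orderings_universal_minimal C_ord.Aut_extremely_amenable by blast
qed

end
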